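(* For every $\delta>0$ there exists a constant $C>0$ (depending only on $\delta$) such that $$\operatorname{Fav}(\mathcal{K}_n)\le C\,n^{\delta-1/6}\qquad\text{for all integers } n\ge 1,$$ where $\mathcal{K}_n=\mathcal{C}_n\times\mathcal{C}_n\subset\mathbb{R}^2$ is the $n$-th generation in the construction of the four-corner Cantor set and $\operatorname{Fav}$ denotes Favard length.
   Context: For each integer $n\ge 1$, let $$\mathcal{C}_n=\bigcup_{a_1,\dots,a_n\in\{0,3\}}\Bigl[\sum_{j=1}^n a_j4^{-j},\ \sum_{j=1}^n a_j4^{-j}+4^{-n}\Bigr]\subset[0,1],$$ a union of $2^n$ closed intervals of length $4^{-n}$, and let $\mathcal{K}_n=\mathcal{C}_n\times\mathcal{C}_n$, a union of $4^n$ closed squares of side length $4^{-n}$. The Favard length of a planar set $E$ is $$\operatorname{Fav}(E)=\frac1\pi\int_0^\pi|\operatorname{Proj}\mathcal{R}_\theta E|\,d\theta,$$ where $\operatorname{Proj}:\mathbb{R}^2\to\mathbb{R}$, $\operatorname{Proj}(x,y)=x$, is the orthogonal projection to the horizontal axis, $\mathcal{R}_\theta$ is the counterclockwise rotation of $\mathbb{R}^2$ about the origin by angle $\theta$, and $|A|$ is the Lebesgue measure of a measurable set $A\subset\mathbb{R}$. *)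

theory Defs
  imports "HOL-Analysis.Analysis"
begin

definition cantor_gen :: "nat \<Rightarrow> real set" where
  "cantor_gen n =
     (\<Union>a \<in> {1..n} \<rightarrow>\<^sub>E {0, 3}.
        {(\<Sum>j = 1..n. a j / 4 ^ j) .. (\<Sum>j = 1..n. a j / 4 ^ j) + 1 / 4 ^ n})"

definition four_corner_gen :: "nat \<Rightarrow> (real \<times> real) set" where
  "four_corner_gen n = cantor_gen n \<times> cantor_gen n"

definition rotate_plane :: "real \<Rightarrow> real \<times> real \<Rightarrow> real \<times> real" where
  "rotate_plane \<theta> = (\<lambda>(x, y). (x * cos \<theta> - y * sin \<theta>, x * sin \<theta> + y * cos \<theta>))"

(* Extended nonnegative values are used so that neither an infinite measure nor a
   non-integrable integrand is silently sent to 0. For compact E, in particular for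
   four_corner_gen n, all the projections are compact, hence measurable. *)
definition favard_length :: "(real \<times> real) set \<Rightarrow> ennreal" where
  "favard_length E =
     (\<integral>\<^sup>+\<theta> \<in> {0..pi}. emeasure lebesgue (fst ` rotate_plane \<theta> ` E) \<partial>lebesgue) / ennreal pi"

lemma compact_four_corner_gen: "compact (four_corner_gen n)"
  unfolding four_corner_gen_def cantor_gen_def
  by (intro compact_Times compact_UN finite_PiE) auto

lemma compact_projection:
  assumes "compact E"
  shows "compact (fst ` rotate_plane \<theta> ` E)"
  unfolding rotate_plane_def case_prod_unfold
  by (intro compact_continuous_image continuous_intros assms)

end

theory Submission
  imports Defs
begin

text \<open>
Up to a bounded factor, the projection of generation \<open>n\<close> in a given direction is covered by the union of \<open>4 ^ n\<close>
intervals of radius \<open>4 ^ (- n)\<close> about the points \<open>\<Sum>j. (e j + t * e' j) / 4 ^ j\<close>, where \<open>e\<close> and \<open>e'\<close> run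
over sequences of signs and the slope \<open>t\<close> may be taken in \<open>[0, 1]\<close> by symmetry. The heart of the proof is
the statement that for every \<open>K = 2 ^ i\<close> the length of this union is at most \<open>8 / K\<close> outside a set of
slopes of measure \<open>O(K * n powr (- 1 / 6))\<close> (lemma \<open>few_bad_directions\<close>). Superposing these bounds over the
dyadic values of \<open>K\<close> gives \<open>O(n powr (- 1 / 6) * ln n)\<close> for the mean over all slopes, and the logarithm is
absorbed by \<open>n powr \<delta>\<close>.

Fix \<open>K\<close> and a generation \<open>N\<close> of order \<open>n / (K * i)\<close>. Let the energy of a slope be the integral of the square of
the number of intervals of generation \<open>N\<close> over a point.

Slopes of energy above \<open>4 * K\<close> have short projections, for a combinatorial reason. Mark the first place where at
least \<open>K\<close> intervals of some generation up to \<open>N\<close> are stacked over a bin of the same size. Self-similarity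
inside the marked bins shows that a large energy forces their total length to be at least of order
\<open>1 / K ^ 2\<close> (\<open>energy_le_if_few_heavy\<close>). The stacks then contain a share \<open>p\<close> of order at least \<open>1 / K\<close> of
all squares but project to a length of order \<open>p / K\<close> (\<open>heavy_gain\<close>). Repeating this inside the remaining
squares, about \<open>K * i\<close> times, leaves a projection of length at most \<open>8 / K\<close>
(\<open>cover_length_le_if_energy_gt\<close>).

Slopes of energy at most \<open>4 * K\<close> are rare, for an analytic reason. The squared Fourier transform of the points is
a product of two Riesz products, one in the frequency \<open>u\<close> and one in \<open>t * u\<close>, and its integral over the
relevant frequencies is \<open>O(K)\<close> (\<open>integral_power_spectrum_le_energy\<close>). Divide the \<open>N\<close> scales into \<open>M\<close> blocks of
\<open>m\<close> scales with \<open>4 ^ m\<close> of order \<open>K\<close>; an average block receives only \<open>O(K / M)\<close>. On the other hand, the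
high-frequency factors alone have a definite mass on every block, because they are positive definite, and the
\<open>m\<close> low-frequency factors are bounded below by \<open>256 ^ (- m)\<close> times the squares of two sines. So the
high-frequency mass must sit near the zeros of these sines. But a weight with a singularity of exponent
\<open>- 1 / 3\<close> at every zero is still integrable against the Riesz products, uniformly in the number of factors, once
one also integrates over \<open>t\<close> (\<open>integral_weighted_mass_le\<close>). By Markov's inequality the mass can concentrate
near the zeros only for a set of slopes of measure \<open>O(1 / A)\<close>, where \<open>A ^ 6\<close> is of order \<open>M / K ^ 4\<close>
(\<open>block_lower_bound\<close>, \<open>total_weighted_mass_ge\<close>). The sixth power, and hence the exponent \<open>1 / 6\<close>,
comes from the exponent \<open>- 1 / 3\<close> of the weight against the square of the sines.
\<close>

section \<open>Words and the covering count\<close>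

definition digits :: "(real \<times> real) set" where
  "digits = {-1, 1} \<times> {-1, 1}"

definition words :: "nat \<Rightarrow> (real \<times> real) list set" where
  "words n = {w. set w \<subseteq> digits \<and> length w = n}"

text \<open>
A word of \<open>n\<close> digits names one of the \<open>4 ^ n\<close> squares of generation \<open>n\<close>. After centring the
Cantor set at \<open>0\<close> and rescaling it by \<open>2 / 3\<close>, the digits \<open>0\<close> and \<open>3\<close> become the signs \<open>-1\<close> and
\<open>1\<close>, and \<open>position t w\<close> is the image of the centre of the square under \<open>(x, y) \<mapsto> x + t * y\<close>. The
first letter of a word is its coarsest digit.
\<close>

primrec position :: "real \<Rightarrow> (real \<times> real) list \<Rightarrow> real" where
  "position t [] = 0"
| "position t (d # w) = (fst d + t * snd d + position t w) / 4"

lemma finite_digits [simp]: "finite digits"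
  by (simp add: digits_def)

lemma card_digits [simp]: "card digits = 4"
  by (simp add: digits_def card_cartesian_product)

lemma finite_words [simp]: "finite (words n)"
  unfolding words_def by (rule finite_lists_length_eq) simp

lemma card_words [simp]: "card (words n) = 4 ^ n"
  unfolding words_def by (simp add: card_lists_length_eq)

lemma words_0 [simp]: "words 0 = {[]}"
  by (auto simp: words_def)

lemma length_words: "w \<in> words n \<Longrightarrow> length w = n"
  by (simp add: words_def)

lemma sum_words_Suc:
  "(\<Sum>w\<in>words (Suc n). F w) = (\<Sum>d\<in>digits. \<Sum>w\<in>words n. F (d # w))"
proof -
  have "bij_betw (\<lambda>(d, w). d # w) (digits \<times> words n) (words (Suc n))"
    by (rule bij_betwI[where g = "\<lambda>w. (hd w, tl w)"])
       (auto simp: words_def length_Suc_conv)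
  then show ?thesis
    by (simp add: sum.cartesian_product sum.reindex_bij_betw[symmetric] case_prod_unfold)
qed

text \<open>
Sums over words split into prefixes and suffixes: this is how self-similarity enters.
\<close>

lemma sum_words_add:
  fixes F :: "(real \<times> real) list \<Rightarrow> 'b::comm_monoid_add"
  shows "(\<Sum>w\<in>words (k + n). F w) = (\<Sum>u\<in>words k. \<Sum>v\<in>words n. F (u @ v))"
  by (induction k arbitrary: F) (simp_all add: sum_words_Suc)

lemma append_in_words: "u \<in> words k \<Longrightarrow> v \<in> words n \<Longrightarrow> u @ v \<in> words (k + n)"
  by (auto simp: words_def)

lemma take_in_words: "w \<in> words n \<Longrightarrow> k \<le> n \<Longrightarrow> take k w \<in> words k"
  by (auto simp: words_def dest: in_set_takeD)

lemma drop_in_words: "w \<in> words n \<Longrightarrow> k \<le> n \<Longrightarrow> drop k w \<in> words (n - k)"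
  by (auto simp: words_def dest: in_set_dropD)

lemma position_append: "position t (u @ v) = position t u + position t v / 4 ^ length u"
  by (induction u) (auto simp: field_simps)

lemma abs_digit_le: "d \<in> digits \<Longrightarrow> \<bar>t\<bar> \<le> 1 \<Longrightarrow> \<bar>fst d + t * snd d\<bar> \<le> 2"
  by (auto simp: digits_def)

lemma abs_position_le:
  assumes "\<bar>t\<bar> \<le> 1" "w \<in> words n"
  shows "\<bar>position t w\<bar> \<le> 2 / 3 * (1 - 1 / 4 ^ n)"
  using assms(2)
proof (induction w arbitrary: n)
  case Nil
  then show ?case by (auto simp: words_def)
next
  case (Cons d w)
  then obtain k where k: "n = Suc k" "w \<in> words k" "d \<in> digits"
    by (auto simp: words_def)
  have "\<bar>fst d + t * snd d\<bar> \<le> 2" using abs_digit_le assms(1) k(3) by blast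
  moreover have "\<bar>position t w\<bar> \<le> 2 / 3 * (1 - 1 / 4 ^ k)" using Cons.IH k(2) by blast
  ultimately have "\<bar>fst d + t * snd d + position t w\<bar> \<le> 2 + 2 / 3 * (1 - 1 / 4 ^ k)"
    by linarith
  then show ?case using k(1) by (simp add: field_simps)
qed

text \<open>
The radius \<open>4 ^ (- n)\<close> of the intervals exceeds that of the projected squares, which is at most
\<open>2 / 3 * 4 ^ (- n)\<close>.
The slack is what makes the intervals of longer words nested in those of their prefixes.
\<close>

lemma abs_position_prefix_le:
  assumes "\<bar>t\<bar> \<le> 1" "v \<in> words n" "\<bar>x - position t (u @ v)\<bar> \<le> 1 / 4 ^ (length u + n)"
  shows "\<bar>x - position t u\<bar> \<le> 1 / 4 ^ length u"
proof -
  have "\<bar>x - position t u\<bar> \<le> \<bar>x - position t (u @ v)\<bar> + \<bar>position t v / 4 ^ length u\<bar>"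
    unfolding position_append by linarith
  also have "\<dots> \<le> 1 / 4 ^ (length u + n) + 2 / 3 * (1 - 1 / 4 ^ n) / 4 ^ length u"
    using assms(3) divide_right_mono[OF abs_position_le[OF assms(1,2)], of "4 ^ length u"]
    by (intro add_mono) (auto simp: abs_divide)
  also have "\<dots> = (2 / 3 + 1 / 3 / 4 ^ n) / 4 ^ length u"
    by (simp add: power_add field_simps)
  also have "\<dots> \<le> 1 / 4 ^ length u"
    by (intro divide_right_mono) (auto simp: field_simps)
  finally show ?thesis .
qed

definition word_interval :: "real \<Rightarrow> (real \<times> real) list \<Rightarrow> real set" where
  "word_interval t w = {position t w - 1 / 4 ^ length w .. position t w + 1 / 4 ^ length w}"

lemma mem_word_interval: "x \<in> word_interval t w \<longleftrightarrow> \<bar>x - position t w\<bar> \<le> 1 / 4 ^ length w"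
  unfolding word_interval_def by (auto simp: abs_le_iff)

lemma word_interval_append:
  assumes "\<bar>t\<bar> \<le> 1" "v \<in> words n"
  shows "word_interval t (u @ v) \<subseteq> word_interval t u"
  using abs_position_prefix_le[OF assms] length_words[OF assms(2)] by (auto simp: mem_word_interval)

lemma mem_word_interval_append:
  "x \<in> word_interval t (u @ v) \<longleftrightarrow> 4 ^ length u * (x - position t u) \<in> word_interval t v"
proof -
  have "\<bar>x - position t (u @ v)\<bar> = \<bar>4 ^ length u * (x - position t u) - position t v\<bar> / 4 ^ length u"
  proof -
    have "x - position t (u @ v) = (4 ^ length u * (x - position t u) - position t v) / 4 ^ length u"
      by (simp add: position_append field_simps)
    then show ?thesis by simp
  qed
  moreover have "b / c \<le> 1 / (c * d) \<longleftrightarrow> b \<le> 1 / d" if "c > 0" "d > 0" for b c d :: real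
    using that by (simp add: field_simps)
  ultimately show ?thesis unfolding mem_word_interval
    by (simp add: power_add)
qed

definition cover_count :: "real \<Rightarrow> nat \<Rightarrow> real \<Rightarrow> real" where
  "cover_count t n x = (\<Sum>w\<in>words n. indicator (word_interval t w) x)"

text \<open>
The square of the \<open>L\<close>-two norm of the covering count. Since the count has integral \<open>2\<close>, a small energy says that the
projected squares overlap little.
\<close>

definition energy :: "real \<Rightarrow> nat \<Rightarrow> real" where
  "energy t n = (LINT x|lborel. (cover_count t n x)\<^sup>2)"

lemma cover_count_nonneg: "cover_count t n x \<ge> 0"
  unfolding cover_count_def by (intro sum_nonneg) auto

lemma cover_count_add: "cover_count t (k + n) x = (\<Sum>u\<in>words k. cover_count t n (4 ^ k * (x - position t u)))"
  unfolding cover_count_def sum_words_add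
  by (intro sum.cong refl) (simp add: indicator_def mem_word_interval_append length_words)

lemma cover_count_zero:
  assumes "\<bar>t\<bar> \<le> 1" "\<bar>x\<bar> > 1"
  shows "cover_count t n x = 0"
  unfolding cover_count_def
proof (intro sum.neutral ballI)
  fix w assume w: "w \<in> words n"
  have "x \<notin> word_interval t w"
    using word_interval_append[OF assms(1) w, of "[]"] assms(2) mem_word_interval[of x t "[]"]
    by auto
  then show "indicator (word_interval t w) x = (0::real)" by simp
qed

lemma word_interval_meas [measurable, simp]: "word_interval t w \<in> sets borel"
  by (simp add: word_interval_def)

lemma cover_count_meas [measurable]: "cover_count t n \<in> borel_measurable borel"
  unfolding cover_count_def by measurable

lemma integrable_indicator_word_interval:
  "integrable lborel (indicator (word_interval t w) :: real \<Rightarrow> real)"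
  by (simp add: word_interval_def)

lemma integrable_cover_count: "integrable lborel (cover_count t n)"
  unfolding cover_count_def
  by (intro Bochner_Integration.integrable_sum integrable_indicator_word_interval)

lemma integrable_cover_count_sq: "integrable lborel (\<lambda>x. (cover_count t n x)\<^sup>2)"
proof -
  have "integrable lborel
      (\<lambda>x. \<Sum>w\<in>words n. \<Sum>v\<in>words n. indicator (word_interval t w) x * indicator (word_interval t v) x :: real)"
    by (intro Bochner_Integration.integrable_sum integrable_real_mult_indicator)
       (auto simp: integrable_indicator_word_interval)
  then show ?thesis
    unfolding cover_count_def power2_eq_square sum_product .
qed

lemma integral_cover_count: "(LINT x|lborel. cover_count t n x) = 2"
proof -
  have "(LINT x|lborel. cover_count t n x)
      = (\<Sum>w\<in>words n. LINT x|lborel. indicator (word_interval t w) x)"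
    unfolding cover_count_def by (intro Bochner_Integration.integral_sum integrable_indicator_word_interval)
  also have "\<dots> = (\<Sum>w\<in>words n. 2 / 4 ^ n)"
    by (intro sum.cong refl) (simp add: word_interval_def length_words)
  finally show ?thesis by simp
qed

lemma energy_nonneg: "energy t n \<ge> 0"
  unfolding energy_def by (rule integral_nonneg_AE) auto

lemma integral_cover_count_scaled:
  "integrable lborel (\<lambda>x. (cover_count t n (4 ^ k * (x - p)))\<^sup>2)"
  "(LINT x|lborel. (cover_count t n (4 ^ k * (x - p)))\<^sup>2) = energy t n / 4 ^ k"
proof -
  have *: "(\<lambda>x. (cover_count t n (4 ^ k * (x - p)))\<^sup>2) = (\<lambda>x. (cover_count t n (- (4 ^ k * p) + 4 ^ k * x))\<^sup>2)"
    by (simp add: algebra_simps)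
  show "integrable lborel (\<lambda>x. (cover_count t n (4 ^ k * (x - p)))\<^sup>2)"
    unfolding * by (rule lborel_integrable_real_affine[OF integrable_cover_count_sq]) simp
  show "(LINT x|lborel. (cover_count t n (4 ^ k * (x - p)))\<^sup>2) = energy t n / 4 ^ k"
    unfolding * energy_def
    using lborel_integral_real_affine[of "4 ^ k" "\<lambda>x. (cover_count t n x)\<^sup>2" "- (4 ^ k * p)"]
    by simp
qed

section \<open>Heavy bins and the energy\<close>

text \<open>
The condition says that the closed interval of \<open>w\<close> meets the closed bin
\<open>[j / 4 ^ k, (j + 1) / 4 ^ k]\<close>. Stated with integers, it passes from a word to its prefix by integer
division of \<open>j\<close> by \<open>4\<close>.
\<close>

definition touch :: "real \<Rightarrow> nat \<Rightarrow> int \<Rightarrow> (real \<times> real) list set" where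
  "touch t k j = {w \<in> words k. of_int j - 1 \<le> 4 ^ k * position t w \<and> 4 ^ k * position t w \<le> of_int j + 2}"

lemma finite_touch [simp]: "finite (touch t k j)"
  by (simp add: touch_def)

lemma touch_subset: "touch t k j \<subseteq> words k"
  by (auto simp: touch_def)

lemma card_touch_0: "card (touch t 0 j) \<le> 1"
  using card_mono[OF finite_words touch_subset, of t 0 j] by simp

text \<open>
A bin has at most four times as many intervals as its parent bin, because dropping the last letter of a
touching word gives a word that touches the parent bin.
\<close>

lemma card_touch_Suc:
  assumes "\<bar>t\<bar> \<le> 1"
  shows "card (touch t (Suc k) j) \<le> 4 * card (touch t k (j div 4))"
proof -
  have "card (touch t (Suc k) j) \<le> card (touch t k (j div 4) \<times> digits)"
  proof (rule card_inj_on_le[where f = "\<lambda>w. (butlast w, last w)"])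
    show "inj_on (\<lambda>w. (butlast w, last w)) (touch t (Suc k) j)"
    proof (rule inj_onI)
      fix v w assume "v \<in> touch t (Suc k) j" "w \<in> touch t (Suc k) j"
        and eq: "(butlast v, last v) = (butlast w, last w)"
      then have "v \<noteq> []" "w \<noteq> []" by (auto simp: touch_def words_def)
      then show "v = w" using eq append_butlast_last_id by (metis prod.inject)
    qed
    show "(\<lambda>w. (butlast w, last w)) ` touch t (Suc k) j \<subseteq> touch t k (j div 4) \<times> digits"
    proof clarsimp
      fix w assume w: "w \<in> touch t (Suc k) j"
      define u d where "u = butlast w" and "d = last w"
      have "w \<noteq> []" using w by (auto simp: touch_def words_def)
      then have wud: "w = u @ [d]" unfolding u_def d_def by simp
      have ud: "u \<in> words k" "d \<in> digits"
        using w unfolding wud by (auto simp: touch_def words_def)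
      have p: "4 ^ Suc k * position t w = 4 * (4 ^ k * position t u) + (fst d + t * snd d)"
        using ud(1) unfolding wud by (simp add: position_append length_words field_simps)
      have j: "of_int j = 4 * of_int (j div 4) + (of_int (j mod 4) :: real)"
        by (metis mult_div_mod_eq of_int_add of_int_mult of_int_numeral)
      have m: "0 \<le> j mod 4" "j mod 4 \<le> 3" by auto
      then have m': "0 \<le> (of_int (j mod 4) :: real)" "(of_int (j mod 4) :: real) \<le> 3" 
        by auto
      have "u \<in> touch t k (j div 4)"
        using w p j m' abs_digit_le[OF ud(2) assms] ud(1) unfolding touch_def by auto
      then show "butlast w \<in> touch t k (j div 4) \<and> last w \<in> digits"
        using ud(2) unfolding u_def d_def by simp
    qed
  qed simp
  then show ?thesis by (simp add: card_cartesian_product)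
qed

lemma mem_touch_floor:
  assumes "w \<in> words n" "x \<in> word_interval t w"
  shows "w \<in> touch t n \<lfloor>4 ^ n * x\<rfloor>"
proof -
  have "\<bar>x - position t w\<bar> \<le> 1 / 4 ^ n"
    using assms by (simp add: mem_word_interval length_words)
  then have "4 ^ n * \<bar>x - position t w\<bar> \<le> 1" by (simp add: field_simps)
  moreover have "4 ^ n * \<bar>x - position t w\<bar> = \<bar>4 ^ n * x - 4 ^ n * position t w\<bar>"
    by (simp add: abs_mult right_diff_distrib[symmetric])
  moreover have "of_int \<lfloor>4 ^ n * x\<rfloor> \<le> 4 ^ n * x" "4 ^ n * x < of_int \<lfloor>4 ^ n * x\<rfloor> + 1" by linarith+
  ultimately have "of_int \<lfloor>4 ^ n * x\<rfloor> - 1 \<le> 4 ^ n * position t w"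
      "4 ^ n * position t w \<le> of_int \<lfloor>4 ^ n * x\<rfloor> + 2"
    by linarith+
  then show ?thesis using assms(1) unfolding touch_def by auto
qed

lemma floor_div_power:
  fixes x :: real
  assumes "i \<le> k"
  shows "\<lfloor>4 ^ k * x\<rfloor> div 4 ^ (k - i) = \<lfloor>4 ^ i * x\<rfloor>"
proof -
  have "(4::real) ^ k = 4 ^ i * 4 ^ (k - i)"
    using assms by (simp flip: power_add)
  then have "4 ^ i * x = 4 ^ k * x / real_of_int (4 ^ (k - i))"
    by simp
  then show ?thesis by (simp add: floor_divide_real_eq_div del: of_int_power)
qed

text \<open>
A stopping time: along every chain of nested bins, select the first bin that is touched by at least \<open>K\<close>
intervals of its own generation.
\<close>

definition heavy :: "real \<Rightarrow> nat \<Rightarrow> nat \<Rightarrow> (nat \<times> int) set" where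
  "heavy t K N = {(k, j). k \<le> N \<and> K \<le> card (touch t k j) \<and>
     (\<forall>i<k. card (touch t i (j div 4 ^ (k - i))) < K)}"

lemma heavyD:
  assumes "(k, j) \<in> heavy t K N"
  shows "k \<le> N" "K \<le> card (touch t k j)" "\<And>i. i < k \<Longrightarrow> card (touch t i (j div 4 ^ (k - i))) < K"
  using assms by (auto simp: heavy_def)

lemma finite_heavy:
  assumes "\<bar>t\<bar> \<le> 1" "K \<ge> 1"
  shows "finite (heavy t K N)"
proof (rule finite_subset)
  show "heavy t K N \<subseteq> (SIGMA k:{..N}. {- (4 ^ k) - 2 .. 4 ^ k + 1})"
  proof clarify
    fix k j assume kj: "(k, j) \<in> heavy t K N"
    have "touch t k j \<noteq> {}" using heavyD(2)[OF kj] assms(2) by auto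
    then obtain w where w: "w \<in> touch t k j" by auto
    have "\<bar>position t w\<bar> \<le> 2 / 3 * (1 - 1 / 4 ^ k)"
      using abs_position_le[OF assms(1)] w by (auto simp: touch_def)
    also have "\<dots> \<le> 1" by (simp add: field_simps)
    finally have "\<bar>4 ^ k * position t w\<bar> \<le> 4 ^ k" by (simp add: abs_mult)
    then have "real_of_int j \<le> 4 ^ k + 1" "- (4 ^ k) - 2 \<le> real_of_int j"
      using w by (auto simp: touch_def)
    then have "real_of_int j \<le> real_of_int (4 ^ k + 1)" "real_of_int (- (4 ^ k) - 2) \<le> real_of_int j"
      by simp_all
    then have "j \<le> 4 ^ k + 1" "- (4 ^ k) - 2 \<le> j" unfolding of_int_le_iff .
    then show "k \<in> {..N} \<and> j \<in> {- (4 ^ k) - 2..4 ^ k + 1}"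
      using heavyD(1)[OF kj] by auto
  qed
qed auto

text \<open>
Stopping at the first heavy bin bounds its multiplicity from above as well: the parent bin was touched by
fewer than \<open>K\<close> intervals.
\<close>

lemma card_touch_heavy_le:
  assumes "\<bar>t\<bar> \<le> 1" "K \<ge> 1" "(k, j) \<in> heavy t K N"
  shows "card (touch t k j) \<le> 4 * K"
proof (cases k)
  case 0
  then show ?thesis using card_touch_0[of t j] assms(2) by simp
next
  case (Suc i)
  have "card (touch t i (j div 4)) < K" using heavyD(3)[OF assms(3), of i] Suc by simp
  then show ?thesis using card_touch_Suc[OF assms(1), of i j] Suc by simp
qed

definition bin :: "nat \<Rightarrow> int \<Rightarrow> real set" where
  "bin k j = {of_int j / 4 ^ k ..< (of_int j + 1) / 4 ^ k}"

lemma mem_bin: "x \<in> bin k j \<longleftrightarrow> \<lfloor>4 ^ k * x\<rfloor> = j"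
  unfolding bin_def floor_eq_iff by (auto simp: field_simps)

lemma heavy_bins_disjoint:
  assumes "(k, j) \<in> heavy t K N" "(k', j') \<in> heavy t K N" "x \<in> bin k j" "x \<in> bin k' j'"
  shows "(k, j) = (k', j')"
proof -
  have le: "\<not> a < b" if "(a, c) \<in> heavy t K N" "(b, d) \<in> heavy t K N" "x \<in> bin a c" "x \<in> bin b d"
    for a b c d
  proof
    assume "a < b"
    have "d div 4 ^ (b - a) = c"
      using floor_div_power[of a b x] that(3,4) \<open>a < b\<close> by (simp add: mem_bin)
    then show False using heavyD(3)[OF that(2) \<open>a < b\<close>] heavyD(2)[OF that(1)] by simp
  qed
  have "k = k'" using le[OF assms] le[OF assms(2,1,4,3)] by simp
  then show ?thesis using assms(3,4) by (simp add: mem_bin)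
qed

lemma cover_count_le_card_touch: "cover_count t n x \<le> card (touch t n \<lfloor>4 ^ n * x\<rfloor>)"
proof -
  have "cover_count t n x \<le> (\<Sum>w\<in>words n. if w \<in> touch t n \<lfloor>4 ^ n * x\<rfloor> then 1 else 0)"
    unfolding cover_count_def by (intro sum_mono) (auto simp: indicator_def dest: mem_touch_floor)
  also have "\<dots> = card (words n \<inter> touch t n \<lfloor>4 ^ n * x\<rfloor>)"
    by (simp add: sum.If_cases Int_commute)
  also have "words n \<inter> touch t n \<lfloor>4 ^ n * x\<rfloor> = touch t n \<lfloor>4 ^ n * x\<rfloor>"
    using touch_subset by blast
  finally show ?thesis .
qed

lemma cover_count_localize:
  assumes "\<bar>t\<bar> \<le> 1" "k \<le> n"
  shows "cover_count t n x
    = (\<Sum>u\<in>touch t k \<lfloor>4 ^ k * x\<rfloor>. cover_count t (n - k) (4 ^ k * (x - position t u)))"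
proof -
  have "cover_count t n x = (\<Sum>u\<in>words k. cover_count t (n - k) (4 ^ k * (x - position t u)))"
    using cover_count_add[of t k "n - k" x] assms(2) by simp
  also have "\<dots> = (\<Sum>u\<in>touch t k \<lfloor>4 ^ k * x\<rfloor>. cover_count t (n - k) (4 ^ k * (x - position t u)))"
  proof (rule sum.mono_neutral_right)
    show "\<forall>u\<in>words k - touch t k \<lfloor>4 ^ k * x\<rfloor>. cover_count t (n - k) (4 ^ k * (x - position t u)) = 0"
    proof
      fix u assume u: "u \<in> words k - touch t k \<lfloor>4 ^ k * x\<rfloor>"
      then have "x \<notin> word_interval t u" using mem_touch_floor by blast
      moreover have "length u = k" using u length_words by blast
      ultimately have "\<not> \<bar>x - position t u\<bar> \<le> 1 / 4 ^ k" by (simp add: mem_word_interval)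
      then have "1 < 4 ^ k * \<bar>x - position t u\<bar>" by (simp add: field_simps)
      then have "1 < \<bar>4 ^ k * (x - position t u)\<bar>" by (simp add: abs_mult)
      then show "cover_count t (n - k) (4 ^ k * (x - position t u)) = 0"
        using cover_count_zero[OF assms(1)] by blast
    qed
  qed (auto simp: touch_subset)
  finally show ?thesis .
qed

text \<open>
Where no bin is heavy the count is at most \<open>K\<close>. Inside a heavy bin the count is a sum of at most
\<open>4 * K\<close> rescaled counts of later generations, and Cauchy-Schwarz costs only that factor.
\<close>

lemma cover_count_sq_le:
  assumes "\<bar>t\<bar> \<le> 1" "K \<ge> 1"
  shows "(cover_count t n x)\<^sup>2 \<le> real K * cover_count t n x +
    (\<Sum>(k, j)\<in>heavy t K n. 4 * real K * (\<Sum>u\<in>touch t k j. (cover_count t (n - k) (4 ^ k * (x - position t u)))\<^sup>2))"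
    (is "_ \<le> _ + (\<Sum>(k, j)\<in>_. ?g k j)")
proof -
  have g0: "0 \<le> ?g k j" for k j by (intro mult_nonneg_nonneg sum_nonneg) auto
  show ?thesis
  proof (cases "\<exists>k\<le>n. K \<le> card (touch t k \<lfloor>4 ^ k * x\<rfloor>)")
    case True
    define P where "P = (\<lambda>k. k \<le> n \<and> K \<le> card (touch t k \<lfloor>4 ^ k * x\<rfloor>))"
    define k where "k = (LEAST k. P k)"
    define j where "j = \<lfloor>4 ^ k * x\<rfloor>"
    have Pk: "P k" unfolding k_def using True LeastI_ex[of P] by (auto simp: P_def)
    have "card (touch t i (j div 4 ^ (k - i))) < K" if "i < k" for i
    proof -
      have "\<not> P i" using that not_less_Least unfolding k_def by blast
      then have "card (touch t i \<lfloor>4 ^ i * x\<rfloor>) < K" using Pk that by (auto simp: P_def)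
      then show ?thesis using floor_div_power[of i k x] that unfolding j_def by simp
    qed
    then have kj: "(k, j) \<in> heavy t K n" using Pk by (auto simp: heavy_def P_def j_def)
    have "(cover_count t n x)\<^sup>2
        = (\<Sum>u\<in>touch t k j. cover_count t (n - k) (4 ^ k * (x - position t u)))\<^sup>2"
      using cover_count_localize[OF assms(1), of k n x] Pk by (simp add: P_def j_def)
    also have "\<dots> \<le> (\<Sum>u\<in>touch t k j. (cover_count t (n - k) (4 ^ k * (x - position t u)))\<^sup>2) * card (touch t k j)"
      by (rule sum_squared_le_sum_of_squares)
    also have "\<dots> \<le> (\<Sum>u\<in>touch t k j. (cover_count t (n - k) (4 ^ k * (x - position t u)))\<^sup>2) * (4 * real K)"
      using card_touch_heavy_le[OF assms kj] by (intro mult_left_mono sum_nonneg) auto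
    also have "\<dots> = (\<lambda>(k, j). ?g k j) (k, j)" by simp
    also have "\<dots> \<le> (\<Sum>(k, j)\<in>heavy t K n. ?g k j)"
      using g0 by (intro member_le_sum[OF kj] finite_heavy assms) auto
    finally show ?thesis using cover_count_nonneg[of t n x] by (simp add: add_increasing)
  next
    case False
    then have "card (touch t n \<lfloor>4 ^ n * x\<rfloor>) < K" by auto
    then have "cover_count t n x \<le> real K" using cover_count_le_card_touch[of t n x] by linarith
    then have "(cover_count t n x)\<^sup>2 \<le> real K * cover_count t n x"
      unfolding power2_eq_square using cover_count_nonneg by (intro mult_right_mono)
    moreover have "0 \<le> (\<Sum>(k, j)\<in>heavy t K n. ?g k j)"
      using g0 by (intro sum_nonneg) auto
    ultimately show ?thesis by linarith
  qed
qed

lemma energy_recursion: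
  assumes "\<bar>t\<bar> \<le> 1" "K \<ge> 1"
  shows "energy t n \<le> 2 * real K +
    (\<Sum>(k, j)\<in>heavy t K n. 4 * real K * (\<Sum>u\<in>touch t k j. energy t (n - k) / 4 ^ k))"
proof -
  let ?h = "\<lambda>(k, j) x. 4 * real K * (\<Sum>u\<in>touch t k j. (cover_count t (n - k) (4 ^ k * (x - position t u)))\<^sup>2)"
  have int_h: "integrable lborel (?h kj)" for kj
    by (cases kj) (auto intro!: integral_cover_count_scaled(1))
  have LINT_h: "(LINT x|lborel. ?h (k, j) x) = 4 * real K * (\<Sum>u\<in>touch t k j. energy t (n - k) / 4 ^ k)" for k j
    by (simp add: integral_cover_count_scaled)
  have "energy t n \<le> (LINT x|lborel. real K * cover_count t n x + (\<Sum>kj\<in>heavy t K n. ?h kj x))"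
    unfolding energy_def
  proof (rule integral_mono)
    show "integrable lborel (\<lambda>x. real K * cover_count t n x + (\<Sum>kj\<in>heavy t K n. ?h kj x))"
      using int_h by (intro Bochner_Integration.integrable_add Bochner_Integration.integrable_sum
          integrable_mult_right integrable_cover_count)
  qed (use cover_count_sq_le[OF assms] integrable_cover_count_sq in \<open>auto simp: case_prod_unfold\<close>)
  also have "\<dots> = real K * 2 + (\<Sum>kj\<in>heavy t K n. LINT x|lborel. ?h kj x)"
    using int_h by (subst Bochner_Integration.integral_add)
      (auto intro!: Bochner_Integration.integrable_sum integrable_mult_right integrable_cover_count
        simp: Bochner_Integration.integral_sum integral_cover_count)
  also have "(\<Sum>kj\<in>heavy t K n. LINT x|lborel. ?h kj x)
      = (\<Sum>(k, j)\<in>heavy t K n. 4 * real K * (\<Sum>u\<in>touch t k j. energy t (n - k) / 4 ^ k))"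
    using LINT_h by (intro sum.cong) auto
  finally show ?thesis by (simp add: mult.commute)
qed

text \<open>
The recursion bounds the largest energy \<open>X\<close> by \<open>2 * K\<close> plus \<open>16 * K ^ 2\<close> times the total length of the
heavy bins times \<open>X\<close> itself. If the heavy bins are short, the last term is at most \<open>X / 2\<close> and can be
absorbed. In this way a single threshold \<open>K\<close> controls counts of arbitrary height.
\<close>

lemma energy_le_if_few_heavy:
  assumes "\<bar>t\<bar> \<le> 1" "K \<ge> 1"
    and few: "32 * (real K)\<^sup>2 * (\<Sum>(k, j)\<in>heavy t K N. 1 / 4 ^ k) \<le> 1"
  shows "energy t N \<le> 4 * real K"
proof -
  define X where "X = Max (energy t ` {..N})"
  have X: "energy t n \<le> X" if "n \<le> N" for n
    unfolding X_def using that by (intro Max_ge) auto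
  have X0: "X \<ge> 0" using X[of 0] energy_nonneg[of t 0] by simp
  \<comment> \<open>All generations up to \<open>N\<close> are treated together, since the recursion refers to the earlier ones.\<close>
  have "energy t n \<le> 2 * real K + X / 2" if n: "n \<le> N" for n
  proof -
    have "energy t n \<le> 2 * real K +
        (\<Sum>(k, j)\<in>heavy t K n. 4 * real K * (\<Sum>u\<in>touch t k j. energy t (n - k) / 4 ^ k))"
      using energy_recursion[OF assms(1,2)] .
    also have "(\<Sum>(k, j)\<in>heavy t K n. 4 * real K * (\<Sum>u\<in>touch t k j. energy t (n - k) / 4 ^ k))
        \<le> (\<Sum>(k, j)\<in>heavy t K n. 16 * (real K)\<^sup>2 * X * (1 / 4 ^ k))"
    proof (rule sum_mono, clarify)
      fix k j assume kj: "(k, j) \<in> heavy t K n"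
      have "(\<Sum>u\<in>touch t k j. energy t (n - k) / 4 ^ k) \<le> (\<Sum>u\<in>touch t k j. X / 4 ^ k)"
        using n by (intro sum_mono divide_right_mono X) auto
      also have "\<dots> = real (card (touch t k j)) * (X / 4 ^ k)" by simp
      also have "\<dots> \<le> real (4 * K) * (X / 4 ^ k)"
        using card_touch_heavy_le[OF assms(1,2) kj] X0 by (intro mult_right_mono of_nat_mono) auto
      finally have "4 * real K * (\<Sum>u\<in>touch t k j. energy t (n - k) / 4 ^ k)
          \<le> 4 * real K * (real (4 * K) * (X / 4 ^ k))"
        by (intro mult_left_mono) auto
      then show "4 * real K * (\<Sum>u\<in>touch t k j. energy t (n - k) / 4 ^ k)
          \<le> 16 * (real K)\<^sup>2 * X * (1 / 4 ^ k)"
        by (simp add: power2_eq_square)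
    qed
    also have "\<dots> \<le> (\<Sum>(k, j)\<in>heavy t K N. 16 * (real K)\<^sup>2 * X * (1 / 4 ^ k))"
      using n X0 by (intro sum_mono2 finite_heavy assms(1,2)) (auto simp: heavy_def)
    also have "\<dots> = X / 2 * (32 * (real K)\<^sup>2 * (\<Sum>(k, j)\<in>heavy t K N. 1 / 4 ^ k))"
      by (simp add: sum_distrib_left case_prod_unfold mult_ac)
    also have "\<dots> \<le> X / 2 * 1" using X0 few by (intro mult_left_mono) auto
    finally show ?thesis by simp
  qed
  moreover have "X \<in> energy t ` {..N}" unfolding X_def by (intro Max_in) auto
  ultimately have "X \<le> 2 * real K + X / 2" by auto
  then show ?thesis using X[of N] by simp
qed

section \<open>Overlaps shorten the projection\<close>

definition cover :: "real \<Rightarrow> nat \<Rightarrow> real set" where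
  "cover t n = (\<Union>w\<in>words n. word_interval t w)"

definition cover_length :: "real \<Rightarrow> nat \<Rightarrow> real" where
  "cover_length t n = measure lebesgue (cover t n)"

lemma lmeasurable_word_interval [simp]: "word_interval t w \<in> lmeasurable"
  by (simp add: word_interval_def)

lemma compact_cover: "compact (cover t n)"
  unfolding cover_def word_interval_def by (intro compact_UN) auto

lemma lmeasurable_cover [simp]: "cover t n \<in> lmeasurable"
  by (rule lmeasurable_compact[OF compact_cover])

lemma cover_length_nonneg: "cover_length t n \<ge> 0"
  by (simp add: cover_length_def)

lemma cover_length_le_2:
  assumes "\<bar>t\<bar> \<le> 1"
  shows "cover_length t n \<le> 2"
proof -
  have "cover t n \<subseteq> word_interval t []"
    unfolding cover_def using word_interval_append[OF assms, of _ n "[]"] by auto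
  then have "cover_length t n \<le> measure lebesgue (word_interval t [])"
    unfolding cover_length_def by (intro measure_mono_fmeasurable) (auto intro: fmeasurableD)
  then show ?thesis by (simp add: word_interval_def)
qed

lemma emeasure_affine_image:
  "emeasure lebesgue ((\<lambda>x::real. p + m * x) ` S) = ennreal \<bar>m\<bar> * emeasure lebesgue S"
  using emeasure_lebesgue_affine[of m p S] by (simp add: add.commute mult.commute)

lemma measure_affine_image:
  "measure lebesgue ((\<lambda>x::real. p + m * x) ` S) = \<bar>m\<bar> * measure lebesgue S"
  unfolding measure_def emeasure_affine_image by (simp add: enn2real_mult)

text \<open>
Split the squares of generation \<open>N\<close> into descendants of the antichain \<open>G\<close> and the rest. The former
stay inside the intervals of \<open>G\<close>; over each of the latter sits a copy of the whole set, scaled by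
\<open>4 ^ (- N)\<close>.
\<close>

lemma cover_length_recursion:
  assumes t: "\<bar>t\<bar> \<le> 1"
    and G: "finite G" "\<And>g. g \<in> G \<Longrightarrow> g \<in> words (length g) \<and> length g \<le> N"
    and antichain: "\<And>g v. g \<in> G \<Longrightarrow> g @ v \<in> G \<Longrightarrow> v = []"
  shows "(\<Sum>g\<in>G. 1 / 4 ^ length g) \<le> (1::real)"
    and "cover_length t (N + q) \<le> measure lebesgue (\<Union>g\<in>G. word_interval t g)
           + (1 - (\<Sum>g\<in>G. 1 / 4 ^ length g)) * cover_length t q"
proof -
  \<comment> \<open>The words of length \<open>N\<close> below \<open>g\<close>; distinct elements of an antichain have disjoint extensions.\<close>
  define ext where "ext = (\<lambda>g. (\<lambda>v. g @ v) ` words (N - length g))"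
  define B where "B = (\<Union>g\<in>G. ext g)"
  have B_sub: "B \<subseteq> words N"
  proof
    fix w assume "w \<in> B"
    then obtain g v where "g \<in> G" "v \<in> words (N - length g)" "w = g @ v"
      by (auto simp: B_def ext_def)
    then show "w \<in> words N" using append_in_words[of g "length g" v "N - length g"] G(2)[of g] by simp
  qed
  have disj: "ext g \<inter> ext h = {}" if gh: "g \<in> G" "h \<in> G" "g \<noteq> h" for g h
  proof (rule ccontr)
    assume "ext g \<inter> ext h \<noteq> {}"
    then obtain u v where "g @ u = h @ v" by (auto simp: ext_def)
    then obtain us where "g = h @ us \<or> g @ us = h" by (auto simp: append_eq_append_conv2)
    then show False using antichain gh by auto
  qed
  have "card B = (\<Sum>g\<in>G. card (ext g))"
    unfolding B_def using disj G(1) by (intro card_UN_disjoint) (auto simp: ext_def)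
  also have "\<dots> = (\<Sum>g\<in>G. 4 ^ (N - length g))"
    by (intro sum.cong refl) (auto simp: ext_def card_image inj_on_def)
  finally have "real (card B) = (\<Sum>g\<in>G. 4 ^ (N - length g))" by simp
  also have "\<dots> = (\<Sum>g\<in>G. 4 ^ N * (1 / 4 ^ length g))"
    using G(2) by (intro sum.cong refl) (simp add: power_diff)
  finally have card_B: "real (card B) = 4 ^ N * (\<Sum>g\<in>G. 1 / 4 ^ length g)"
    by (simp add: sum_distrib_left)
  have "card B \<le> 4 ^ N" using card_mono[OF finite_words B_sub] by simp
  then have "real (card B) \<le> 4 ^ N" by (metis of_nat_le_iff of_nat_numeral of_nat_power)
  then show "(\<Sum>g\<in>G. 1 / 4 ^ length g) \<le> (1::real)" unfolding card_B by simp
  have card_compl: "real (card (words N - B)) = 4 ^ N * (1 - (\<Sum>g\<in>G. 1 / 4 ^ length g))"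
    using card_Diff_subset[OF finite_subset[OF B_sub finite_words] B_sub] card_mono[OF finite_words B_sub]
    by (simp add: of_nat_diff card_B right_diff_distrib)
  define R where "R = (\<lambda>u. (\<lambda>x. position t u + 1 / 4 ^ N * x) ` cover t q)"
  have R_meas: "R u \<in> lmeasurable" for u
    unfolding R_def
    by (intro lmeasurable_compact compact_continuous_image compact_cover continuous_intros)
  have "cover t (N + q) \<subseteq> (\<Union>g\<in>G. word_interval t g) \<union> (\<Union>u\<in>words N - B. R u)"
  proof
    fix x assume "x \<in> cover t (N + q)"
    then obtain w where w: "w \<in> words (N + q)" "x \<in> word_interval t w" by (auto simp: cover_def)
    define u v where "u = take N w" and "v = drop N w"
    have uv: "w = u @ v" "u \<in> words N" "v \<in> words q"
      using take_in_words[OF w(1), of N] drop_in_words[OF w(1), of N] by (auto simp: u_def v_def)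
    show "x \<in> (\<Union>g\<in>G. word_interval t g) \<union> (\<Union>u\<in>words N - B. R u)"
    proof (cases "u \<in> B")
      case True
      then obtain g s where gs: "g \<in> G" "s \<in> words (N - length g)" "u = g @ s"
        by (auto simp: B_def ext_def)
      have "s @ v \<in> words (N - length g + q)" using append_in_words gs(2) uv(3) by blast
      then have "x \<in> word_interval t g"
        using word_interval_append[OF t, of "s @ v" _ g] w(2) uv(1) gs(3) by auto
      then show ?thesis using gs(1) by blast
    next
      case False
      define y where "y = 4 ^ N * (x - position t u)"
      have "y \<in> cover t q"
        using w(2) uv length_words[OF uv(2)] mem_word_interval_append[of x t u v]
        unfolding cover_def y_def by auto
      moreover have "x = position t u + 1 / 4 ^ N * y" by (simp add: y_def)
      ultimately have "x \<in> R u" unfolding R_def by blast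
      then show ?thesis using False uv(2) by blast
    qed
  qed
  then have "cover_length t (N + q)
      \<le> measure lebesgue ((\<Union>g\<in>G. word_interval t g) \<union> (\<Union>u\<in>words N - B. R u))"
    unfolding cover_length_def
    by (intro measure_mono_fmeasurable fmeasurable.Un fmeasurable.finite_UN)
       (auto simp: G R_meas fmeasurableD)
  also have "\<dots> \<le> measure lebesgue (\<Union>g\<in>G. word_interval t g) + measure lebesgue (\<Union>u\<in>words N - B. R u)"
    by (intro measure_Un_le fmeasurableD fmeasurable.finite_UN) (auto simp: G R_meas)
  also have "measure lebesgue (\<Union>u\<in>words N - B. R u) \<le> (\<Sum>u\<in>words N - B. measure lebesgue (R u))"
    by (intro measure_UNION_le fmeasurableD) (auto simp: R_meas)
  also have "\<dots> = (1 - (\<Sum>g\<in>G. 1 / 4 ^ length g)) * cover_length t q"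
  proof -
    have "measure lebesgue (R u) = cover_length t q / 4 ^ N" for u
      unfolding R_def measure_affine_image cover_length_def by simp
    then show ?thesis using card_compl by simp
  qed
  finally show "cover_length t (N + q) \<le> measure lebesgue (\<Union>g\<in>G. word_interval t g)
           + (1 - (\<Sum>g\<in>G. 1 / 4 ^ length g)) * cover_length t q"
    by simp
qed

text \<open>
Over a heavy bin at least \<open>K\<close> intervals lie on top of each other, so they project to a \<open>1 / K\<close> fraction
of their total length. A Vitali selection of disjoint enlarged bins turns them into an antichain whose share
\<open>p\<close> of all squares is comparable with \<open>K\<close> times the total length of the heavy bins.
\<close>

lemma heavy_gain:
  assumes t: "\<bar>t\<bar> \<le> 1" and K: "K \<ge> 1"
    and many: "32 * (real K)\<^sup>2 * (\<Sum>(k, j)\<in>heavy t K N. 1 / 4 ^ k) > 1"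
  obtains p where "1 / (960 * real K) \<le> p" "p \<le> 1"
    "\<And>q. cover_length t (N + q) \<le> 6 * p / real K + (1 - p) * cover_length t q"
proof -
  define a where "a = (\<lambda>(k::nat, j). (of_int j + 1 / 2) / 4 ^ k :: real)"
  \<comment> \<open>The bin has radius \<open>1 / 2 / 4 ^ k\<close>, and an interval that touches it reaches at most
    \<open>5 / 2 / 4 ^ k\<close> from its centre. The radius \<open>3 / 4 ^ k\<close> leaves room for open balls.\<close>
  define r where "r = (\<lambda>(k::nat, j::int). 3 / 4 ^ k :: real)"
  have r: "0 < r i \<and> r i \<le> 3" for i
    by (auto simp: r_def divide_le_eq split: prod.split)
  obtain C where "countable C" and C: "C \<subseteq> heavy t K N"
      "pairwise (\<lambda>i j. disjnt (ball (a i) (r i)) (ball (a j) (r j))) C"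
      "(\<Union>i\<in>heavy t K N. ball (a i) (r i)) \<subseteq> (\<Union>i\<in>C. ball (a i) (5 * r i))"
    by (rule Vitali_covering_lemma_balls[OF order_refl r, of "heavy t K N" a])
  have finC: "finite C" using C(1) finite_heavy[OF t K] finite_subset by blast
  have ball_measure: "measure lebesgue (ball (x::real) \<rho>) = 2 * \<rho>" if "\<rho> \<ge> 0" for x \<rho>
    using that by (simp add: ball_eq_greaterThanLessThan)
  have bin_ball: "bin k j \<subseteq> ball (a (k, j)) (r (k, j))" for k j
  proof
    fix x assume "x \<in> bin k j"
    then have "\<bar>x - (of_int j + 1 / 2) / 4 ^ k\<bar> \<le> 1 / 2 / 4 ^ k"
      by (auto simp: bin_def abs_le_iff field_simps)
    also have "\<dots> < 3 / 4 ^ k" by (intro divide_strict_right_mono) auto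
    finally show "x \<in> ball (a (k, j)) (r (k, j))" by (simp add: a_def r_def dist_real_def abs_minus_commute)
  qed
  have bin_lm: "bin k j \<in> lmeasurable" for k j
    unfolding bin_def by (intro bounded_set_imp_lmeasurable) auto
  have "(\<Sum>(k, j)\<in>heavy t K N. 1 / 4 ^ k) = (\<Sum>kj\<in>heavy t K N. measure lebesgue (case kj of (k, j) \<Rightarrow> bin k j))"
    by (intro sum.cong refl) (auto simp: bin_def divide_simps)
  also have "\<dots> = measure lebesgue (\<Union>kj\<in>heavy t K N. case kj of (k, j) \<Rightarrow> bin k j)"
  proof (rule measure_UNION'[symmetric])
    show "pairwise (\<lambda>i j. disjnt (case i of (k, j) \<Rightarrow> bin k j) (case j of (k, j) \<Rightarrow> bin k j)) (heavy t K N)"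
      unfolding pairwise_def disjnt_def using heavy_bins_disjoint by (fastforce split: prod.split)
  qed (use finite_heavy[OF t K] in \<open>auto simp: bin_lm split: prod.split\<close>)
  also have "\<dots> \<le> measure lebesgue (\<Union>i\<in>C. ball (a i) (5 * r i))"
  proof (rule measure_mono_fmeasurable)
    show "(\<Union>kj\<in>heavy t K N. case kj of (k, j) \<Rightarrow> bin k j) \<subseteq> (\<Union>i\<in>C. ball (a i) (5 * r i))"
      using C(3) bin_ball by fastforce
    show "(\<Union>kj\<in>heavy t K N. case kj of (k, j) \<Rightarrow> bin k j) \<in> sets lebesgue"
      by (intro fmeasurableD fmeasurable.finite_UN finite_heavy t K) (auto simp: bin_lm)
    show "(\<Union>i\<in>C. ball (a i) (5 * r i)) \<in> lmeasurable"
      by (intro fmeasurable.finite_UN finC) auto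
  qed
  also have "\<dots> \<le> (\<Sum>i\<in>C. measure lebesgue (ball (a i) (5 * r i)))"
    by (intro measure_UNION_le finC) auto
  also have "\<dots> = 30 * (\<Sum>(k, j)\<in>C. 1 / 4 ^ k)"
    unfolding sum_distrib_left
    by (intro sum.cong refl) (subst ball_measure; auto simp: r_def)
  finally have C_large: "(\<Sum>(k, j)\<in>heavy t K N. 1 / 4 ^ k) \<le> 30 * (\<Sum>(k, j)\<in>C. 1 / 4 ^ k :: real)" .

  define G where "G = (\<Union>(k, j)\<in>C. touch t k j)"
  have touch_ball: "word_interval t w \<subseteq> ball (a (k, j)) (r (k, j))" if "w \<in> touch t k j" for w k j
  proof
    fix x assume x: "x \<in> word_interval t w"
    have w: "of_int j - 1 \<le> 4 ^ k * position t w" "4 ^ k * position t w \<le> of_int j + 2" "length w = k"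
      using that by (auto simp: touch_def length_words)
    have "\<bar>position t w - (of_int j + 1 / 2) / 4 ^ k\<bar> \<le> (3 / 2) / 4 ^ k"
      using w(1,2) by (auto simp: abs_le_iff field_simps)
    moreover have "\<bar>x - position t w\<bar> \<le> 1 / 4 ^ k" using x w(3) by (simp add: mem_word_interval)
    ultimately have "\<bar>x - (of_int j + 1 / 2) / 4 ^ k\<bar> \<le> (3 / 2) / 4 ^ k + 1 / 4 ^ k" by linarith
    also have "\<dots> < 3 / 4 ^ k" by (simp add: field_simps)
    finally show "x \<in> ball (a (k, j)) (r (k, j))" by (simp add: a_def r_def dist_real_def abs_minus_commute)
  qed
  have sep: "(k, j) = (k', j')"
    if "(k, j) \<in> C" "(k', j') \<in> C" "w \<in> touch t k j" "w' \<in> touch t k' j'"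
      "x \<in> word_interval t w" "x \<in> word_interval t w'" for k j k' j' w w' x
    using C(2) that touch_ball[OF that(3)] touch_ball[OF that(4)]
    unfolding pairwise_def disjnt_def by blast
  have center: "position t w \<in> word_interval t w" for w by (simp add: mem_word_interval)
  have finG: "finite G" unfolding G_def using finC by auto
  have G_words: "g \<in> words (length g) \<and> length g \<le> N" if "g \<in> G" for g
    using that C(1) heavyD(1) by (fastforce simp: G_def touch_def words_def)
  have antichain: "v = []" if gv: "g \<in> G" "g @ v \<in> G" for g v
  proof -
    obtain k j k' j' where *: "(k, j) \<in> C" "(k', j') \<in> C" "g \<in> touch t k j" "g @ v \<in> touch t k' j'"
      using gv by (auto simp: G_def)
    have "v \<in> words (length v)" using *(4) by (auto simp: touch_def words_def)
    then have "position t (g @ v) \<in> word_interval t g"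
      using word_interval_append[OF t] center by blast
    then have "k = k'" using sep[OF * _ center] by blast
    then show ?thesis using *(3,4) by (auto simp: touch_def words_def)
  qed
  define p where "p = (\<Sum>g\<in>G. 1 / 4 ^ length g :: real)"
  have p_eq: "p = (\<Sum>(k, j)\<in>C. real (card (touch t k j)) / 4 ^ k)"
  proof -
    have "p = (\<Sum>kj\<in>C. \<Sum>g\<in>(case kj of (k, j) \<Rightarrow> touch t k j). 1 / 4 ^ length g)"
      unfolding p_def G_def using sep center finC
      by (intro sum.UNION_disjoint) (auto, blast+)
    also have "\<dots> = (\<Sum>(k, j)\<in>C. real (card (touch t k j)) / 4 ^ k)"
    proof (intro sum.cong refl, clarify)
      fix k j
      have "(\<Sum>g\<in>touch t k j. 1 / 4 ^ length g) = (\<Sum>g\<in>touch t k j. 1 / 4 ^ k :: real)"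
        by (intro sum.cong refl) (auto simp: touch_def length_words)
      then show "(\<Sum>g\<in>touch t k j. 1 / 4 ^ length g) = real (card (touch t k j)) / 4 ^ k" by simp
    qed
    finally show ?thesis .
  qed
  have p_ge: "real K * (\<Sum>(k, j)\<in>C. 1 / 4 ^ k) \<le> p"
    unfolding p_eq sum_distrib_left using C(1) heavyD(2)
    by (intro sum_mono) (force simp: intro!: divide_right_mono)
  \<comment> \<open>Here \<open>960 = 30 * 32\<close>: the Vitali balls have length \<open>2 * 5 * 3 / 4 ^ k\<close>, and \<open>32\<close> comes from the hypothesis.\<close>
  have "1 / (960 * real K) \<le> real K * (1 / 30 * (1 / (32 * (real K)\<^sup>2)))"
    using K by (simp add: power2_eq_square)
  also have "\<dots> \<le> real K * (1 / 30 * (\<Sum>(k, j)\<in>heavy t K N. 1 / 4 ^ k))"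
    using many K by (intro mult_left_mono) (auto simp: divide_simps mult_ac)
  also have "\<dots> \<le> real K * (\<Sum>(k, j)\<in>C. 1 / 4 ^ k)"
    using C_large by (intro mult_left_mono) auto
  also note p_ge
  finally have p_lower: "1 / (960 * real K) \<le> p" .
  have "measure lebesgue (\<Union>g\<in>G. word_interval t g) \<le> measure lebesgue (\<Union>i\<in>C. ball (a i) (r i))"
  proof (rule measure_mono_fmeasurable)
    show "(\<Union>g\<in>G. word_interval t g) \<subseteq> (\<Union>i\<in>C. ball (a i) (r i))"
      unfolding G_def using touch_ball by fastforce
    show "(\<Union>g\<in>G. word_interval t g) \<in> sets lebesgue"
      by (intro fmeasurableD fmeasurable.finite_UN finG) auto
    show "(\<Union>i\<in>C. ball (a i) (r i)) \<in> lmeasurable"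
      by (intro fmeasurable.finite_UN finC) auto
  qed
  also have "\<dots> \<le> (\<Sum>i\<in>C. measure lebesgue (ball (a i) (r i)))"
    by (intro measure_UNION_le finC) auto
  also have "\<dots> = 6 * (\<Sum>(k, j)\<in>C. 1 / 4 ^ k)"
    unfolding sum_distrib_left by (intro sum.cong refl) (subst ball_measure; auto simp: r_def)
  also have "\<dots> \<le> 6 * p / real K" using p_ge K by (simp add: field_simps)
  finally have union: "measure lebesgue (\<Union>g\<in>G. word_interval t g) \<le> 6 * p / real K" .
  show thesis
  proof (rule that[OF p_lower])
    show "p \<le> 1" unfolding p_def
      by (rule cover_length_recursion(1)[OF t finG]) (use G_words antichain in blast)+
    fix q
    have "cover_length t (N + q) \<le> measure lebesgue (\<Union>g\<in>G. word_interval t g) + (1 - p) * cover_length t q"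
      unfolding p_def
      by (rule cover_length_recursion(2)[OF t finG]) (use G_words antichain in blast)+
    then show "cover_length t (N + q) \<le> 6 * p / real K + (1 - p) * cover_length t q"
      using union by linarith
  qed
qed

text \<open>
Each round removes the fraction \<open>p\<close> of the remaining squares and adds \<open>b\<close> times the removed share
to the length. The shares add up to at most \<open>1\<close>, and what remains decays geometrically.
\<close>

lemma cover_length_iterate:
  assumes "\<bar>t\<bar> \<le> 1" "0 \<le> p" "p \<le> 1" "b \<ge> 0"
    and rec: "\<And>q. cover_length t (N + q) \<le> b * p + (1 - p) * cover_length t q"
  shows "cover_length t (r * N + q) \<le> b + 2 * (1 - p) ^ r"
proof (induction r)
  case 0
  then show ?case using cover_length_le_2[OF assms(1), of q] assms(4) by simp
next
  case (Suc r)
  have "cover_length t (Suc r * N + q) \<le> b * p + (1 - p) * cover_length t (r * N + q)"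
    using rec[of "r * N + q"] by (simp add: algebra_simps)
  also have "\<dots> \<le> b * p + (1 - p) * (b + 2 * (1 - p) ^ r)"
    using Suc.IH assms by (intro add_left_mono mult_left_mono) auto
  finally show ?case by (simp add: algebra_simps)
qed

text \<open>
The combinatorial half of the proof. Since \<open>p\<close> is at least of order \<open>1 / K\<close> with \<open>K = 2 ^ i\<close>, about
\<open>K * i\<close> rounds of length \<open>N\<close> push the remaining share below \<open>1 / K\<close>.
\<close>

lemma cover_length_le_if_energy_gt:
  assumes t: "\<bar>t\<bar> \<le> 1" and e: "energy t N > 4 * 2 ^ i" and n: "960 * 2 ^ i * i * N \<le> n"
  shows "cover_length t n \<le> 8 / 2 ^ i"
proof -
  have "32 * (real (2 ^ i))\<^sup>2 * (\<Sum>(k, j)\<in>heavy t (2 ^ i) N. 1 / 4 ^ k) > 1"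
    using energy_le_if_few_heavy[OF t, of "2 ^ i" N] e by (auto simp: not_le[symmetric])
  then obtain p where p: "1 / (960 * real (2 ^ i)) \<le> p" "p \<le> 1"
      "\<And>q. cover_length t (N + q) \<le> 6 * p / real (2 ^ i) + (1 - p) * cover_length t q"
    using heavy_gain[OF t, of "2 ^ i" N] by auto
  define r where "r = 960 * 2 ^ i * i"
  have p0: "0 \<le> p" using p(1) by (rule order_trans[rotated]) simp
  have "cover_length t (r * N + (n - r * N)) \<le> 6 / 2 ^ i + 2 * (1 - p) ^ r"
    using p p0 by (intro cover_length_iterate t) auto
  moreover have "r * N + (n - r * N) = n" using n by (simp add: r_def)
  moreover have "(1 - p) ^ r \<le> 1 / 2 ^ i"
  proof -
    have "(1 - p) ^ r \<le> exp (- p) ^ r"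
      using p(2) exp_ge_add_one_self[of "- p"] by (intro power_mono) auto
    also have "\<dots> = exp (- (real r * p))" by (simp add: exp_of_nat_mult[symmetric])
    also have "\<dots> \<le> exp (- real i)"
    proof -
      have "real i = real r * (1 / (960 * real (2 ^ i)))" by (simp add: r_def)
      also have "\<dots> \<le> real r * p" using p(1) by (intro mult_left_mono) auto
      finally show ?thesis by simp
    qed
    also have "\<dots> = exp (- 1) ^ i" by (simp add: exp_of_nat_mult[symmetric])
    also have "\<dots> \<le> (1 / 2) ^ i"
      using exp_ge_add_one_self[of 1] by (intro power_mono) (auto simp: exp_minus divide_simps)
    finally show ?thesis by (simp add: power_one_over)
  qed
  ultimately show ?thesis by simp
qed

section \<open>The energy bounds the Fourier transform\<close>

text \<open>
By \<open>cos x ^ 2 = (1 + cos (2 * x)) / 2\<close> this is, up to the factor \<open>2 ^ (- l)\<close>, the classical Riesz product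
with frequencies \<open>2 * 4 ^ j\<close>.
\<close>

definition riesz :: "nat \<Rightarrow> real \<Rightarrow> real" where
  "riesz l x = (\<Prod>j<l. (cos (4 ^ j * x))\<^sup>2)"

lemma riesz_0 [simp]: "riesz 0 x = 1"
  by (simp add: riesz_def)

lemma riesz_Suc: "riesz (Suc l) x = riesz l x * (cos (4 ^ l * x))\<^sup>2"
  by (simp add: riesz_def)

lemma riesz_add: "riesz (m + l) x = riesz m x * riesz l (4 ^ m * x)"
  by (induction l) (simp_all add: riesz_Suc power_add mult_ac)

lemma riesz_Suc_shift: "riesz (Suc l) x = (cos x)\<^sup>2 * riesz l (4 * x)"
  using riesz_add[of 1 l x] by (simp add: riesz_def)

lemma riesz_nonneg: "0 \<le> riesz l x"
  unfolding riesz_def by (intro prod_nonneg) auto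

lemma continuous_on_riesz [continuous_intros]:
  fixes f :: "'a::t2_space \<Rightarrow> real"
  shows "continuous_on S f \<Longrightarrow> continuous_on S (\<lambda>x. riesz l (f x))"
  unfolding riesz_def by (auto intro!: continuous_intros)

lemma riesz_minus [simp]: "riesz l (- x) = riesz l x"
  by (simp add: riesz_def)

lemma riesz_periodic: "riesz l (x + pi) = riesz l x"
proof (induction l arbitrary: x)
  case (Suc l)
  have "riesz l (4 * (x + pi)) = riesz l (4 * x + pi + pi + pi + pi)"
    by (simp add: algebra_simps)
  also have "\<dots> = riesz l (4 * x)" by (simp only: Suc.IH)
  finally show ?case by (simp add: riesz_Suc_shift)
qed simp

lemma riesz_reflect: "riesz l (pi - x) = riesz l x"
  using riesz_periodic[of l "- x"] by (simp add: add.commute)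

lemma integral_scale:
  fixes g :: "real \<Rightarrow> real"
  assumes "c > 0" "a \<le> b" "continuous_on UNIV g"
  shows "integral {a..b} (\<lambda>x. g (c * x)) = integral {c * a..c * b} g / c"
proof -
  have "((\<lambda>x. c *\<^sub>R g (c * x)) has_integral integral {c * a..c * b} g) {a..b}"
    by (rule has_integral_substitution[where c = "c * a" and d = "c * b"])
       (use assms in \<open>auto intro!: derivative_eq_intros mult_left_mono
          intro: continuous_on_subset[OF assms(3)]\<close>)
  from integral_unique[OF this] have "c * integral {a..b} (\<lambda>x. g (c * x)) = integral {c * a..c * b} g"
    by simp
  then show ?thesis using assms(1) by (simp add: field_simps)
qed

lemma integrable_cont:
  fixes g :: "real \<Rightarrow> real"
  shows "continuous_on UNIV g \<Longrightarrow> g integrable_on {a..b}"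
  by (intro integrable_continuous_interval) (rule continuous_on_subset, auto)

text \<open>
The points \<open>position t w\<close> are sums of independent random signs, so their characteristic function is a
product of cosines. The sine sum vanishes by symmetry and is carried along for the induction.
\<close>

lemma trig_sum_words:
  "(\<Sum>w\<in>words n. cos (position t w * (4 ^ n * u))) = 4 ^ n * (\<Prod>j<n. cos (4 ^ j * u) * cos (4 ^ j * (t * u)))"
  "(\<Sum>w\<in>words n. sin (position t w * (4 ^ n * u))) = 0"
proof (induction n)
  case (Suc n)
  let ?C = "\<Sum>w\<in>words n. cos (position t w * (4 ^ n * u))"
  let ?S = "\<Sum>w\<in>words n. sin (position t w * (4 ^ n * u))"
  let ?d = "\<lambda>d. (fst d + t * snd d) * (4 ^ n * u)"
  have arg: "position t (d # w) * (4 ^ Suc n * u) = ?d d + position t w * (4 ^ n * u)" for d w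
    by (simp add: algebra_simps)
  have C: "(\<Sum>w\<in>words (Suc n). cos (position t w * (4 ^ Suc n * u)))
      = (\<Sum>d\<in>digits. cos (?d d) * ?C - sin (?d d) * ?S)"
    unfolding sum_words_Suc arg cos_add by (simp add: sum_subtractf sum_distrib_left)
  have S: "(\<Sum>w\<in>words (Suc n). sin (position t w * (4 ^ Suc n * u)))
      = (\<Sum>d\<in>digits. sin (?d d) * ?C + cos (?d d) * ?S)"
    unfolding sum_words_Suc arg sin_add by (simp add: sum.distrib sum_distrib_left)
  have cosd: "(\<Sum>d\<in>digits. cos (?d d)) = 4 * (cos (4 ^ n * u) * cos (4 ^ n * (t * u)))"
    by (simp add: digits_def sum.cartesian_product[symmetric] cos_add cos_diff algebra_simps)
  have sind: "(\<Sum>d\<in>digits. sin (?d d)) = 0"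
    by (simp add: digits_def sum.cartesian_product[symmetric] sin_add sin_diff algebra_simps)
  {
    case 1
    show ?case unfolding C Suc.IH by (simp add: sum_distrib_right[symmetric] cosd)
  next
    case 2
    show ?case unfolding S Suc.IH by (simp add: sum_distrib_right[symmetric] sind)
  }
qed simp_all

lemma riesz_eq_pair_sum:
  "16 ^ n * (riesz n u * riesz n (t * u))
    = (\<Sum>v\<in>words n. \<Sum>w\<in>words n. cos ((position t v - position t w) * (4 ^ n * u)))"
proof -
  let ?c = "\<lambda>w. cos (position t w * (4 ^ n * u))" and ?s = "\<lambda>w. sin (position t w * (4 ^ n * u))"
  have "(\<Sum>v\<in>words n. \<Sum>w\<in>words n. cos ((position t v - position t w) * (4 ^ n * u)))
      = (\<Sum>v\<in>words n. ?c v) * (\<Sum>w\<in>words n. ?c w) + (\<Sum>v\<in>words n. ?s v) * (\<Sum>w\<in>words n. ?s w)"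
    by (simp add: sum_product left_diff_distrib cos_diff sum.distrib)
  also have "\<dots> = (4 ^ n * (\<Prod>j<n. cos (4 ^ j * u) * cos (4 ^ j * (t * u))))\<^sup>2"
    unfolding trig_sum_words by (simp add: power2_eq_square)
  also have "\<dots> = 16 ^ n * (riesz n u * riesz n (t * u))"
    by (simp add: power_mult_distrib riesz_def prod.distrib prod_power_distrib power2_eq_square
        flip: power_mult_distrib)
  finally show ?thesis by simp
qed

text \<open>
The cosine transform of the triangle is nonnegative and decays quadratically. The decay serves for upper bounds
on the Fourier side of the energy, the positivity for lower bounds on means of Riesz products.
\<close>

lemma triangle_cos_integral:
  fixes c \<beta> :: real
  assumes "c > 0"
  shows "((\<lambda>u. (1 - u / c) * cos (\<beta> * u)) has_integral
           (if \<beta> = 0 then c / 2 else (1 - cos (\<beta> * c)) / (c * \<beta>\<^sup>2))) {0..c}"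
proof (cases "\<beta> = 0")
  case True
  have "((\<lambda>u. 1 - u / c) has_integral (c - c\<^sup>2 / (2 * c)) - (0 - 0\<^sup>2 / (2 * c))) {0..c}"
    using assms
    by (intro fundamental_theorem_of_calculus)
       (auto intro!: derivative_eq_intros simp: has_real_derivative_iff_has_vector_derivative[symmetric])
  then show ?thesis using True assms by (simp add: power2_eq_square)
next
  case False
  have "((\<lambda>u. (1 - u / c) * cos (\<beta> * u)) has_integral
      ((1 - c / c) * sin (\<beta> * c) / \<beta> - cos (\<beta> * c) / (c * \<beta>\<^sup>2)) -
      ((1 - 0 / c) * sin (\<beta> * 0) / \<beta> - cos (\<beta> * 0) / (c * \<beta>\<^sup>2))) {0..c}"
    using assms False
    by (intro fundamental_theorem_of_calculus)
       (auto intro!: derivative_eq_intros simp: has_real_derivative_iff_has_vector_derivative[symmetric]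
          power2_eq_square field_simps)
  then show ?thesis using False assms by (simp add: diff_divide_distrib)
qed

text \<open>
The integral is \<open>(sin \<beta> / \<beta>) ^ 2\<close>, hence at most \<open>1\<close> and at most \<open>1 / \<beta> ^ 2\<close>. The bound is
stated with an integer \<open>k\<close> close to \<open>\<beta>\<close> because it is summed over pairs of bins.
\<close>

lemma triangle_cos_integral_2_le:
  fixes \<beta> :: real and k :: int
  assumes "\<bar>of_int k\<bar> \<le> \<bar>\<beta>\<bar> + 1"
  shows "integral {0..2} (\<lambda>u. (1 - u / 2) * cos (\<beta> * u)) \<le> 5 / (1 + (of_int k)\<^sup>2)"
proof -
  have k2: "(of_int k)\<^sup>2 \<le> (\<bar>\<beta>\<bar> + 1)\<^sup>2" 
    using assms by (metis abs_le_square_iff abs_of_nonneg abs_ge_zero add_nonneg_nonneg zero_le_one)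
  have I: "integral {0..2} (\<lambda>u. (1 - u / 2) * cos (\<beta> * u))
      = (if \<beta> = 0 then 1 else (1 - cos (\<beta> * 2)) / (2 * \<beta>\<^sup>2))"
    using integral_unique[OF triangle_cos_integral[of 2 \<beta>]] by simp
  have sin: "1 - cos (\<beta> * 2) = 2 * (sin \<beta>)\<^sup>2"
    using cos_double_sin[of \<beta>] by (simp add: mult.commute[of \<beta> 2])
  have J: "integral {0..2} (\<lambda>u. (1 - u / 2) * cos (\<beta> * u)) \<le> 1"
      "\<bar>\<beta>\<bar> > 1 \<Longrightarrow> integral {0..2} (\<lambda>u. (1 - u / 2) * cos (\<beta> * u)) \<le> 1 / \<beta>\<^sup>2"
  proof -
    have "(sin \<beta>)\<^sup>2 \<le> \<beta>\<^sup>2" using abs_sin_x_le_abs_x[of \<beta>] by (simp add: abs_le_square_iff)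
    then show "integral {0..2} (\<lambda>u. (1 - u / 2) * cos (\<beta> * u)) \<le> 1"
      unfolding I sin by (auto simp: divide_le_eq)
    show "integral {0..2} (\<lambda>u. (1 - u / 2) * cos (\<beta> * u)) \<le> 1 / \<beta>\<^sup>2" if "\<bar>\<beta>\<bar> > 1"
      using that unfolding I sin by (auto intro!: divide_right_mono simp: abs_square_le_1)
  qed
  show ?thesis
  proof (cases "\<bar>\<beta>\<bar> > 1")
    case True
    have "1 \<le> \<beta>\<^sup>2" using True by (metis abs_square_le_1 linear not_le order_less_imp_le)
    moreover have "(\<bar>\<beta>\<bar> + 1)\<^sup>2 \<le> (2 * \<bar>\<beta>\<bar>)\<^sup>2" using True by (intro power_mono) auto
    ultimately have "1 + (of_int k)\<^sup>2 \<le> 5 * \<beta>\<^sup>2" using k2 by (simp add: power_mult_distrib)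
    then have "1 / \<beta>\<^sup>2 \<le> 5 / (1 + (of_int k)\<^sup>2)"
      using True by (simp add: divide_simps add_pos_nonneg)
    then show ?thesis using J(2)[OF True] by linarith
  next
    case False
    then have "(\<bar>\<beta>\<bar> + 1)\<^sup>2 \<le> 2\<^sup>2" by (intro power_mono) auto
    then have "1 + (of_int k)\<^sup>2 \<le> (5::real)" using k2 by simp
    then have "1 \<le> 5 / (1 + (of_int k :: real)\<^sup>2)"
      by (simp add: add_pos_nonneg)
    then show ?thesis using J(1) by linarith
  qed
qed

text \<open>
A telescoping comparison: \<open>1 / (1 + k ^ 2)\<close> is at most \<open>1 / (k - 1 / 2) - 1 / (k + 1 / 2)\<close> for
\<open>k \<ge> 1\<close>.
\<close>

lemma sum_inverse_squares_int_le:
  fixes I :: "int set"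
  assumes "finite I"
  shows "(\<Sum>k\<in>I. 1 / (1 + (of_int (i - k))\<^sup>2)) \<le> (5::real)"
proof -
  \<comment> \<open>The symmetric partial sums, with the tail of the telescoping series kept for the induction.\<close>
  have bound: "(\<Sum>k\<in>{- int n..int n}. 1 / (1 + (of_int k)\<^sup>2)) \<le> (5 - 2 / (real n + 1 / 2))" for n
  proof (induction n)
    case (Suc n)
    have "{- int (Suc n)..int (Suc n)} = insert (- int (Suc n)) (insert (int (Suc n)) {- int n..int n})"
      by auto
    then have "(\<Sum>k\<in>{- int (Suc n)..int (Suc n)}. 1 / (1 + (of_int k)\<^sup>2))
        = 2 * (1 / (1 + (real n + 1)\<^sup>2)) + (\<Sum>k\<in>{- int n..int n}. 1 / (1 + (of_int k)\<^sup>2))"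
      by (simp add: power2_eq_square algebra_simps)
    also have "\<dots> \<le> 2 * (1 / (real n + 1 / 2) - 1 / (real n + 3 / 2)) + (5 - 2 / (real n + 1 / 2))"
    proof (intro add_mono mult_left_mono Suc.IH)
      have "1 / (real n + 1 / 2) - 1 / (real n + 3 / 2) = 1 / ((real n + 1 / 2) * (real n + 3 / 2))"
        by (simp add: field_simps)
      moreover have "1 / (1 + (real n + 1)\<^sup>2) \<le> 1 / ((real n + 1 / 2) * (real n + 3 / 2))"
        by (intro divide_left_mono mult_pos_pos) (auto simp: power2_eq_square algebra_simps add_pos_nonneg)
      ultimately show "1 / (1 + (real n + 1)\<^sup>2) \<le> 1 / (real n + 1 / 2) - 1 / (real n + 3 / 2)" by simp
    qed simp
    finally show ?case by (simp add: algebra_simps)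
  qed simp
  define n where "n = nat (\<Sum>k\<in>I. \<bar>i - k\<bar>)"
  have le_n: "\<bar>i - k\<bar> \<le> int n" if "k \<in> I" for k
    using member_le_sum[OF that, of "\<lambda>k. \<bar>i - k\<bar>"] assms unfolding n_def by auto
  have "- int n \<le> i - k \<and> i - k \<le> int n" if "k \<in> I" for k
    using le_n[OF that] by linarith
  then have "(\<lambda>k. i - k) ` I \<subseteq> {- int n..int n}" by auto
  then have "(\<Sum>k\<in>(\<lambda>k. i - k) ` I. 1 / (1 + (of_int k)\<^sup>2))
      \<le> (\<Sum>k\<in>{- int n..int n}. 1 / (1 + (of_int k)\<^sup>2) :: real)"
    by (intro sum_mono2) auto
  also note bound
  finally have "(\<Sum>k\<in>(\<lambda>k. i - k) ` I. 1 / (1 + (of_int k)\<^sup>2)) \<le> (5 - 2 / (real n + 1 / 2))" .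
  also have "\<dots> \<le> (5::real)" by simp
  finally show ?thesis by (subst (asm) sum.reindex) (auto simp: inj_on_def o_def)
qed

text \<open>
Schur's test: the kernel \<open>1 / (1 + (i - j) ^ 2)\<close> has row sums at most \<open>5\<close>, so as a quadratic form in
the occupation numbers of the bins it is at most five times the diagonal.
\<close>

lemma sum_kernel_le:
  fixes b :: "'a \<Rightarrow> int"
  assumes "finite W"
  shows "(\<Sum>v\<in>W. \<Sum>w\<in>W. 1 / (1 + (of_int (b v - b w))\<^sup>2))
      \<le> 5 * (\<Sum>i\<in>b ` W. (real (card {w \<in> W. b w = i}))\<^sup>2)"
proof -
  define I where "I = b ` W"
  define c where "c = (\<lambda>i. real (card {w \<in> W. b w = i}))"
  define \<kappa> where "\<kappa> = (\<lambda>i j. 1 / (1 + (of_int (i - j :: int))\<^sup>2) :: real)"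
  have finI: "finite I" using assms by (simp add: I_def)
  \<comment> \<open>A function of the bin is summed by counting the points in each bin.\<close>
  have fiber: "(\<Sum>w\<in>W. h (b w)) = (\<Sum>i\<in>I. c i * h i)" for h :: "int \<Rightarrow> real"
  proof -
    have "(\<Sum>w\<in>W. h (b w)) = (\<Sum>i\<in>I. \<Sum>w\<in>{w \<in> W. b w = i}. h (b w))"
      unfolding I_def by (rule sum.image_gen[OF assms])
    also have "\<dots> = (\<Sum>i\<in>I. c i * h i)"
      by (intro sum.cong refl) (simp add: c_def)
    finally show ?thesis .
  qed
  have \<kappa>_nonneg: "0 \<le> \<kappa> i j" for i j by (simp add: \<kappa>_def)
  have \<kappa>_sym: "\<kappa> i j = \<kappa> j i" for i j by (simp add: \<kappa>_def power2_commute)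
  have row: "(\<Sum>j\<in>I. \<kappa> i j) \<le> 5" for i
    unfolding \<kappa>_def by (rule sum_inverse_squares_int_le[OF finI])
  have "(\<Sum>v\<in>W. \<Sum>w\<in>W. \<kappa> (b v) (b w)) = (\<Sum>i\<in>I. c i * (\<Sum>j\<in>I. c j * \<kappa> i j))"
    unfolding fiber[of "\<lambda>i. \<kappa> _ i"] fiber[of "\<lambda>i. \<Sum>j\<in>I. c j * \<kappa> i j"] ..
  also have "\<dots> = (\<Sum>i\<in>I. \<Sum>j\<in>I. c i * c j * \<kappa> i j)"
    by (simp add: sum_distrib_left mult.assoc)
  also have "\<dots> \<le> (\<Sum>i\<in>I. \<Sum>j\<in>I. ((c i)\<^sup>2 / 2 + (c j)\<^sup>2 / 2) * \<kappa> i j)"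
  proof (intro sum_mono mult_right_mono \<kappa>_nonneg)
    fix i j
    show "c i * c j \<le> (c i)\<^sup>2 / 2 + (c j)\<^sup>2 / 2"
      using sum_squares_bound[of "c i" "c j"] by simp
  qed
  also have "\<dots> = (\<Sum>i\<in>I. \<Sum>j\<in>I. (c i)\<^sup>2 / 2 * \<kappa> i j) + (\<Sum>i\<in>I. \<Sum>j\<in>I. (c j)\<^sup>2 / 2 * \<kappa> i j)"
    by (simp add: distrib_right sum.distrib)
  also have "(\<Sum>i\<in>I. \<Sum>j\<in>I. (c j)\<^sup>2 / 2 * \<kappa> i j) = (\<Sum>i\<in>I. \<Sum>j\<in>I. (c i)\<^sup>2 / 2 * \<kappa> i j)"
    by (subst sum.swap) (simp add: \<kappa>_sym)
  also have "(\<Sum>i\<in>I. \<Sum>j\<in>I. (c i)\<^sup>2 / 2 * \<kappa> i j) = (\<Sum>i\<in>I. (c i)\<^sup>2 / 2 * (\<Sum>j\<in>I. \<kappa> i j))"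
    by (simp add: sum_distrib_left)
  also have "\<dots> \<le> (\<Sum>i\<in>I. (c i)\<^sup>2 / 2 * 5)"
    using row by (intro sum_mono mult_left_mono) auto
  finally show ?thesis
    unfolding \<kappa>_def I_def c_def by (simp add: sum_distrib_left sum_divide_distrib[symmetric] mult.commute)
qed

text \<open>
On a bin the covering count is at least the number of points in the bin, since the intervals have radius
equal to the length of the bin.
\<close>

lemma sum_bin_squares_le_energy:
  assumes "finite I"
  shows "(\<Sum>i\<in>I. (real (card {w \<in> words n. \<lfloor>4 ^ n * position t w\<rfloor> = i}))\<^sup>2) \<le> 4 ^ n * energy t n"
proof -
  define c where "c = (\<lambda>i. real (card {w \<in> words n. \<lfloor>4 ^ n * position t w\<rfloor> = i}))"
  have c_le: "c \<lfloor>4 ^ n * x\<rfloor> \<le> cover_count t n x" for x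
  proof -
    have "c \<lfloor>4 ^ n * x\<rfloor> = (\<Sum>w\<in>words n. if \<lfloor>4 ^ n * position t w\<rfloor> = \<lfloor>4 ^ n * x\<rfloor> then 1 else 0)"
      by (simp add: c_def sum.If_cases Int_def)
    also have "\<dots> \<le> cover_count t n x"
      unfolding cover_count_def
    proof (rule sum_mono)
      fix w assume w: "w \<in> words n"
      have "x \<in> word_interval t w" if "\<lfloor>4 ^ n * position t w\<rfloor> = \<lfloor>4 ^ n * x\<rfloor>"
      proof -
        have "\<bar>4 ^ n * x - 4 ^ n * position t w\<bar> \<le> 1" using that by linarith
        then have "\<bar>4 ^ n * (x - position t w)\<bar> \<le> 1" by (simp add: right_diff_distrib)
        then have "4 ^ n * \<bar>x - position t w\<bar> \<le> 1" by (simp add: abs_mult)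
        then show ?thesis using length_words[OF w] by (simp add: mem_word_interval field_simps)
      qed
      then show "(if \<lfloor>4 ^ n * position t w\<rfloor> = \<lfloor>4 ^ n * x\<rfloor> then 1 else 0) \<le> indicat_real (word_interval t w) x"
        by auto
    qed
    finally show ?thesis .
  qed
  have bin_finite: "emeasure lborel (bin n i) < \<infinity>" for i
    unfolding bin_def by (intro emeasure_bounded_finite) auto
  have int: "integrable lborel (\<lambda>x. (c i)\<^sup>2 * indicat_real (bin n i) x)" for i
    using bin_finite[of i]
    by (intro integrable_mult_right integrable_real_indicator) (auto simp: bin_def)
  have "(\<Sum>i\<in>I. (c i)\<^sup>2) / 4 ^ n = (\<Sum>i\<in>I. LINT x|lborel. (c i)\<^sup>2 * indicator (bin n i) x)"
  proof -
    have "measure lborel (bin n i) = 1 / 4 ^ n" for i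
      by (simp add: bin_def divide_right_mono diff_divide_distrib[symmetric])
    then show ?thesis by (simp add: sum_divide_distrib)
  qed
  also have "\<dots> = (LINT x|lborel. (\<Sum>i\<in>I. (c i)\<^sup>2 * indicator (bin n i) x))"
    using int by (intro Bochner_Integration.integral_sum[symmetric]) auto
  also have "\<dots> \<le> energy t n"
    unfolding energy_def
  proof (rule integral_mono)
    fix x
    have "(\<Sum>i\<in>I. (c i)\<^sup>2 * indicat_real (bin n i) x)
        = (\<Sum>i\<in>I. if i = \<lfloor>4 ^ n * x\<rfloor> then (c \<lfloor>4 ^ n * x\<rfloor>)\<^sup>2 else 0)"
      by (intro sum.cong refl) (auto simp: indicator_def mem_bin)
    also have "\<dots> \<le> (c \<lfloor>4 ^ n * x\<rfloor>)\<^sup>2" using assms by simp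
    also have "\<dots> \<le> (cover_count t n x)\<^sup>2"
      using c_le by (intro power_mono) (auto simp: c_def)
    finally show "(\<Sum>i\<in>I. (c i)\<^sup>2 * indicat_real (bin n i) x) \<le> (cover_count t n x)\<^sup>2" .
  qed (use int in \<open>auto intro: integrable_cover_count_sq\<close>)
  finally show ?thesis by (simp add: c_def field_simps)
qed

text \<open>
The squared Fourier transform, at frequency \<open>4 ^ n * u\<close>, of the uniform probability measure on the points
\<open>position t w\<close> with \<open>w\<close> of length \<open>n\<close>.
\<close>

definition power_spectrum :: "nat \<Rightarrow> real \<Rightarrow> real \<Rightarrow> real" where
  "power_spectrum n t u = riesz n u * riesz n (t * u)"

lemma power_spectrum_nonneg: "0 \<le> power_spectrum n t u"
  by (simp add: power_spectrum_def riesz_nonneg)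

lemma continuous_on_power_spectrum [continuous_intros]:
  fixes f g :: "'a::t2_space \<Rightarrow> real"
  shows "continuous_on S f \<Longrightarrow> continuous_on S g \<Longrightarrow> continuous_on S (\<lambda>x. power_spectrum n (f x) (g x))"
  unfolding power_spectrum_def by (intro continuous_intros)

text \<open>
A one-sided substitute for Plancherel's theorem. Majorising the indicator function of the unit interval by
twice a triangle of base \<open>2\<close> turns the integral into a sum over pairs of points with the kernel of the
preceding lemmas.
\<close>

lemma integral_power_spectrum_le_energy:
  "integral {0..1} (power_spectrum n t) \<le> 50 * energy t n / 4 ^ n"
proof -
  let ?tri = "\<lambda>u::real. 1 - u / 2"
  let ?b = "\<lambda>w. \<lfloor>4 ^ n * position t w\<rfloor>"
  let ?\<beta> = "\<lambda>v w. (position t v - position t w) * 4 ^ n"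
  have int: "(\<lambda>u. ?tri u * cos (\<beta> * u)) integrable_on {0..2}" for \<beta>
    using triangle_cos_integral[of 2 \<beta>] by (auto simp: has_integral_integrable)
  have spec: "?tri u * power_spectrum n t u
      = (\<Sum>v\<in>words n. \<Sum>w\<in>words n. ?tri u * cos (?\<beta> v w * u)) / 16 ^ n" for u
  proof -
    have "?tri u * (16 ^ n * power_spectrum n t u)
        = (\<Sum>v\<in>words n. \<Sum>w\<in>words n. ?tri u * cos (?\<beta> v w * u))"
      unfolding power_spectrum_def riesz_eq_pair_sum by (simp add: sum_distrib_left mult.assoc)
    then show ?thesis by (simp add: field_simps)
  qed
  have int2: "(\<lambda>u. ?tri u * power_spectrum n t u) integrable_on {a..b}" for a b
    by (intro integrable_cont continuous_intros) auto
  have "integral {0..1} (power_spectrum n t) \<le> integral {0..1} (\<lambda>u. 2 * (?tri u * power_spectrum n t u))"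
  proof (rule integral_le)
    fix u :: real assume "u \<in> {0..1}"
    have "1 * power_spectrum n t u \<le> (2 * ?tri u) * power_spectrum n t u"
      using \<open>u \<in> {0..1}\<close> by (intro mult_right_mono power_spectrum_nonneg) auto
    also have "(2 * ?tri u) * power_spectrum n t u = 2 * (?tri u * power_spectrum n t u)" by (rule mult.assoc)
    finally show "power_spectrum n t u \<le> 2 * (?tri u * power_spectrum n t u)" by simp
  qed (auto intro!: integrable_cont continuous_intros)
  also have "\<dots> = 2 * integral {0..1} (\<lambda>u. ?tri u * power_spectrum n t u)" by simp
  also have "\<dots> \<le> 2 * integral {0..2} (\<lambda>u. ?tri u * power_spectrum n t u)"
    by (intro mult_left_mono integral_subset_le int2) (auto intro!: mult_nonneg_nonneg power_spectrum_nonneg)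
  also have "integral {0..2} (\<lambda>u. ?tri u * power_spectrum n t u)
      = (\<Sum>v\<in>words n. \<Sum>w\<in>words n. integral {0..2} (\<lambda>u. ?tri u * cos (?\<beta> v w * u))) / 16 ^ n"
    unfolding spec using int by (simp add: integral_sum integrable_sum)
  also have "\<dots> \<le> (\<Sum>v\<in>words n. \<Sum>w\<in>words n. 5 * (1 / (1 + (of_int (?b v - ?b w))\<^sup>2))) / 16 ^ n"
  proof (intro divide_right_mono sum_mono)
    fix v w
    have "\<bar>real_of_int (?b v - ?b w)\<bar> \<le> \<bar>4 ^ n * position t v - 4 ^ n * position t w\<bar> + 1"
      by linarith
    also have "4 ^ n * position t v - 4 ^ n * position t w = ?\<beta> v w" by (simp add: algebra_simps)
    finally show "integral {0..2} (\<lambda>u. ?tri u * cos (?\<beta> v w * u))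
        \<le> 5 * (1 / (1 + (of_int (?b v - ?b w))\<^sup>2))"
      using triangle_cos_integral_2_le[of "?b v - ?b w" "?\<beta> v w"] by simp
  qed simp
  also have "\<dots> \<le> 5 * (5 * (4 ^ n * energy t n)) / 16 ^ n"
    unfolding sum_distrib_left[symmetric]
    using sum_kernel_le[of "words n" ?b] sum_bin_squares_le_energy[of "?b ` words n" n t]
    by (intro divide_right_mono mult_left_mono) auto
  finally have "integral {0..1} (power_spectrum n t) \<le> 2 * (5 * (5 * (4 ^ n * energy t n)) / 16 ^ n)" by simp
  also have "(16::real) ^ n = 4 ^ n * 4 ^ n" by (simp flip: power_mult_distrib)
  finally show ?thesis by simp
qed

section \<open>Riesz products across the scales\<close>

text \<open>
The omitted factors are cosines of \<open>v / 4\<close>, \<open>v / 16\<close>, and so on; their squares are at least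
\<open>1 - 16 ^ (- i)\<close>, and these defects sum to less than \<open>1 / 2\<close>.
\<close>

lemma riesz_tail_ge: "\<bar>v\<bar> \<le> 1 \<Longrightarrow> riesz k (v / 4 ^ k) \<ge> 1 / 2"
proof -
  assume v: "\<bar>v\<bar> \<le> 1"
  \<comment> \<open>The sum of the defects \<open>16 ^ (- i)\<close> up to \<open>k\<close> is \<open>(1 - 16 ^ (- k)) / 15\<close>.\<close>
  have "riesz k (v / 4 ^ k) \<ge> 1 - (1 - 1 / 16 ^ k) / 15"
  proof (induction k)
    case (Suc k)
    define x where "x = v / 4 ^ Suc k"
    have "x\<^sup>2 = v\<^sup>2 / 16 ^ Suc k" by (simp add: x_def power_divide power_mult_distrib flip: power_mult)
       (simp add: power_mult mult.commute power2_eq_square flip: power_mult_distrib)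
    moreover have "v\<^sup>2 \<le> 1" using v by (simp add: abs_square_le_1)
    ultimately have x: "x\<^sup>2 \<le> 1 / 16 ^ Suc k" by (simp add: divide_right_mono)
    have "(sin x)\<^sup>2 \<le> x\<^sup>2" using abs_sin_x_le_abs_x[of x] by (simp add: abs_le_square_iff)
    then have c: "(cos x)\<^sup>2 \<ge> 1 - 1 / 16 ^ Suc k" using x by (simp add: cos_squared_eq)
    have "1 - (1 - 1 / 16 ^ Suc k) / 15 \<le> (1 - 1 / 16 ^ Suc k) * (1 - (1 - 1 / 16 ^ k) / (15::real))"
    proof -
      define z where "z = (1 / 16 ^ k :: real)"
      have z: "0 \<le> z" "z \<le> 1" by (auto simp: z_def divide_le_eq)
      have "1 / 16 ^ Suc k = z / 16" by (simp add: z_def)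
      moreover have "1 - (1 - z / 16) / 15 \<le> (1 - z / 16) * (1 - (1 - z) / 15)"
        using z mult_left_mono[of z 1 z] by (simp add: field_simps)
      ultimately show ?thesis unfolding z_def by (simp add: mult.commute)
    qed
    also have "\<dots> \<le> (cos x)\<^sup>2 * riesz k (v / 4 ^ k)"
      using c Suc.IH by (intro mult_mono) (auto simp: field_simps)
    also have "\<dots> = riesz (Suc k) x"
      unfolding riesz_Suc_shift by (simp add: x_def)
    finally show ?case by (simp add: x_def)
  qed simp
  moreover have "1 - (1 - 1 / 16 ^ k) / 15 \<ge> (1 / 2 :: real)" by (simp add: field_simps)
  ultimately show ?thesis by linarith
qed

lemma power_spectrum_dilate_le:
  assumes "0 \<le> t" "t \<le> 1" "0 \<le> v" "v \<le> 1"
  shows "power_spectrum n t v \<le> 4 * power_spectrum (k + n) t (1 / 4 ^ k * v)"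
proof -
  have "1 / 2 * (1 / 2) \<le> riesz k (v / 4 ^ k) * riesz k (t * v / 4 ^ k)"
    using assms mult_le_one[of t v] by (intro mult_mono riesz_tail_ge riesz_nonneg) (auto simp: abs_le_iff)
  then have "1 * power_spectrum n t v \<le> (4 * (riesz k (v / 4 ^ k) * riesz k (t * v / 4 ^ k))) * power_spectrum n t v"
    by (intro mult_right_mono power_spectrum_nonneg) simp
  also have "\<dots> = 4 * power_spectrum (k + n) t (1 / 4 ^ k * v)"
    by (simp add: power_spectrum_def riesz_add mult_ac)
  finally show ?thesis by simp
qed

lemma integral_power_spectrum_dilate_le:
  assumes "0 \<le> t" "t \<le> 1" "0 \<le> a" "a \<le> b" "b \<le> 1"
  shows "integral {a..b} (power_spectrum n t)
    \<le> 4 * 4 ^ k * integral {a / 4 ^ k..b / 4 ^ k} (power_spectrum (k + n) t)"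
proof -
  have "integral {a..b} (power_spectrum n t) \<le> integral {a..b} (\<lambda>v. 4 * power_spectrum (k + n) t (1 / 4 ^ k * v))"
    using assms by (intro integral_le integrable_cont power_spectrum_dilate_le) (auto intro!: continuous_intros)
  also have "\<dots> = 4 * integral {a..b} (\<lambda>v. power_spectrum (k + n) t (1 / 4 ^ k * v))"
    by simp
  also have "integral {a..b} (\<lambda>v. power_spectrum (k + n) t (1 / 4 ^ k * v))
      = integral {1 / 4 ^ k * a..1 / 4 ^ k * b} (power_spectrum (k + n) t) / (1 / 4 ^ k)"
    using assms by (intro integral_scale) (auto intro!: continuous_intros)
  finally show ?thesis by (simp add: mult_ac)
qed

lemma integral_power_spectrum_le:
  assumes "0 \<le> t" "t \<le> 1" "n \<le> N"
  shows "integral {0..1} (power_spectrum n t) \<le> 4 * 4 ^ (N - n) * integral {0..1} (power_spectrum N t)"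
proof -
  have "integral {0..1} (power_spectrum n t)
      \<le> 4 * 4 ^ (N - n) * integral {0 / 4 ^ (N - n)..1 / 4 ^ (N - n)} (power_spectrum N t)"
    using integral_power_spectrum_dilate_le[of t 0 1 n "N - n"] assms by simp
  also have "\<dots> \<le> 4 * 4 ^ (N - n) * integral {0..1} (power_spectrum N t)"
    by (intro mult_left_mono integral_subset_le integrable_cont)
       (auto intro!: continuous_intros power_spectrum_nonneg simp: divide_le_eq)
  finally show ?thesis .
qed

text \<open>
Rescaling turns the blocks \<open>[4 ^ (- m), 1]\<close> of the different generations into adjacent intervals of one
and the same spectrum. So \<open>M\<close> blocks share the mass that the energy allows for a single generation, and
on average a block gets only the \<open>M\<close>-th part of it.
\<close>

lemma sum_integral_power_spectrum_scales_le:
  assumes "0 \<le> t" "t \<le> 1" "M * m \<le> N"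
  shows "(\<Sum>i<M. 4 ^ (Suc i * m) * integral {1 / 4 ^ m..1} (power_spectrum (Suc i * m) t))
    \<le> 4 * 4 ^ N * integral {0..1} (power_spectrum N t)"
proof -
  \<comment> \<open>The endpoints of the adjacent intervals.\<close>
  define s where "s = (\<lambda>i. 4 ^ (i * m) / 4 ^ N :: real)"
  have s_mono: "s i \<le> s j" if "i \<le> j" for i j
    unfolding s_def using that by (intro divide_right_mono power_increasing mult_right_mono) auto
  have cont: "continuous_on UNIV (power_spectrum N t)" by (intro continuous_intros)
  have "4 ^ (Suc i * m) * integral {1 / 4 ^ m..1} (power_spectrum (Suc i * m) t)
      \<le> 4 * 4 ^ N * integral {s i..s (Suc i)} (power_spectrum N t)" if "i < M" for i
  proof -
    have le: "Suc i * m \<le> N" using that assms(3) by (meson Suc_leI le_trans mult_le_mono1)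
    define k where "k = N - Suc i * m"
    have N: "(4::real) ^ N = 4 ^ k * 4 ^ (Suc i * m)" using le by (simp add: k_def flip: power_add)
    have "integral {1 / 4 ^ m..1} (power_spectrum (Suc i * m) t)
        \<le> 4 * 4 ^ k * integral {1 / 4 ^ m / 4 ^ k..1 / 4 ^ k} (power_spectrum (k + Suc i * m) t)"
      using assms by (intro integral_power_spectrum_dilate_le) (auto simp: divide_le_eq)
    also have "1 / 4 ^ m / 4 ^ k = s i" unfolding s_def N by (simp add: power_add field_simps)
    also have "1 / 4 ^ k = s (Suc i)" unfolding s_def N by (simp add: field_simps)
    also have "k + Suc i * m = N" using le by (simp add: k_def)
    finally show ?thesis unfolding N by (simp add: field_simps)
  qed
  then have "(\<Sum>i<M. 4 ^ (Suc i * m) * integral {1 / 4 ^ m..1} (power_spectrum (Suc i * m) t))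
      \<le> (\<Sum>i<M. 4 * 4 ^ N * integral {s i..s (Suc i)} (power_spectrum N t))"
    by (intro sum_mono) auto
  also have "\<dots> = 4 * 4 ^ N * (\<Sum>i<M. integral {s i..s (Suc i)} (power_spectrum N t))"
    by (simp add: sum_distrib_left)
  also have "(\<Sum>i<M. integral {s i..s (Suc i)} (power_spectrum N t)) = integral {s 0..s M} (power_spectrum N t)"
  proof (induction M)
    case (Suc M)
    then show ?case
      using Henstock_Kurzweil_Integration.integral_combine[of "s 0" "s M" "s (Suc M)" "power_spectrum N t"]
        s_mono integrable_cont[OF cont] by simp
  qed simp
  also have "\<dots> \<le> integral {0..1} (power_spectrum N t)"
  proof (intro integral_subset_le integrable_cont cont)
    have "s M \<le> 1" unfolding s_def using assms(3) by (simp add: divide_le_eq power_increasing)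
    then show "{s 0..s M} \<subseteq> {0..1}" by (auto simp: s_def)
  qed (auto intro: power_spectrum_nonneg)
  finally show ?thesis by (simp add: mult_left_mono)
qed

text \<open>
The doubling formula gives \<open>sin (4 * y) = 4 * sin y * cos y * cos (2 * y)\<close>; bounding \<open>cos (2 * y)\<close> by
\<open>1\<close> lets the product telescope. It shows that a Riesz product is small only near the zeros of one sine.
\<close>

lemma sin_sq_le_riesz: "(sin (4 ^ m * x))\<^sup>2 \<le> 16 ^ m * riesz m x"
proof (induction m)
  case 0
  then show ?case by (simp add: abs_square_le_1)
next
  case (Suc m)
  define y where "y = 4 ^ m * x"
  have "sin (4 * y) = 4 * (sin y * cos y * cos (2 * y))"
    using sin_double[of "2 * y"] sin_double[of y] by simp
  then have "(sin (4 * y))\<^sup>2 = 16 * ((sin y)\<^sup>2 * (cos y)\<^sup>2) * (cos (2 * y))\<^sup>2"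
    by (simp add: power_mult_distrib)
  also have "\<dots> \<le> 16 * ((sin y)\<^sup>2 * (cos y)\<^sup>2) * 1"
    by (intro mult_left_mono) (auto simp: abs_square_le_1)
  also have "\<dots> \<le> 16 * ((16 ^ m * riesz m x) * (cos y)\<^sup>2) * 1"
    using Suc.IH by (intro mult_left_mono mult_right_mono) (auto simp: y_def)
  finally show ?case by (simp add: riesz_Suc y_def mult_ac)
qed

text \<open>
Expanding the product gives the constant \<open>1\<close> plus cosines with nonnegative coefficients, whose integrals
against the triangle are nonnegative. The induction multiplies one factor at a time and therefore needs the
positivity for every additional frequency \<open>\<beta>\<close>.
\<close>

lemma integral_triangle_riesz_ge:
  fixes \<omega> \<omega>' :: "nat \<Rightarrow> real"
  defines "P \<equiv> \<lambda>l v. \<Prod>j<l. (1 + cos (\<omega> j * v)) * (1 + cos (\<omega>' j * v))"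
  shows "integral {0..1} (\<lambda>v. (1 - v) * P l v) \<ge> 1 / 2"
proof -
  \<comment> \<open>Positive definiteness, tested against the triangle.\<close>
  define Q where "Q = (\<lambda>f :: real \<Rightarrow> real. \<forall>\<beta>. 0 \<le> integral {0..1} (\<lambda>v. (1 - v) * cos (\<beta> * v) * f v))"
  have step: "Q (\<lambda>v. f v * (1 + cos (w * v))) \<and>
      integral {0..1} (\<lambda>v. (1 - v) * (f v * (1 + cos (w * v)))) \<ge> 1 / 2"
    if cont: "continuous_on UNIV f" and Q: "Q f" and ge: "integral {0..1} (\<lambda>v. (1 - v) * f v) \<ge> 1 / 2"
    for f :: "real \<Rightarrow> real" and w
  proof
    let ?I = "\<lambda>\<beta>. integral {0..1} (\<lambda>v. (1 - v) * cos (\<beta> * v) * f v)"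
    have int: "(\<lambda>v. (1 - v) * cos (\<beta> * v) * f v) integrable_on {0..1}" for \<beta>
      by (intro integrable_cont continuous_intros cont)
    have expand: "integral {0..1} (\<lambda>v. (1 - v) * cos (\<beta> * v) * (f v * (1 + cos (w * v))))
        = ?I \<beta> + 1 / 2 * ?I (\<beta> + w) + 1 / 2 * ?I (\<beta> - w)" for \<beta>
    proof -
      have "(1 - v) * cos (\<beta> * v) * (f v * (1 + cos (w * v)))
          = (1 - v) * cos (\<beta> * v) * f v + 1 / 2 * ((1 - v) * cos ((\<beta> + w) * v) * f v)
            + 1 / 2 * ((1 - v) * cos ((\<beta> - w) * v) * f v)" for v
        by (simp add: distrib_right left_diff_distrib cos_add cos_diff algebra_simps)
      then show ?thesis
        using int by (simp add: integral_add integrable_add integrable_on_mult_right)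
    qed
    have nn: "0 \<le> ?I \<beta>" for \<beta> using Q by (auto simp: Q_def)
    show "Q (\<lambda>v. f v * (1 + cos (w * v)))"
      unfolding Q_def expand using nn by (auto intro!: add_nonneg_nonneg)
    show "integral {0..1} (\<lambda>v. (1 - v) * (f v * (1 + cos (w * v)))) \<ge> 1 / 2"
      using expand[of 0] ge nn[of w] nn[of "- w"] by simp
  qed
  have cont: "continuous_on UNIV (P l)" for l
    unfolding P_def by (intro continuous_intros)
  have "Q (P l) \<and> integral {0..1} (\<lambda>v. (1 - v) * P l v) \<ge> 1 / 2"
  proof (induction l)
    case 0
    have "0 \<le> integral {0..1} (\<lambda>v. (1 - v) * cos (\<beta> * v))" for \<beta> :: real
      using integral_unique[OF triangle_cos_integral[of 1 \<beta>]] by simp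
    moreover have "integral {0..1} (\<lambda>v::real. 1 - v) = 1 / 2"
      using integral_unique[OF triangle_cos_integral[of 1 0]] by simp
    ultimately show ?case by (simp add: Q_def P_def)
  next
    case (Suc l)
    have P_Suc: "P (Suc l) = (\<lambda>v. P l v * (1 + cos (\<omega> l * v)) * (1 + cos (\<omega>' l * v)))"
      by (simp add: P_def mult.assoc fun_eq_iff)
    have "Q (\<lambda>v. P l v * (1 + cos (\<omega> l * v))) \<and>
        integral {0..1} (\<lambda>v. (1 - v) * (P l v * (1 + cos (\<omega> l * v)))) \<ge> 1 / 2"
      using step[OF cont] Suc.IH by blast
    then show ?case unfolding P_Suc
      by (intro step) (auto intro!: continuous_intros cont)
  qed
  then show ?thesis ..
qed

lemma integral_power_spectrum_dilated_ge:
  "integral {0..1} (\<lambda>v. power_spectrum l t (c * v)) \<ge> 1 / 2 / 4 ^ l"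
proof -
  let ?P = "\<lambda>v. \<Prod>j<l. (1 + cos ((2 * 4 ^ j * c) * v)) * (1 + cos ((2 * 4 ^ j * t * c) * v))"
  have sq: "(cos x)\<^sup>2 = (1 + cos (2 * x)) / 2" for x :: real
    using cos_double_cos[of x] by simp
  have spec: "power_spectrum l t (c * v) = ?P v / 4 ^ l" for v
  proof -
    have "power_spectrum l t (c * v) = (\<Prod>j<l. (1 + cos ((2 * 4 ^ j * c) * v)) * (1 + cos ((2 * 4 ^ j * t * c) * v)) / 4)"
      unfolding power_spectrum_def riesz_def sq
      by (subst prod.distrib[symmetric]) (simp add: mult_ac)
    then show ?thesis by (simp add: prod_dividef)
  qed
  have "1 / 2 / 4 ^ l \<le> integral {0..1} (\<lambda>v. (1 - v) * ?P v) / 4 ^ l"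
    by (intro divide_right_mono integral_triangle_riesz_ge) simp
  also have "\<dots> = integral {0..1} (\<lambda>v. (1 - v) * power_spectrum l t (c * v))"
    unfolding spec by simp
  also have "\<dots> \<le> integral {0..1} (\<lambda>v. power_spectrum l t (c * v))"
    by (intro integral_le integrable_cont)
       (auto intro!: continuous_intros mult_left_le_one_le power_spectrum_nonneg)
  finally show ?thesis .
qed

section \<open>A singular weight against the Riesz product\<close>

lemma integral_reflect_shift:
  fixes g :: "real \<Rightarrow> real"
  assumes "continuous_on UNIV g"
  shows "integral {a..b} (\<lambda>x. g (c - x)) = integral {c - b..c - a} g"
    and "integral {a..b} (\<lambda>x. g (x + c)) = integral {a + c..b + c} g"
proof -
  have shift: "integral {a..b} (\<lambda>x. g (x + c)) = integral {a + c..b + c} g" for g :: "real \<Rightarrow> real" and a b c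
    using integral_shift_Icc_real[of a b g c] by (simp add: o_def add.commute)
  show "integral {a..b} (\<lambda>x. g (x + c)) = integral {a + c..b + c} g" by (rule shift)
  show "integral {a..b} (\<lambda>x. g (c - x)) = integral {c - b..c - a} g"
    using Henstock_Kurzweil_Integration.integral_reflect_real[of b a "\<lambda>x. g (c - x)"] shift[of "-b" "-a" g c] by (simp add: add.commute)
qed

lemma integral_half_periods:
  fixes h :: "real \<Rightarrow> real"
  assumes cont: "continuous_on UNIV h"
    and per: "\<And>x. h (x + pi) = h x" and refl: "\<And>x. h (pi - x) = h x"
  shows "integral {0..real n * (pi / 2)} h = real n * integral {0..pi / 2} h"
proof -
  \<comment> \<open>Translation by \<open>pi\<close> reduces the number of the half period by two, reflection treats the first odd one.\<close>
  have piece: "integral {real k * (pi / 2)..real (Suc k) * (pi / 2)} h = integral {0..pi / 2} h" for k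
  proof (induction k rule: induct_nat_012)
    case 1
    show ?case using integral_reflect_shift(1)[OF cont, of 0 "pi / 2" pi] by (simp add: refl)
  next
    case (ge2 k)
    have "integral {real (Suc (Suc k)) * (pi / 2)..real (Suc (Suc (Suc k))) * (pi / 2)} h
        = integral {real k * (pi / 2)..real (Suc k) * (pi / 2)} (\<lambda>x. h (x + pi))"
    proof -
      have "real k * (pi / 2) + pi = real (Suc (Suc k)) * (pi / 2)"
          "real (Suc k) * (pi / 2) + pi = real (Suc (Suc (Suc k))) * (pi / 2)"
        by (simp_all add: field_simps)
      then show ?thesis by (simp only: integral_reflect_shift(2)[OF cont])
    qed
    then show ?case using ge2 by (simp add: per)
  qed simp
  show ?thesis
  proof (induction n)
    case (Suc n)
    have "integral {0..real (Suc n) * (pi / 2)} h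
        = integral {0..real n * (pi / 2)} h + integral {real n * (pi / 2)..real (Suc n) * (pi / 2)} h"
      by (rule Henstock_Kurzweil_Integration.integral_combine[symmetric])
         (auto intro!: integrable_cont cont mult_right_mono)
    then show ?case unfolding piece Suc.IH by (simp add: algebra_simps)
  qed simp
qed

lemma integral_periodic_le:
  fixes h :: "real \<Rightarrow> real"
  assumes cont: "continuous_on UNIV h" and nonneg: "\<And>x. 0 \<le> h x"
    and per: "\<And>x. h (x + pi) = h x" and refl: "\<And>x. h (pi - x) = h x"
    and "1 \<le> X"
  shows "integral {0..X} h \<le> 2 * X * integral {0..pi / 2} h"
proof -
  define n where "n = nat \<lceil>X / (pi / 2)\<rceil>"
  have X: "X / (pi / 2) \<le> real n" unfolding n_def by linarith
  have "real n \<le> X / (pi / 2) + 1"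
    using assms(5) unfolding n_def by (simp add: ceiling_correct) 
  also have "\<dots> \<le> X + X"
    using assms(5) pi_ge_two mult_mono[of 1 X 2 pi] by (intro add_mono) (auto simp: field_simps)
  finally have n: "real n \<le> 2 * X" by simp
  have "integral {0..X} h \<le> integral {0..real n * (pi / 2)} h"
    using X nonneg by (intro integral_subset_le integrable_cont cont) (auto simp: field_simps)
  also have "\<dots> = real n * integral {0..pi / 2} h"
    by (rule integral_half_periods[OF cont per refl])
  also have "\<dots> \<le> 2 * X * integral {0..pi / 2} h"
    using n nonneg by (intro mult_right_mono integral_nonneg integrable_cont cont) auto
  finally show ?thesis .
qed

text \<open>
Reflection at \<open>pi / 4\<close> exchanges \<open>cos x ^ 2\<close> and \<open>sin x ^ 2\<close> and fixes the other factors, so each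
factor has mean exactly \<open>1 / 2\<close>.
\<close>

lemma integral_riesz: "integral {0..pi / 2} (riesz l) = pi / 2 / 2 ^ l"
proof (induction l)
  case 0
  have "riesz 0 = (\<lambda>x. 1)" by (simp add: fun_eq_iff)
  then show ?case by simp
next
  case (Suc l)
  have cont: "continuous_on UNIV (riesz l)" by (intro continuous_intros)
  have int: "(\<lambda>x. f x * riesz l (4 * x)) integrable_on {0..pi / 2}" if "continuous_on UNIV f" for f :: "real \<Rightarrow> real"
    using that by (intro integrable_cont continuous_intros)
  let ?C = "integral {0..pi / 2} (\<lambda>x. (cos x)\<^sup>2 * riesz l (4 * x))"
  let ?S = "integral {0..pi / 2} (\<lambda>x. (sin x)\<^sup>2 * riesz l (4 * x))"
  have "riesz l (4 * (pi / 2 - x)) = riesz l (4 * x)" for x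
    using riesz_periodic[of l "- 4 * x"] riesz_periodic[of l "pi - 4 * x"]
    by (simp add: algebra_simps)
  then have "?S = integral {0..pi / 2} (\<lambda>x. (\<lambda>y. (cos y)\<^sup>2 * riesz l (4 * y)) (pi / 2 - x))"
    by (simp add: cos_diff)
  also have "\<dots> = integral {pi / 2 - pi / 2..pi / 2 - 0} (\<lambda>y. (cos y)\<^sup>2 * riesz l (4 * y))"
    by (rule integral_reflect_shift(1)) (intro continuous_intros)
  finally have "?S = ?C" by simp
  moreover have "?C + ?S = integral {0..pi / 2} (\<lambda>x. riesz l (4 * x))"
  proof -
    have "?C + ?S = integral {0..pi / 2} (\<lambda>x. (cos x)\<^sup>2 * riesz l (4 * x) + (sin x)\<^sup>2 * riesz l (4 * x))"
      by (intro integral_add[symmetric] int continuous_intros)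
    then show ?thesis by (simp add: distrib_right[symmetric])
  qed
  moreover have "integral {0..pi / 2} (\<lambda>x. riesz l (4 * x)) = integral {4 * 0..4 * (pi / 2)} (riesz l) / 4"
    by (rule integral_scale) (auto intro!: continuous_intros)
  moreover have "integral {0..real 4 * (pi / 2)} (riesz l) = real 4 * integral {0..pi / 2} (riesz l)"
    by (rule integral_half_periods[OF cont riesz_periodic riesz_reflect])
  ultimately have "?C = integral {0..pi / 2} (riesz l) / 2" by simp
  then show ?case unfolding Suc.IH by (simp add: riesz_Suc_shift[abs_def])
qed

text \<open>
A regularised \<open>\<bar>sin x\<bar> powr (- 1 / 3)\<close>. The shift \<open>\<eta>\<close> keeps it continuous; all bounds are uniform
in \<open>\<eta>\<close>. The exponent has to exceed \<open>- 1 / 2\<close>, because near \<open>0\<close> a Riesz product behaves like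
a density with singularity \<open>x powr (- 1 / 2)\<close>.
\<close>

definition sin_weight :: "real \<Rightarrow> real \<Rightarrow> real" where
  "sin_weight \<eta> x = (\<bar>sin x\<bar> + \<eta>) powr (- 1 / 3)"

lemma continuous_on_sin_weight [continuous_intros]:
  fixes f :: "'a::t2_space \<Rightarrow> real"
  assumes "\<eta> > 0" "continuous_on S f"
  shows "continuous_on S (\<lambda>x. sin_weight \<eta> (f x))"
  unfolding sin_weight_def using assms
  by (intro continuous_intros) (auto simp: add_nonneg_eq_0_iff)

lemma sin_weight_nonneg: "0 \<le> sin_weight \<eta> x"
  by (simp add: sin_weight_def)

lemma sin_weight_sym: "sin_weight \<eta> (x + pi) = sin_weight \<eta> x" "sin_weight \<eta> (pi - x) = sin_weight \<eta> x"
  by (simp_all add: sin_weight_def)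

text \<open>
The constant \<open>8 / 5\<close> majorises the cube root of \<open>4\<close>. What matters later is that a quarter of it is
less than \<open>1 / 2\<close>.
\<close>

lemma sin_weight_le_quarter:
  assumes "0 < \<eta>"
  shows "sin_weight \<eta> x \<le> 8 / 5 * sin_weight \<eta> (4 * x)"
proof -
  have "\<bar>sin (2 * y)\<bar> \<le> 2 * \<bar>sin y\<bar>" for y :: real
    unfolding sin_double using abs_cos_le_one[of y]
    by (simp add: abs_mult mult_left_le)
  from this[of x] this[of "2 * x"] have s: "\<bar>sin (4 * x)\<bar> \<le> 4 * \<bar>sin x\<bar>" by simp
  have "((1::real) / 4) powr (- 1 / 3) \<le> 8 / 5"
  proof -
    have "((1::real) / 4) powr (- 1 / 3) = 4 powr (1 / 3)" 
      by (simp add: powr_minus_divide powr_divide divide_simps powr_minus)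
    also have "\<dots> \<le> ((8 / 5) ^ 3) powr (1 / 3)" by (intro powr_mono2) (auto simp: power3_eq_cube)
    also have "((8::real) / 5) ^ 3 = (8 / 5) powr 3" by (rule powr_numeral[symmetric]) simp
    also have "((8 / 5) powr 3) powr (1 / 3) = (8 / 5 :: real)" unfolding powr_powr by simp
    finally show ?thesis .
  qed
  note quarter = this
  have "sin_weight \<eta> x \<le> (1 / 4 * (\<bar>sin (4 * x)\<bar> + \<eta>)) powr (- 1 / 3)"
    unfolding sin_weight_def using s assms by (intro powr_mono2') (auto intro!: add_nonneg_pos)
  also have "\<dots> = (1 / 4) powr (- 1 / 3) * sin_weight \<eta> (4 * x)"
    unfolding sin_weight_def using assms by (subst powr_mult) auto
  also have "\<dots> \<le> 8 / 5 * sin_weight \<eta> (4 * x)"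
    by (intro mult_right_mono quarter sin_weight_nonneg)
  finally show ?thesis .
qed

lemma sin_weight_le_2:
  assumes "0 < \<eta>" "pi / 8 \<le> x" "x \<le> pi / 2"
  shows "sin_weight \<eta> x \<le> 2"
proof -
  have sin_pos: "0 < sin (pi / 8)" by (rule sin_gt_zero) auto
  have "sqrt 2 / 2 = 2 * sin (pi / 8) * cos (pi / 8)"
    using sin_double[of "pi / 8"] by (simp add: sin_45)
  also have "\<dots> \<le> 2 * sin (pi / 8) * 1" using sin_pos by (intro mult_left_mono) auto
  finally have "sin (pi / 8) \<ge> sqrt 2 / 4" by simp
  moreover have "sqrt 2 \<ge> 1" by simp
  moreover have "sin (pi / 8) \<le> sin x" using assms by (intro sin_monotone_2pi_le) auto
  ultimately have "1 / 8 \<le> \<bar>sin x\<bar> + \<eta>" using assms(1) by linarith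
  then have "sin_weight \<eta> x \<le> (1 / 8) powr (- 1 / 3)"
    unfolding sin_weight_def by (intro powr_mono2') auto
  also have "((1::real) / 8) = 2 powr (- 3)" by (simp add: powr_minus_divide powr_numeral)
  also have "(2 powr (- 3)) powr (- 1 / 3) = (2::real)" by (simp add: powr_powr)
  finally show ?thesis .
qed

text \<open>
Near \<open>0\<close> the weight at \<open>x\<close> is compared with the weight at \<open>4 * x\<close>; away from \<open>0\<close> it is bounded.
\<close>

lemma integral_sin_weight_split:
  assumes \<eta>: "0 < \<eta>" and f: "continuous_on UNIV f" "\<And>x. 0 \<le> f x"
    and g: "continuous_on UNIV g" "\<And>x. f x \<le> g (4 * x)"
  shows "integral {0..pi / 2} (\<lambda>x. f x * sin_weight \<eta> x)
    \<le> 2 / 5 * integral {0..pi / 2} (\<lambda>x. g x * sin_weight \<eta> x) + 2 * integral {0..pi / 2} f"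
proof -
  have int: "(\<lambda>x. f x * sin_weight \<eta> x) integrable_on {a..b}" for a b
    using \<eta> f by (intro integrable_cont continuous_intros)
  have "integral {0..pi / 8} (\<lambda>x. f x * sin_weight \<eta> x)
      \<le> integral {0..pi / 8} (\<lambda>x. 8 / 5 * (g (4 * x) * sin_weight \<eta> (4 * x)))"
  proof (rule integral_le)
    show "(\<lambda>x. 8 / 5 * (g (4 * x) * sin_weight \<eta> (4 * x))) integrable_on {0..pi / 8}"
      using \<eta> by (intro integrable_cont continuous_intros) (auto intro!: continuous_on_compose2[OF g(1)] continuous_intros)
    show "f x * sin_weight \<eta> x \<le> 8 / 5 * (g (4 * x) * sin_weight \<eta> (4 * x))" for x
    proof -
      have "f x * sin_weight \<eta> x \<le> g (4 * x) * (8 / 5 * sin_weight \<eta> (4 * x))"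
        using order_trans[OF f(2) g(2)] by (intro mult_mono g sin_weight_le_quarter \<eta> sin_weight_nonneg)
      then show ?thesis by simp
    qed
  qed (rule int)
  also have "\<dots> = 8 / 5 * integral {0..pi / 8} (\<lambda>x. g (4 * x) * sin_weight \<eta> (4 * x))"
    by simp
  also have "integral {0..pi / 8} (\<lambda>x. g (4 * x) * sin_weight \<eta> (4 * x))
      = integral {4 * 0..4 * (pi / 8)} (\<lambda>x. g x * sin_weight \<eta> x) / 4"
    using \<eta> g by (intro integral_scale[where g = "\<lambda>x. g x * sin_weight \<eta> x"] continuous_intros) auto
  finally have near: "integral {0..pi / 8} (\<lambda>x. f x * sin_weight \<eta> x)
      \<le> 2 / 5 * integral {0..pi / 2} (\<lambda>x. g x * sin_weight \<eta> x)" by simp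
  have "integral {pi / 8..pi / 2} (\<lambda>x. f x * sin_weight \<eta> x) \<le> integral {pi / 8..pi / 2} (\<lambda>x. f x * 2)"
    using \<eta> f by (intro integral_le int integrable_cont continuous_intros mult_left_mono sin_weight_le_2) auto
  also have "\<dots> \<le> integral {0..pi / 2} (\<lambda>x. f x * 2)"
    using f by (intro integral_subset_le integrable_cont continuous_intros) auto
  finally have far: "integral {pi / 8..pi / 2} (\<lambda>x. f x * sin_weight \<eta> x) \<le> 2 * integral {0..pi / 2} f"
    by simp
  show ?thesis
    using near far Henstock_Kurzweil_Integration.integral_combine[of 0 "pi / 8" "pi / 2" "\<lambda>x. f x * sin_weight \<eta> x"] int
    by simp
qed

text \<open>
The singular part contracts by \<open>2 / 5\<close> from one generation to the next, faster than the factor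
\<open>1 / 2\<close> by which the mass of the Riesz product decays, so the regular part dominates.
\<close>

lemma integral_riesz_sin_weight_le:
  assumes "0 < \<eta>"
  shows "integral {0..pi / 2} (\<lambda>x. riesz l x * sin_weight \<eta> x) \<le> 20 / 2 ^ l"
proof (induction l)
  case 0
  show ?case
    using integral_sin_weight_split[OF assms, of "\<lambda>_. 1" "\<lambda>_. 1"] pi_less_4 by simp
next
  case (Suc l)
  have "integral {0..pi / 2} (\<lambda>x. riesz (Suc l) x * sin_weight \<eta> x)
      \<le> 2 / 5 * integral {0..pi / 2} (\<lambda>x. riesz l x * sin_weight \<eta> x) + 2 * integral {0..pi / 2} (riesz (Suc l))"
  proof (rule integral_sin_weight_split[OF assms])
    fix x
    have "(cos x)\<^sup>2 * riesz l (4 * x) \<le> 1 * riesz l (4 * x)"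
      by (intro mult_right_mono riesz_nonneg) (simp add: abs_square_le_1)
    then show "riesz (Suc l) x \<le> riesz l (4 * x)" by (simp add: riesz_Suc_shift)
  qed (auto intro!: continuous_intros riesz_nonneg)
  also have "\<dots> \<le> 2 / 5 * (20 / 2 ^ l) + 2 * (pi / 2 / 2 ^ Suc l)"
    unfolding integral_riesz using Suc.IH by simp
  also have "\<dots> \<le> 20 / 2 ^ Suc l"
    using pi_less_4 by (simp add: field_simps)
  finally show ?case .
qed

text \<open>
Either the product of the two weights is at least \<open>A\<close>, or both sines are at least \<open>\<eta>\<close> and then their
product is at least of order \<open>A ^ (- 3)\<close>. This replaces cutting out the set where the low frequencies
are small.
\<close>

lemma sin_weight_or_sines_large:
  assumes A: "1 \<le> A"
  defines "\<eta> \<equiv> 1 / (4 * A ^ 3)"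
  shows "1 \<le> sin_weight \<eta> x * sin_weight \<eta> y / A + 16 * A ^ 6 * ((sin x)\<^sup>2 * (sin y)\<^sup>2)"
proof -
  define z where "z = (\<bar>sin x\<bar> + \<eta>) * (\<bar>sin y\<bar> + \<eta>)"
  have A3: "1 \<le> A ^ 3" using A by (rule one_le_power)
  have \<eta>: "0 < \<eta>" "\<eta> \<le> 1 / 4" using A A3 by (auto simp: \<eta>_def divide_le_eq)
  have z0: "0 < z" unfolding z_def using \<eta> by (intro mult_pos_pos add_nonneg_pos) auto
  have S: "sin_weight \<eta> x * sin_weight \<eta> y = z powr (- 1 / 3)"
    unfolding sin_weight_def z_def using \<eta>(1) by (simp add: powr_mult)
  show ?thesis
  proof (cases "z \<le> 1 / A ^ 3")
    case True
    have "A = (1 / A ^ 3) powr (- 1 / 3)"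
    proof -
      have "1 / A ^ 3 = A powr (- 3)" using A by (simp add: powr_minus_divide powr_numeral)
      then show ?thesis using A by (simp add: powr_powr)
    qed
    also have "\<dots> \<le> z powr (- 1 / 3)" using True z0 by (intro powr_mono2') auto
    finally have "1 \<le> sin_weight \<eta> x * sin_weight \<eta> y / A" using A S by simp
    moreover have "0 \<le> 16 * A ^ 6 * ((sin x)\<^sup>2 * (sin y)\<^sup>2)" using A by simp
    ultimately show ?thesis by linarith
  next
    case False
    \<comment> \<open>A sine below \<open>\<eta>\<close> would make the product \<open>z\<close> at most \<open>4 * \<eta> = 1 / A ^ 3\<close>.\<close>
    have big: "\<eta> \<le> \<bar>sin u\<bar>" if zu: "z = (\<bar>sin u\<bar> + \<eta>) * (\<bar>sin v\<bar> + \<eta>)" for u v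
    proof (rule ccontr)
      assume "\<not> \<eta> \<le> \<bar>sin u\<bar>"
      then have "z \<le> (2 * \<eta>) * 2"
        unfolding zu using \<eta> abs_sin_le_one[of v] by (intro mult_mono) linarith+
      then show False using False by (simp add: \<eta>_def)
    qed
    have "\<eta> \<le> \<bar>sin x\<bar>" "\<eta> \<le> \<bar>sin y\<bar>" using big[of x y] big[of y x] by (simp_all add: z_def mult.commute)
    then have "z \<le> (2 * \<bar>sin x\<bar>) * (2 * \<bar>sin y\<bar>)"
      unfolding z_def using \<eta> by (intro mult_mono) auto
    then have "1 / A ^ 3 \<le> 4 * (\<bar>sin x\<bar> * \<bar>sin y\<bar>)" using False by simp
    then have "A ^ 3 * (1 / A ^ 3) \<le> A ^ 3 * (4 * (\<bar>sin x\<bar> * \<bar>sin y\<bar>))"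
      using A A3 by (intro mult_left_mono) auto
    then have "1 \<le> 4 * A ^ 3 * (\<bar>sin x\<bar> * \<bar>sin y\<bar>)" using A by (simp add: mult_ac)
    then have "1 \<le> (4 * A ^ 3 * (\<bar>sin x\<bar> * \<bar>sin y\<bar>))\<^sup>2" by (rule one_le_power)
    also have "\<dots> = 16 * A ^ 6 * ((sin x)\<^sup>2 * (sin y)\<^sup>2)"
      by (simp add: power_mult_distrib flip: power_mult)
    finally have "1 \<le> 16 * A ^ 6 * ((sin x)\<^sup>2 * (sin y)\<^sup>2)" .
    moreover have "0 \<le> sin_weight \<eta> x * sin_weight \<eta> y / A" using A by (simp add: sin_weight_nonneg)
    ultimately show ?thesis by linarith
  qed
qed

section \<open>Few directions have small energy\<close>

definition weighted_riesz :: "real \<Rightarrow> nat \<Rightarrow> real \<Rightarrow> real" where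
  "weighted_riesz \<eta> l x = riesz l x * sin_weight \<eta> x"

lemma weighted_riesz_nonneg: "0 \<le> weighted_riesz \<eta> l x"
  by (simp add: weighted_riesz_def riesz_nonneg sin_weight_nonneg)

lemma weighted_riesz_sym: "weighted_riesz \<eta> l (x + pi) = weighted_riesz \<eta> l x" "weighted_riesz \<eta> l (pi - x) = weighted_riesz \<eta> l x"
  by (simp_all add: weighted_riesz_def riesz_periodic riesz_reflect sin_weight_sym)

lemma continuous_on_weighted_riesz [continuous_intros]:
  fixes f :: "'a::t2_space \<Rightarrow> real"
  shows "\<eta> > 0 \<Longrightarrow> continuous_on S f \<Longrightarrow> continuous_on S (\<lambda>x. weighted_riesz \<eta> l (f x))"
  unfolding weighted_riesz_def by (intro continuous_intros)

lemma integral_weighted_riesz_dilated_le: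
  assumes "0 < \<eta>" "1 \<le> c"
  shows "integral {0..1} (\<lambda>x. weighted_riesz \<eta> l (c * x)) \<le> 40 / 2 ^ l"
proof -
  have cont: "continuous_on UNIV (weighted_riesz \<eta> l)" using assms by (intro continuous_intros)
  have "integral {0..1} (\<lambda>x. weighted_riesz \<eta> l (c * x)) = integral {c * 0..c * 1} (weighted_riesz \<eta> l) / c"
    using assms by (intro integral_scale cont) auto
  also have "integral {c * 0..c * 1} (weighted_riesz \<eta> l) \<le> 2 * c * integral {0..pi / 2} (weighted_riesz \<eta> l)"
    using integral_periodic_le[OF cont weighted_riesz_nonneg weighted_riesz_sym assms(2)] by simp
  also have "integral {0..pi / 2} (weighted_riesz \<eta> l) \<le> 20 / 2 ^ l"
    using integral_riesz_sin_weight_le[OF assms(1)] by (simp add: weighted_riesz_def[abs_def])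
  finally show ?thesis using assms by (simp add: divide_right_mono mult_left_mono)
qed

text \<open>
The mass in one block of the high-frequency part of the spectrum, weighted by the singularities at the zeros
of \<open>sin (4 ^ m * v)\<close> and \<open>sin (4 ^ m * v * t)\<close>.
\<close>

definition weighted_mass :: "real \<Rightarrow> nat \<Rightarrow> nat \<Rightarrow> real \<Rightarrow> real" where
  "weighted_mass \<eta> m l t
    = integral {1 / 4 ^ m..1} (\<lambda>v. weighted_riesz \<eta> l (4 ^ m * v) * weighted_riesz \<eta> l (4 ^ m * v * t))"

lemma weighted_mass_nonneg: "0 < \<eta> \<Longrightarrow> 0 \<le> weighted_mass \<eta> m l t"
  unfolding weighted_mass_def
  by (intro integral_nonneg integrable_cont continuous_intros mult_nonneg_nonneg weighted_riesz_nonneg)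

lemma continuous_on_weighted_mass:
  assumes "0 < \<eta>"
  shows "continuous_on {0..1} (weighted_mass \<eta> m l)"
proof -
  have "continuous_on (cbox 0 1) (\<lambda>t. integral (cbox (1 / 4 ^ m) 1)
      (\<lambda>v. weighted_riesz \<eta> l (4 ^ m * v) * weighted_riesz \<eta> l (4 ^ m * v * t)))"
    by (rule integral_continuous_on_param)
       (use assms in \<open>auto simp: case_prod_unfold intro!: continuous_intros\<close>)
  then show ?thesis by (simp add: weighted_mass_def[abs_def])
qed

text \<open>
Averaging over all slopes decouples the two Riesz products: for fixed \<open>v\<close> in the block, \<open>4 ^ m * v * t\<close>
runs over an interval of length at least \<open>1\<close> as \<open>t\<close> varies.
\<close>

lemma integral_weighted_mass_le:
  assumes \<eta>: "0 < \<eta>"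
  shows "integral {0..1} (weighted_mass \<eta> m l) \<le> 1600 / 4 ^ l"
proof -
  let ?h = "weighted_riesz \<eta> l" and ?a = "1 / 4 ^ m :: real"
  have cont: "continuous_on (cbox (0, ?a) (1, 1)) (\<lambda>(t, v). ?h (4 ^ m * v) * ?h (4 ^ m * v * t))"
    unfolding case_prod_unfold by (intro continuous_intros \<eta>)
  have "integral {0..1} (weighted_mass \<eta> m l)
      = integral {?a..1} (\<lambda>v. integral {0..1} (\<lambda>t. ?h (4 ^ m * v) * ?h (4 ^ m * v * t)))"
    unfolding weighted_mass_def[abs_def]
    using integral_swap_continuous[OF cont] by simp
  also have "\<dots> = integral {?a..1} (\<lambda>v. ?h (4 ^ m * v) * integral {0..1} (\<lambda>t. ?h (4 ^ m * v * t)))"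
    by simp
  also have "\<dots> \<le> integral {?a..1} (\<lambda>v. ?h (4 ^ m * v) * (40 / 2 ^ l))"
  proof (rule integral_le)
    have "continuous_on (cbox ?a 1) (\<lambda>v. integral (cbox 0 1) (\<lambda>t. ?h (4 ^ m * v * t)))"
      by (rule integral_continuous_on_param)
         (use \<eta> in \<open>auto simp: case_prod_unfold intro!: continuous_intros\<close>)
    then show "(\<lambda>v. ?h (4 ^ m * v) * integral {0..1} (\<lambda>t. ?h (4 ^ m * v * t))) integrable_on {?a..1}"
      using \<eta> by (intro integrable_continuous_interval continuous_intros) auto
    fix v assume "v \<in> {?a..1}"
    then have "1 \<le> 4 ^ m * v" by (simp add: field_simps)
    then show "?h (4 ^ m * v) * integral {0..1} (\<lambda>t. ?h (4 ^ m * v * t)) \<le> ?h (4 ^ m * v) * (40 / 2 ^ l)"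
      by (intro mult_left_mono integral_weighted_riesz_dilated_le \<eta> weighted_riesz_nonneg)
  qed (use \<eta> in \<open>auto intro!: integrable_cont continuous_intros\<close>)
  also have "\<dots> = integral {?a..1} (\<lambda>v. ?h (4 ^ m * v)) * (40 / 2 ^ l)" by simp
  also have "\<dots> \<le> 40 / 2 ^ l * (40 / 2 ^ l)"
  proof (rule mult_right_mono)
    have "integral {?a..1} (\<lambda>v. ?h (4 ^ m * v)) \<le> integral {0..1} (\<lambda>v. ?h (4 ^ m * v))"
      using \<eta> by (intro integral_subset_le integrable_cont continuous_intros) (auto intro: weighted_riesz_nonneg)
    also have "\<dots> \<le> 40 / 2 ^ l" by (intro integral_weighted_riesz_dilated_le \<eta>) simp
    finally show "integral {?a..1} (\<lambda>v. ?h (4 ^ m * v)) \<le> 40 / 2 ^ l" .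
  qed simp
  also have "40 / 2 ^ l * (40 / 2 ^ l) = 1600 / (4::real) ^ l"
    by (simp flip: power_mult_distrib)
  finally show ?thesis .
qed

text \<open>
On the block \<open>[4 ^ (- m), 1]\<close> the spectrum of generation \<open>m + l\<close> is the product of \<open>m\<close>
low-frequency factors and of the high-frequency part \<open>power_spectrum l t (4 ^ m * v)\<close>. Positivity gives
the latter the mass \<open>4 ^ (- l) / 2\<close> on the unit interval, and \<open>m\<close> is so large that at most half of it
lies to the left of the block. The rest is either paid for by the weighted mass or survives multiplication
with the low-frequency factors.
\<close>

lemma block_lower_bound:
  assumes t: "0 \<le> t" "t \<le> 1" and A: "1 \<le> A"
    and B: "integral {0..1} (power_spectrum l t) \<le> B / 4 ^ l" "4 * B \<le> 4 ^ m"
  shows "1 / 4 / 4 ^ l \<le> weighted_mass (1 / (4 * A ^ 3)) m l t / A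
    + 16 * A ^ 6 * 256 ^ m * integral {1 / 4 ^ m..1} (power_spectrum (m + l) t)"
proof -
  define \<eta> where "\<eta> = 1 / (4 * A ^ 3)"
  have \<eta>: "0 < \<eta>" using A by (simp add: \<eta>_def)
  let ?a = "1 / 4 ^ m :: real" and ?V = "\<lambda>v. power_spectrum l t (4 ^ m * v)"
  have a: "0 \<le> ?a" "?a \<le> 1" by (auto simp: divide_le_eq)
  have intV: "?V integrable_on {x..y}" for x y by (intro integrable_cont continuous_intros)
  have "integral {0..?a} ?V = integral {4 ^ m * 0..4 ^ m * ?a} (power_spectrum l t) / 4 ^ m"
    using a by (intro integral_scale) (auto intro!: continuous_intros)
  also have "\<dots> \<le> B / 4 ^ l / 4 ^ m" using divide_right_mono[OF B(1), of "4 ^ m"] by simp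
  also have "\<dots> = B / 4 ^ m / 4 ^ l" by simp
  also have "\<dots> \<le> 1 / 4 / 4 ^ l" using B(2) by (intro divide_right_mono) (auto simp: field_simps)
  finally have "1 / 4 / 4 ^ l \<le> integral {?a..1} ?V"
    using integral_power_spectrum_dilated_ge[of l t "4 ^ m"]
      Henstock_Kurzweil_Integration.integral_combine[OF a intV] by simp
  also have "\<dots> \<le> integral {?a..1} (\<lambda>v. weighted_riesz \<eta> l (4 ^ m * v) * weighted_riesz \<eta> l (4 ^ m * v * t) / A
      + 16 * A ^ 6 * 256 ^ m * power_spectrum (m + l) t v)"
  proof (rule integral_le)
    fix v
    let ?x = "4 ^ m * v" and ?y = "4 ^ m * (t * v)"
    have V: "?V v = riesz l ?x * riesz l ?y" by (simp add: power_spectrum_def mult_ac)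
    have "?V v * 1 \<le> ?V v * (sin_weight \<eta> ?x * sin_weight \<eta> ?y / A + 16 * A ^ 6 * ((sin ?x)\<^sup>2 * (sin ?y)\<^sup>2))"
      unfolding \<eta>_def by (intro mult_left_mono sin_weight_or_sines_large A power_spectrum_nonneg)
    also have "\<dots> = weighted_riesz \<eta> l ?x * weighted_riesz \<eta> l ?y / A + 16 * A ^ 6 * (?V v * ((sin ?x)\<^sup>2 * (sin ?y)\<^sup>2))"
      unfolding V weighted_riesz_def by (simp add: algebra_simps)
    also have "\<dots> \<le> weighted_riesz \<eta> l ?x * weighted_riesz \<eta> l ?y / A
        + 16 * A ^ 6 * (?V v * ((16 ^ m * riesz m v) * (16 ^ m * riesz m (t * v))))"
      using A by (intro add_left_mono mult_left_mono mult_mono sin_sq_le_riesz power_spectrum_nonneg)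
        (auto intro!: mult_nonneg_nonneg riesz_nonneg)
    also have "?V v * ((16 ^ m * riesz m v) * (16 ^ m * riesz m (t * v))) = 256 ^ m * power_spectrum (m + l) t v"
    proof -
      have "(256::real) ^ m = 16 ^ m * 16 ^ m" by (simp flip: power_mult_distrib)
      then show ?thesis unfolding V power_spectrum_def riesz_add by (simp add: mult_ac)
    qed
    also have "4 ^ m * (t * v) = 4 ^ m * v * t" by simp
    finally show "?V v \<le> weighted_riesz \<eta> l (4 ^ m * v) * weighted_riesz \<eta> l (4 ^ m * v * t) / A
      + 16 * A ^ 6 * 256 ^ m * power_spectrum (m + l) t v" by (simp add: mult.assoc)
  qed (use \<eta> A in \<open>auto intro!: integrable_cont continuous_intros\<close>)
  also have "\<dots> = weighted_mass \<eta> m l t / A + 16 * A ^ 6 * 256 ^ m * integral {?a..1} (power_spectrum (m + l) t)"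
    unfolding weighted_mass_def using \<eta> A
    by (subst integral_add) (auto intro!: integrable_cont continuous_intros)
  finally show ?thesis unfolding \<eta>_def .
qed

definition total_weighted_mass :: "real \<Rightarrow> nat \<Rightarrow> nat \<Rightarrow> real \<Rightarrow> real" where
  "total_weighted_mass \<eta> m M t = (\<Sum>i<M. 4 ^ (i * m) * weighted_mass \<eta> m (i * m) t)"

text \<open>
A direction of small energy distributes its spectrum so thinly over the \<open>M\<close> blocks that the second term of
the block bound contributes at most half. The weighted mass has to make up for the other half.
\<close>

lemma total_weighted_mass_ge:
  assumes t: "0 \<le> t" "t \<le> 1" and A: "1 \<le> A"
    and e: "energy t N \<le> 4 * K"
    and m: "3200 * K \<le> 4 ^ m" "M * m \<le> N"
    and M: "128 * A ^ 6 * 64 ^ m * (800 * K) \<le> real M"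
  shows "A * real M / 8 \<le> total_weighted_mass (1 / (4 * A ^ 3)) m M t"
proof -
  let ?R = "\<lambda>i. integral {1 / 4 ^ m..1} (power_spectrum (Suc i * m) t)"
  have S: "integral {0..1} (power_spectrum N t) \<le> 200 * K / 4 ^ N"
  proof -
    have "50 * energy t N / 4 ^ N \<le> 50 * (4 * K) / 4 ^ N"
      using e by (intro divide_right_mono) auto
    then show ?thesis using integral_power_spectrum_le_energy[where n = N and t = t] by simp
  qed
  have B: "integral {0..1} (power_spectrum l t) \<le> 800 * K / 4 ^ l" if "l \<le> N" for l
  proof -
    have "integral {0..1} (power_spectrum l t) \<le> 4 * 4 ^ (N - l) * (200 * K / 4 ^ N)"
      using integral_power_spectrum_le[OF t that] S by (rule order_trans[OF _ mult_left_mono]) simp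
    also have "\<dots> = 800 * K / 4 ^ l" using that by (simp add: power_diff)
    finally show ?thesis .
  qed
  have scale: "1 / 4 \<le> 4 ^ (i * m) * weighted_mass (1 / (4 * A ^ 3)) m (i * m) t / A
      + 16 * A ^ 6 * 64 ^ m * (4 ^ (Suc i * m) * ?R i)" if "i < M" for i
  proof -
    have "i * m \<le> M * m" using that by (intro mult_right_mono) auto
    also note m(2)
    finally have "1 / 4 / 4 ^ (i * m) \<le> weighted_mass (1 / (4 * A ^ 3)) m (i * m) t / A
        + 16 * A ^ 6 * 256 ^ m * ?R i"
      using block_lower_bound[OF t A B, of "i * m" m] m(1) by simp
    then have "4 ^ (i * m) * (1 / 4 / 4 ^ (i * m)) \<le> 4 ^ (i * m) * (weighted_mass (1 / (4 * A ^ 3)) m (i * m) t / A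
        + 16 * A ^ 6 * 256 ^ m * ?R i)" by (intro mult_left_mono) auto
    moreover have "(256::real) ^ m = 64 ^ m * 4 ^ m" by (simp flip: power_mult_distrib)
    moreover have "(4::real) ^ (Suc i * m) = 4 ^ m * 4 ^ (i * m)" by (simp add: power_add)
    ultimately show ?thesis by (simp add: algebra_simps)
  qed
  have "real M / 4 = (\<Sum>i<M. 1 / 4)" by simp
  also have "\<dots> \<le> (\<Sum>i<M. 4 ^ (i * m) * weighted_mass (1 / (4 * A ^ 3)) m (i * m) t / A
      + 16 * A ^ 6 * 64 ^ m * (4 ^ (Suc i * m) * ?R i))"
    using scale by (intro sum_mono) auto
  also have "\<dots> = total_weighted_mass (1 / (4 * A ^ 3)) m M t / A
      + 16 * A ^ 6 * 64 ^ m * (\<Sum>i<M. 4 ^ (Suc i * m) * ?R i)"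
    unfolding total_weighted_mass_def sum.distrib sum_divide_distrib sum_distrib_left ..
  also have "\<dots> \<le> total_weighted_mass (1 / (4 * A ^ 3)) m M t / A + 16 * A ^ 6 * 64 ^ m * (800 * K)"
  proof (intro add_left_mono mult_left_mono)
    have "(\<Sum>i<M. 4 ^ (Suc i * m) * ?R i) \<le> 4 * 4 ^ N * (200 * K / 4 ^ N)"
      using sum_integral_power_spectrum_scales_le[OF t m(2)] S by (rule order_trans[OF _ mult_left_mono]) simp
    then show "(\<Sum>i<M. 4 ^ (Suc i * m) * ?R i) \<le> 800 * K" by simp
  qed (use A in auto)
  also have "16 * A ^ 6 * 64 ^ m * (800 * K) = 128 * A ^ 6 * 64 ^ m * (800 * K) / 8" by simp
  finally have "real M / 8 \<le> total_weighted_mass (1 / (4 * A ^ 3)) m M t / A" using M by linarith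
  then show ?thesis using A by (simp add: field_simps)
qed

lemma measure_superlevel_le:
  fixes f :: "real \<Rightarrow> real"
  assumes f: "continuous_on {a..b} f" "\<And>x. x \<in> {a..b} \<Longrightarrow> 0 \<le> f x"
  shows "compact {x \<in> {a..b}. c \<le> f x}"
    and "c * measure lebesgue {x \<in> {a..b}. c \<le> f x} \<le> integral {a..b} f"
proof -
  let ?E = "{x \<in> {a..b}. c \<le> f x}"
  have "closed ({a..b} \<inter> f -` {c..})" using f(1) by (intro continuous_closed_preimage) auto
  moreover have "{a..b} \<inter> f -` {c..} = ?E" by auto
  ultimately have "compact ({a..b} \<inter> ?E)" by (intro compact_Int_closed) auto
  then show "compact ?E" by (simp add: Int_absorb1 subset_eq)
  then have lm: "?E \<in> lmeasurable" by (rule lmeasurable_compact)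
  have "((\<lambda>x. 1) has_integral measure lebesgue ?E) ?E"
    using lmeasure_integral[OF lm] integrable_on_const[OF lm, of 1] by (simp add: has_integral_iff)
  then have "((\<lambda>x. c * 1) has_integral c * measure lebesgue ?E) ?E"
    by (rule has_integral_mult_right)
  then have I: "((\<lambda>x. if x \<in> ?E then c * 1 else 0) has_integral c * measure lebesgue ?E) {a..b}"
    by (subst has_integral_restrict) auto
  show "c * measure lebesgue ?E \<le> integral {a..b} f"
    by (rule has_integral_le[OF I integrable_integral[OF integrable_continuous_interval[OF f(1)]]])
       (auto simp: f(2))
qed

text \<open>
Markov's inequality, with the mean of the weighted mass computed above.
\<close>

lemma large_total_weighted_mass_set:
  fixes m M :: nat
  assumes \<eta>: "0 < \<eta>" and A: "0 < A" and M: "0 < M"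
  defines "E \<equiv> {t \<in> {0..1}. A * real M / 8 \<le> total_weighted_mass \<eta> m M t}"
  shows "compact E" "measure lebesgue E \<le> 12800 / A"
proof -
  have cont: "continuous_on {0..1} (total_weighted_mass \<eta> m M)"
    unfolding total_weighted_mass_def[abs_def] by (intro continuous_intros continuous_on_weighted_mass \<eta>)
  have nn: "0 \<le> total_weighted_mass \<eta> m M t" for t
    unfolding total_weighted_mass_def by (intro sum_nonneg mult_nonneg_nonneg weighted_mass_nonneg \<eta>) auto
  show "compact E" unfolding E_def by (rule measure_superlevel_le(1)[OF cont nn])
  have "A * real M / 8 * measure lebesgue E \<le> integral {0..1} (total_weighted_mass \<eta> m M)"
    unfolding E_def by (rule measure_superlevel_le(2)[OF cont nn])
  also have "\<dots> = (\<Sum>i<M. 4 ^ (i * m) * integral {0..1} (weighted_mass \<eta> m (i * m)))"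
    unfolding total_weighted_mass_def[abs_def] using continuous_on_weighted_mass[OF \<eta>]
    by (subst integral_sum) (auto intro!: integrable_continuous_interval continuous_intros)
  also have "\<dots> \<le> (\<Sum>i<M. 4 ^ (i * m) * (1600 / 4 ^ (i * m)))"
    by (intro sum_mono mult_left_mono integral_weighted_mass_le \<eta>) auto
  also have "\<dots> = 1600 * real M" by simp
  finally show "measure lebesgue E \<le> 12800 / A" using A M by (simp add: field_simps)
qed

lemma square_le_two_power: "i\<^sup>2 \<le> 2 * 2 ^ i" for i :: nat
proof (induction i)
  case (Suc i)
  show ?case
  proof (cases "i \<le> 2")
    case True
    then have "i = 0 \<or> i = 1 \<or> i = 2" by auto
    then show ?thesis by (auto simp: power2_eq_square)
  next
    case False
    then have "3 * i \<le> i * i" by (intro mult_le_mono1) simp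
    moreover have "(Suc i)\<^sup>2 = i * i + 2 * i + 1" by (simp add: power2_eq_square)
    ultimately have "(Suc i)\<^sup>2 \<le> 2 * i\<^sup>2" using False unfolding power2_eq_square by linarith
    then show ?thesis using Suc by simp
  qed
qed simp

lemma power_swap: "(a ^ i) ^ j = (a ^ j) ^ i" for a :: real
  by (metis mult.commute power_mult)

text \<open>
The exceptional directions are those of large weighted mass. A direction outside has energy above
\<open>4 * 2 ^ i\<close> at generation \<open>N\<close>, and the combinatorial half shortens its projection. With \<open>K = 2 ^ i\<close>,
\<open>n\<close> is about \<open>K * i * N\<close>, there are about \<open>N / i\<close> blocks, and the admissible \<open>A\<close> satisfies
\<open>A ^ 6 = O(M / K ^ 4)\<close>. One of the six powers of \<open>K\<close> in the resulting \<open>A ^ 6 = c * n / K ^ 6\<close> only serves to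
absorb the factors \<open>i\<close>.
\<close>

lemma few_bad_directions:
  assumes i: "i \<ge> 1" and n: "n \<ge> 1"
  obtains E where "compact E"
    "measure lebesgue E \<le> 64000000 * 2 ^ i / real n powr (1 / 6)"
    "\<And>t. t \<in> {0..1} - E \<Longrightarrow> cover_length t n \<le> 8 / 2 ^ i"
proof -
  \<comment> \<open>The constant satisfies \<open>128 * 800 * 16384 ^ 3 * 30720 \<le> 5000 ^ 6\<close>, which \<open>M_large\<close> below needs; the
    constant of the statement is \<open>64000000 = 12800 * 5000\<close>.\<close>
  define A where "A = real n powr (1 / 6) / (5000 * 2 ^ i)"
  have A0: "0 < A" using n by (simp add: A_def)
  show thesis
  proof (cases "1 \<le> A")
    case False
    \<comment> \<open>Here the claimed bound exceeds \<open>1\<close>, and all slopes may be declared exceptional.\<close>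
    then have "real n powr (1 / 6) < 5000 * 2 ^ i" by (simp add: A_def field_simps)
    also have "\<dots> \<le> 64000000 * 2 ^ i" by simp
    finally have "1 \<le> 64000000 * 2 ^ i / real n powr (1 / 6)"
      using n by (simp add: le_divide_eq)
    then show thesis using that[of "{0..1}"] by simp
  next
    case True
    have A6: "A ^ 6 = real n / (5000 ^ 6 * 64 ^ i)"
    proof -
      have "(real n powr (1 / 6)) ^ 6 = real n" using n by (simp add: powr_power)
      moreover have "((2::real) ^ i) ^ 6 = 64 ^ i" using power_swap[of 2 i 6] by simp
      ultimately show ?thesis by (simp add: A_def power_divide power_mult_distrib)
    qed
    have n_ge: "5000 ^ 6 * 64 ^ i \<le> real n"
    proof -
      have "1 \<le> A ^ 6" using True by (rule one_le_power)
      then show ?thesis unfolding A6 by (simp add: le_divide_eq)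
    qed
    \<comment> \<open>The number of rounds in the combinatorial half.\<close>
    define r where "r = 960 * 2 ^ i * i"
    \<comment> \<open>The number of low-frequency factors: \<open>4 ^ m\<close> is comparable with \<open>2 ^ i\<close>.\<close>
    define m where "m = 7 + i div 2"
    define N where "N = n div r"
    define M where "M = N div m"
    have four_m: "3200 * 2 ^ i \<le> (4::real) ^ m" "(4::real) ^ m \<le> 16384 * 2 ^ i"
    proof -
      have "(4::real) ^ m = 16384 * 2 ^ (2 * (i div 2))" by (simp add: m_def power_add power_mult)
      moreover have "(2::real) ^ (2 * (i div 2)) \<le> 2 ^ i" by (intro power_increasing) auto
      moreover have "(2::real) ^ i \<le> 2 * 2 ^ (2 * (i div 2))"
        using power_increasing[of i "Suc (2 * (i div 2))" "2::real"] by simp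
      moreover have "0 \<le> (2::real) ^ (2 * (i div 2))" by simp
      ultimately show "3200 * 2 ^ i \<le> (4::real) ^ m" "(4::real) ^ m \<le> 16384 * 2 ^ i" by linarith+
    qed
    have rm: "r * m \<le> 15360 * 4 ^ i"
    proof -
      have "i * m \<le> i * (8 * i)" using i by (intro mult_left_mono) (auto simp: m_def)
      then have "i * m \<le> 8 * i\<^sup>2" by (simp add: power2_eq_square)
      also have "\<dots> \<le> 8 * (2 * 2 ^ i)" using square_le_two_power[of i] by (intro mult_left_mono) auto
      finally have "960 * 2 ^ i * (i * m) \<le> 960 * 2 ^ i * (16 * 2 ^ i)" by simp
      also have "\<dots> = 15360 * (2 ^ i * 2 ^ i)" by simp
      also have "(2::nat) ^ i * 2 ^ i = 4 ^ i" by (simp flip: power_mult_distrib)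
      finally show ?thesis by (simp add: r_def mult.assoc)
    qed
    have rm0: "0 < r * m" using i by (simp add: r_def m_def)
    have "real n / (30720 * 4 ^ i) \<le> real M"
    proof -
      have M: "M = n div (r * m)" by (simp add: M_def N_def div_mult2_eq)
      have "real (r * m) \<le> real (15360 * 4 ^ i)" using rm by (rule of_nat_mono)
      also have "\<dots> = 15360 * 4 ^ i" by simp
      finally have "real (r * m) \<le> 15360 * 4 ^ i" .
      have "real n / (15360 * 4 ^ i) \<le> real n / real (r * m)"
        using \<open>real (r * m) \<le> 15360 * 4 ^ i\<close> rm0 by (intro divide_left_mono mult_pos_pos) auto
      also have "\<dots> \<le> real M + 1"
      proof -
        have "n \<le> (M + 1) * (r * m)"
          unfolding M using dividend_less_div_times[OF rm0, of n] by (simp add: algebra_simps)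
        then have "real n \<le> real ((M + 1) * (r * m))" by (rule of_nat_mono)
        then show ?thesis using rm0 by (simp add: divide_le_eq distrib_right add.commute)
      qed
      finally have "real n / (15360 * 4 ^ i) \<le> real M + 1" .
      moreover have "2 \<le> real n / (15360 * 4 ^ i)"
      proof -
        have "2 * (15360 * 4 ^ i) = 30720 * (4::real) ^ i" by simp
        also have "\<dots> \<le> 5000 ^ 6 * 64 ^ i" by (intro mult_mono power_mono) auto
        finally have "2 * (15360 * 4 ^ i) \<le> (5000 ^ 6 * 64 ^ i :: real)" .
        then show ?thesis using n_ge by (simp add: le_divide_eq)
      qed
      ultimately show ?thesis by simp
    qed
    note M_ge = this
    have "0 < real n / (30720 * 4 ^ i)" using n by simp
    then have M0: "0 < M" using M_ge by linarith
    have M_large: "128 * A ^ 6 * 64 ^ m * (800 * 2 ^ i) \<le> real M"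
    proof -
      have "(64::real) ^ m = (4 ^ m) ^ 3" using power_swap[of 4 m 3] by simp
      also have "\<dots> \<le> (16384 * 2 ^ i) ^ 3" using four_m(2) by (intro power_mono) auto
      also have "\<dots> = 16384 ^ 3 * 8 ^ i"
        using power_swap[of 2 i 3] by (simp add: power_mult_distrib)
      finally have "128 * A ^ 6 * 64 ^ m * (800 * 2 ^ i) \<le> 128 * A ^ 6 * (16384 ^ 3 * 8 ^ i) * (800 * 2 ^ i)"
        by (intro mult_left_mono mult_right_mono) auto
      also have "\<dots> = (128 * 800 * 16384 ^ 3 * 30720 / 5000 ^ 6) * (real n / (30720 * 4 ^ i))"
      proof -
        have "(64::real) ^ i = 4 ^ i * (8 ^ i * 2 ^ i)" by (simp flip: power_mult_distrib)
        then show ?thesis unfolding A6 by (simp add: field_simps)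
      qed
      also have "\<dots> \<le> 1 * (real n / (30720 * 4 ^ i))" by (intro mult_right_mono) auto
      finally show ?thesis using M_ge by simp
    qed
    have Mm: "M * m \<le> N" unfolding M_def by (rule div_times_less_eq_dividend)
    have "r * N \<le> n" unfolding N_def by (rule times_div_less_eq_dividend)
    then have rN: "960 * 2 ^ i * i * N \<le> n" unfolding r_def .
    \<comment> \<open>Defined by the weighted mass and not by the energy: this set is closed, and Markov applies to it.\<close>
    define E where "E = {t \<in> {0..1}. A * real M / 8 \<le> total_weighted_mass (1 / (4 * A ^ 3)) m M t}"
    have \<eta>: "0 < 1 / (4 * A ^ 3)" using A0 by simp
    show thesis
    proof (rule that[of E])
      show "compact E" unfolding E_def by (rule large_total_weighted_mass_set(1)[OF \<eta> A0 M0])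
      have "measure lebesgue E \<le> 12800 / A"
        unfolding E_def by (rule large_total_weighted_mass_set(2)[OF \<eta> A0 M0])
      then show "measure lebesgue E \<le> 64000000 * 2 ^ i / real n powr (1 / 6)"
        by (simp add: A_def)
      fix t assume t: "t \<in> {0..1} - E"
      have "\<not> energy t N \<le> 4 * 2 ^ i"
      proof
        assume "energy t N \<le> 4 * 2 ^ i"
        then have "A * real M / 8 \<le> total_weighted_mass (1 / (4 * A ^ 3)) m M t"
          using t four_m(1) M_large True Mm
          by (intro total_weighted_mass_ge[where N = N and K = "2 ^ i"]) simp_all
        then show False using t by (auto simp: E_def)
      qed
      then show "cover_length t n \<le> 8 / 2 ^ i"
        using t rN by (intro cover_length_le_if_energy_gt[where N = N]) simp_all
    qed
  qed
qed

section \<open>From slopes to the Favard length\<close>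

lemma position_map_upt:
  "position t (map f [1..<Suc n]) = (\<Sum>j = 1..n. (fst (f j) + t * snd (f j)) / 4 ^ j)"
  by (induction n) (simp_all add: position_append)

lemma sum_quarter_powers: "(\<Sum>j = 1..n. 3 / 2 / 4 ^ j) = (1 - 1 / 4 ^ n) / (2::real)"
  by (induction n) (simp_all add: field_simps)

text \<open>
The interval of \<open>cantor_gen n\<close> with digits \<open>a j\<close> has centre \<open>1 / 2 + 3 / 2 * (\<Sum>j. e j / 4 ^ j)\<close>
with the signs \<open>e j = 2 / 3 * a j - 1\<close>. One word serves for all slopes \<open>t\<close> at once.
\<close>

lemma cantor_gen_cover:
  assumes "x \<in> cantor_gen n" "y \<in> cantor_gen n"
  obtains w where "w \<in> words n"
    "\<And>t. \<bar>t\<bar> \<le> 1 \<Longrightarrow> (x + t * y - (1 + t) / 2) * (2 / 3) \<in> word_interval t w"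
proof -
  obtain a where a: "a \<in> {1..n} \<rightarrow>\<^sub>E {0, 3}" "(\<Sum>j = 1..n. a j / 4 ^ j) \<le> x"
      "x \<le> (\<Sum>j = 1..n. a j / 4 ^ j) + 1 / 4 ^ n"
    using assms(1) by (auto simp: cantor_gen_def)
  obtain b where b: "b \<in> {1..n} \<rightarrow>\<^sub>E {0, 3}" "(\<Sum>j = 1..n. b j / 4 ^ j) \<le> y"
      "y \<le> (\<Sum>j = 1..n. b j / 4 ^ j) + 1 / 4 ^ n"
    using assms(2) by (auto simp: cantor_gen_def)
  \<comment> \<open>The signs that correspond to the digits \<open>0\<close> and \<open>3\<close>.\<close>
  define f where "f = (\<lambda>j. (2 / 3 * a j - 1, 2 / 3 * b j - 1))"
  define w where "w = map f [1..<Suc n]"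
  have digit: "f j \<in> digits" if "j \<in> {1..n}" for j
  proof -
    have "a j \<in> {0, 3}" "b j \<in> {0, 3}" using PiE_mem[OF a(1) that] PiE_mem[OF b(1) that] by auto
    then show ?thesis by (auto simp: f_def digits_def)
  qed
  have "w \<in> words n" using digit by (auto simp: w_def words_def)
  moreover have "(x + t * y - (1 + t) / 2) * (2 / 3) \<in> word_interval t w" if t: "\<bar>t\<bar> \<le> 1" for t
  proof -
    define z :: real where "z = 1 / 4 ^ n"
    define X Y where "X = (\<Sum>j = 1..n. a j / 4 ^ j)" and "Y = (\<Sum>j = 1..n. b j / 4 ^ j)"
    have "position t w = (\<Sum>j = 1..n. 2 / 3 * (a j / 4 ^ j) + t * (2 / 3 * (b j / 4 ^ j)) - (1 + t) * (2 / 3 * (3 / 2 / 4 ^ j)))"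
      unfolding w_def position_map_upt by (intro sum.cong refl) (simp add: f_def field_simps)
    also have "\<dots> = 2 / 3 * X + t * (2 / 3 * Y) - (1 + t) * (2 / 3 * ((1 - z) / 2))"
      unfolding X_def Y_def z_def sum_quarter_powers[symmetric]
      by (simp only: sum.distrib sum_subtractf sum_distrib_left)
    finally have p: "(x + t * y - (1 + t) / 2) * (2 / 3) - position t w
        = 2 / 3 * ((x - X - z / 2) + t * (y - Y - z / 2))"
      by (simp add: field_simps)
    have "\<bar>x - X - z / 2\<bar> \<le> z / 2" "\<bar>y - Y - z / 2\<bar> \<le> z / 2"
      using a(2,3) b(2,3) unfolding z_def[symmetric] X_def[symmetric] Y_def[symmetric] abs_le_iff by linarith+
    moreover from this(2) have "\<bar>t * (y - Y - z / 2)\<bar> \<le> 1 * (z / 2)"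
      unfolding abs_mult using t by (intro mult_mono) auto
    ultimately have "\<bar>(x - X - z / 2) + t * (y - Y - z / 2)\<bar> \<le> z"
      by linarith
    then have "\<bar>2 / 3 * ((x - X - z / 2) + t * (y - Y - z / 2))\<bar> \<le> z"
      by (simp add: abs_mult)
    then show ?thesis
      unfolding mem_word_interval p using length_words[OF \<open>w \<in> words n\<close>] by (simp add: z_def)
  qed
  ultimately show thesis using that by blast
qed

text \<open>
Reflecting the second coordinate permutes the words.
\<close>

lemma cover_minus: "cover (- t) n = cover t n"
proof -
  let ?flip = "map (\<lambda>d. (fst d, - snd d)) :: (real \<times> real) list \<Rightarrow> _"
  have flip_position: "position (- t) (?flip w) = position t w" for t w
    by (induction w) auto
  have flip: "?flip w \<in> words n" if "w \<in> words n" for w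
    using that by (force simp: words_def digits_def)
  have "cover t n \<subseteq> cover (- t) n" for t
  proof
    fix x assume "x \<in> cover t n"
    then obtain w where w: "w \<in> words n" "x \<in> word_interval t w" by (auto simp: cover_def)
    then have "x \<in> word_interval (- t) (?flip w)" by (simp add: mem_word_interval flip_position)
    then show "x \<in> cover (- t) n" using flip[OF w(1)] unfolding cover_def by blast
  qed
  from this[of t] this[of "- t"] show ?thesis by auto
qed

lemma cover_length_abs: "cover_length t n = cover_length \<bar>t\<bar> n"
  by (cases "t \<ge> 0") (auto simp: cover_length_def cover_minus)

lemma projection_le_cover_length:
  assumes "\<bar>b\<bar> \<le> \<bar>a\<bar>" "a \<noteq> 0" "\<bar>a\<bar> \<le> 1"
    and P: "P \<subseteq> {a * x + b * y |x y. x \<in> cantor_gen n \<and> y \<in> cantor_gen n}"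
  shows "emeasure lebesgue P \<le> ennreal (3 / 2 * cover_length \<bar>b / a\<bar> n)"
proof -
  define t where "t = b / a"
  have t: "\<bar>t\<bar> \<le> 1" using assms(1,2) by (simp add: t_def divide_le_eq)
  let ?g = "\<lambda>z. a * (1 + t) / 2 + 3 / 2 * a * z"
  have "P \<subseteq> ?g ` cover t n"
  proof
    fix p assume "p \<in> P"
    then obtain x y where xy: "p = a * x + b * y" "x \<in> cantor_gen n" "y \<in> cantor_gen n" using P by blast
    obtain w where w: "w \<in> words n" "(x + t * y - (1 + t) / 2) * (2 / 3) \<in> word_interval t w"
      using cantor_gen_cover[OF xy(2,3)] t by metis
    have "p = ?g ((x + t * y - (1 + t) / 2) * (2 / 3))"
      using assms(2) unfolding xy(1) t_def by (simp add: field_simps)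
    then show "p \<in> ?g ` cover t n" using w unfolding cover_def by blast
  qed
  moreover have "compact (?g ` cover t n)"
    by (intro compact_continuous_image compact_cover continuous_intros)
  ultimately have "emeasure lebesgue P \<le> emeasure lebesgue (?g ` cover t n)"
    by (intro emeasure_mono) (auto dest: lmeasurable_compact fmeasurableD)
  also have "\<dots> = ennreal (3 / 2 * \<bar>a\<bar>) * emeasure lebesgue (cover t n)"
    unfolding emeasure_affine_image by (simp add: abs_mult)
  also have "emeasure lebesgue (cover t n) = ennreal (cover_length t n)"
    unfolding cover_length_def by (rule emeasure_eq_measure2[OF lmeasurable_cover])
  also have "ennreal (3 / 2 * \<bar>a\<bar>) * ennreal (cover_length t n) = ennreal (3 / 2 * \<bar>a\<bar> * cover_length t n)"
    by (intro ennreal_mult[symmetric]) (auto simp: cover_length_nonneg)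
  also have "\<dots> \<le> ennreal (3 / 2 * 1 * cover_length t n)"
    using assms(3) by (intro ennreal_leI mult_right_mono mult_left_mono cover_length_nonneg) auto
  finally show ?thesis unfolding cover_length_abs[of t] by (simp add: t_def)
qed

text \<open>
The factor \<open>a\<close> is meant to be the larger one of cosine and sine; the two coordinates may be exchanged
because the set is a square of one Cantor set.
\<close>

lemma projection_rotated_le:
  assumes "\<bar>b\<bar> \<le> \<bar>a\<bar>" "a \<noteq> 0" "(a = cos \<theta> \<and> b = - sin \<theta>) \<or> (a = - sin \<theta> \<and> b = cos \<theta>)"
  shows "emeasure lebesgue (fst ` rotate_plane \<theta> ` four_corner_gen n)
    \<le> ennreal (3 / 2 * cover_length \<bar>b / a\<bar> n)"
proof (rule projection_le_cover_length[OF assms(1,2)])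
  show "\<bar>a\<bar> \<le> 1" using assms(3) by auto
  show "fst ` rotate_plane \<theta> ` four_corner_gen n
      \<subseteq> {a * x + b * y |x y. x \<in> cantor_gen n \<and> y \<in> cantor_gen n}"
  proof clarsimp
    fix x y assume "(x, y) \<in> four_corner_gen n"
    then have "x \<in> cantor_gen n" "y \<in> cantor_gen n" by (auto simp: four_corner_gen_def)
    moreover have "fst (rotate_plane \<theta> (x, y)) = a * x + b * y \<or> fst (rotate_plane \<theta> (x, y)) = a * y + b * x"
      using assms(3) by (auto simp: rotate_plane_def algebra_simps)
    ultimately show "\<exists>u v. fst (rotate_plane \<theta> (x, y)) = a * u + b * v \<and> u \<in> cantor_gen n \<and> v \<in> cantor_gen n"
      by blast
  qed
qed

text \<open>
Parametrise by the slope \<open>tan \<theta>\<close> where the cosine dominates and by \<open>- cot \<theta>\<close> where the sine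
dominates. The slope then stays in \<open>[-1, 1]\<close>, and both derivatives are at least \<open>1\<close>, so passing to
the slope only increases the integral.
\<close>

lemma favard_le_slope_integral:
  assumes h: "h \<in> borel_measurable borel"
    and le: "\<And>t. 0 \<le> t \<Longrightarrow> t \<le> 1 \<Longrightarrow> ennreal (3 / 2 * cover_length t n) \<le> h t"
  shows "favard_length (four_corner_gen n)
    \<le> 3 * (\<integral>\<^sup>+t. h \<bar>t\<bar> * indicator {-1..1} t \<partial>lborel) / ennreal pi"
proof -
  let ?F = "\<lambda>\<theta>. emeasure lebesgue (fst ` rotate_plane \<theta> ` four_corner_gen n)"
  let ?I = "\<integral>\<^sup>+t. h \<bar>t\<bar> * indicator {-1..1} t \<partial>lborel"
  define T where "T = (\<lambda>\<theta>. h \<bar>tan \<theta>\<bar> * ennreal (inverse ((cos \<theta>)\<^sup>2)))"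
  define U where "U = (\<lambda>\<theta>. h \<bar>- cot \<theta>\<bar> * ennreal (inverse ((sin \<theta>)\<^sup>2)))"
  have habs: "(\<lambda>t. h \<bar>t\<bar>) \<in> borel_measurable borel" using h by measurable
  have meas: "T \<in> borel_measurable borel" "U \<in> borel_measurable borel"
    unfolding T_def U_def tan_def cot_def using h by measurable
  have le_T: "?F \<theta> \<le> T \<theta>" if "\<bar>sin \<theta>\<bar> \<le> \<bar>cos \<theta>\<bar>" "cos \<theta> \<noteq> 0" for \<theta>
  proof -
    have "?F \<theta> \<le> ennreal (3 / 2 * cover_length \<bar>tan \<theta>\<bar> n)"
      using projection_rotated_le[of "- sin \<theta>" "cos \<theta>" \<theta> n] that by (simp add: tan_def)
    also have "\<dots> \<le> h \<bar>tan \<theta>\<bar> * 1" using le[of "\<bar>tan \<theta>\<bar>"] that by (simp add: tan_def divide_le_eq)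
    also have "\<dots> \<le> T \<theta>"
      unfolding T_def using that
      by (intro mult_left_mono) (auto simp: one_le_inverse_iff abs_square_le_1)
    finally show ?thesis .
  qed
  have le_U: "?F \<theta> \<le> U \<theta>" if "\<bar>cos \<theta>\<bar> \<le> \<bar>sin \<theta>\<bar>" "sin \<theta> \<noteq> 0" for \<theta>
  proof -
    have "?F \<theta> \<le> ennreal (3 / 2 * cover_length \<bar>- cot \<theta>\<bar> n)"
      using projection_rotated_le[of "cos \<theta>" "- sin \<theta>" \<theta> n] that by (simp add: cot_def)
    also have "\<dots> \<le> h \<bar>- cot \<theta>\<bar> * 1" using le[of "\<bar>- cot \<theta>\<bar>"] that by (simp add: cot_def divide_le_eq)
    also have "\<dots> \<le> U \<theta>"
      unfolding U_def using that
      by (intro mult_left_mono) (auto simp: one_le_inverse_iff abs_square_le_1)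
    finally show ?thesis .
  qed
  have pointwise: "?F \<theta> * indicator {0..pi} \<theta> \<le> T \<theta> * indicator {0..pi / 4} \<theta>
      + U \<theta> * indicator {pi / 4..3 * pi / 4} \<theta> + T \<theta> * indicator {3 * pi / 4..pi} \<theta>" for \<theta>
  proof -
    have cos_ge: "sqrt 2 / 2 \<le> cos x" and sin_le: "sin x \<le> sqrt 2 / 2" if "0 \<le> x" "x \<le> pi / 4" for x
      using that cos_monotone_0_pi_le[of x "pi / 4"] sin_monotone_2pi_le[of x "pi / 4"]
      by (auto simp: cos_45 sin_45)
    have s2: "0 < sqrt 2 / (2::real)" by simp
    consider "\<theta> \<in> {0..pi / 4}" | "\<theta> \<in> {pi / 4..pi / 2}" | "\<theta> \<in> {pi / 2..3 * pi / 4}"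
      | "\<theta> \<in> {3 * pi / 4..pi}" | "\<theta> \<notin> {0..pi}" by fastforce
    then show ?thesis
    proof cases
      case 1
      then have "\<bar>sin \<theta>\<bar> \<le> \<bar>cos \<theta>\<bar>" "cos \<theta> \<noteq> 0"
        using cos_ge[of \<theta>] sin_le[of \<theta>] sin_ge_zero[of \<theta>] s2 by auto
      from le_T[OF this] 1 show ?thesis by (auto simp: add_increasing2)
    next
      case 2
      then have "\<bar>cos \<theta>\<bar> \<le> \<bar>sin \<theta>\<bar>" "sin \<theta> \<noteq> 0"
        using cos_ge[of "pi / 2 - \<theta>"] sin_le[of "pi / 2 - \<theta>"] cos_ge_zero[of \<theta>] s2
        by (auto simp: cos_diff sin_diff)
      from le_U[OF this] 2 show ?thesis by (auto simp: add_increasing2 add_increasing)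
    next
      case 3
      then have "\<bar>cos \<theta>\<bar> \<le> \<bar>sin \<theta>\<bar>" "sin \<theta> \<noteq> 0"
        using cos_ge[of "\<theta> - pi / 2"] sin_le[of "\<theta> - pi / 2"] sin_ge_zero[of "\<theta> - pi / 2"] s2
        by (auto simp: cos_diff sin_diff)
      from le_U[OF this] 3 show ?thesis by (auto simp: add_increasing2 add_increasing)
    next
      case 4
      then have "\<bar>sin \<theta>\<bar> \<le> \<bar>cos \<theta>\<bar>" "cos \<theta> \<noteq> 0"
        using cos_ge[of "pi - \<theta>"] sin_le[of "pi - \<theta>"] sin_ge_zero[of "pi - \<theta>"] s2 by auto
      from le_T[OF this] 4 show ?thesis by (auto simp: add_increasing2 add_increasing)
    qed simp
  qed
  have range: "(\<integral>\<^sup>+t. h \<bar>t\<bar> * indicator {c..d} t \<partial>lborel) \<le> ?I" if "-1 \<le> c" "d \<le> 1" for c d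
    using that by (intro nn_integral_mono mult_left_mono) (auto simp: indicator_def)
  have I1: "(\<integral>\<^sup>+\<theta>. T \<theta> * indicator {0..pi / 4} \<theta> \<partial>lborel) \<le> ?I"
  proof -
    have nz: "cos \<theta> \<noteq> 0" if "\<theta> \<in> {0..pi / 4}" for \<theta>
      using that cos_gt_zero_pi[of \<theta>] pi_gt_zero by (auto intro!: less_imp_neq[symmetric])
    have "(\<integral>\<^sup>+\<theta>. T \<theta> * indicator {0..pi / 4} \<theta> \<partial>lborel)
        = (\<integral>\<^sup>+t. h \<bar>t\<bar> * indicator {tan 0..tan (pi / 4)} t \<partial>lborel)"
      unfolding T_def
      by (rule nn_integral_substitution_aux[OF habs, symmetric])
         (use nz in \<open>auto intro!: DERIV_tan continuous_intros\<close>)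
    then show ?thesis using range[of 0 1] by (simp add: tan_45)
  qed
  have I2: "(\<integral>\<^sup>+\<theta>. U \<theta> * indicator {pi / 4..3 * pi / 4} \<theta> \<partial>lborel) \<le> ?I"
  proof -
    have nz: "sin \<theta> \<noteq> 0" if "\<theta> \<in> {pi / 4..3 * pi / 4}" for \<theta>
      using that sin_gt_zero[of \<theta>] pi_gt_zero by (auto intro!: less_imp_neq[symmetric])
    have cot1: "- cot (pi / 4) = -1" by (simp add: cot_def sin_45 cos_45)
    have cot3: "- cot (3 * pi / 4) = 1"
    proof -
      have "sin (3 * pi / 4) = sqrt 2 / 2" "cos (3 * pi / 4) = - (sqrt 2 / 2)"
        using sin_pi_minus[of "pi / 4"] cos_pi_minus[of "pi / 4"] sin_45 cos_45 by simp_all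
      then show ?thesis unfolding cot_def by (simp only:) simp
    qed
    have "(\<integral>\<^sup>+\<theta>. U \<theta> * indicator {pi / 4..3 * pi / 4} \<theta> \<partial>lborel)
        = (\<integral>\<^sup>+t. h \<bar>t\<bar> * indicator {- cot (pi / 4)..- cot (3 * pi / 4)} t \<partial>lborel)"
      unfolding U_def
      by (rule nn_integral_substitution_aux[OF habs, symmetric])
         (use nz in \<open>auto intro!: derivative_eq_intros DERIV_cot continuous_intros\<close>)
    then show ?thesis using range[of "-1" 1] by (simp add: cot1 cot3)
  qed
  have I3: "(\<integral>\<^sup>+\<theta>. T \<theta> * indicator {3 * pi / 4..pi} \<theta> \<partial>lborel) \<le> ?I"
  proof -
    have nz: "cos \<theta> \<noteq> 0" if "\<theta> \<in> {3 * pi / 4..pi}" for \<theta>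
    proof -
      have "3 * pi / 4 \<le> \<theta>" "\<theta> \<le> pi" using that by auto
      then have "0 < cos (pi - \<theta>)" by (intro cos_gt_zero_pi) (use pi_gt_zero in linarith)+
      then show ?thesis by simp
    qed
    have tan3: "tan (3 * pi / 4) = -1"
    proof -
      have "tan (3 * pi / 4) = tan (- (pi / 4) + pi)" by simp
      also have "\<dots> = -1" by (simp only: tan_periodic_pi tan_minus tan_45)
      finally show ?thesis .
    qed
    have "(\<integral>\<^sup>+\<theta>. T \<theta> * indicator {3 * pi / 4..pi} \<theta> \<partial>lborel)
        = (\<integral>\<^sup>+t. h \<bar>t\<bar> * indicator {tan (3 * pi / 4)..tan pi} t \<partial>lborel)"
      unfolding T_def
      by (rule nn_integral_substitution_aux[OF habs, symmetric])
         (use nz in \<open>auto intro!: DERIV_tan continuous_intros\<close>)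
    then show ?thesis using range[of "-1" 0] by (simp add: tan3)
  qed
  have "(\<integral>\<^sup>+\<theta>\<in>{0..pi}. ?F \<theta> \<partial>lebesgue)
      \<le> (\<integral>\<^sup>+\<theta>. T \<theta> * indicator {0..pi / 4} \<theta> + U \<theta> * indicator {pi / 4..3 * pi / 4} \<theta>
          + T \<theta> * indicator {3 * pi / 4..pi} \<theta> \<partial>lebesgue)"
    by (intro nn_integral_mono pointwise)
  also have "\<dots> = (\<integral>\<^sup>+\<theta>. T \<theta> * indicator {0..pi / 4} \<theta> + U \<theta> * indicator {pi / 4..3 * pi / 4} \<theta>
          + T \<theta> * indicator {3 * pi / 4..pi} \<theta> \<partial>lborel)"
    by (rule nn_integral_completion)
  also have "\<dots> = (\<integral>\<^sup>+\<theta>. T \<theta> * indicator {0..pi / 4} \<theta> \<partial>lborel)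
      + (\<integral>\<^sup>+\<theta>. U \<theta> * indicator {pi / 4..3 * pi / 4} \<theta> \<partial>lborel)
      + (\<integral>\<^sup>+\<theta>. T \<theta> * indicator {3 * pi / 4..pi} \<theta> \<partial>lborel)"
    using meas by (simp add: nn_integral_add)
  also have "\<dots> \<le> ?I + ?I + ?I" by (intro add_mono I1 I2 I3)
  also have "\<dots> = (1 + 1 + 1) * ?I" by (simp only: distrib_right mult_1_left)
  also have "(1 + 1 + 1 :: ennreal) = 3" by simp
  finally show ?thesis unfolding favard_length_def by (intro divide_right_mono_ennreal)
qed

lemma emeasure_abs_preimage_le:
  assumes "E \<in> sets borel"
  shows "emeasure lborel {t::real. \<bar>t\<bar> \<in> E} \<le> 2 * emeasure lborel E"
proof -
  have neg: "(uminus :: real \<Rightarrow> real) -` E \<in> sets borel"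
    using assms by (intro measurable_sets_borel[of _ borel]) auto
  have "{t. \<bar>t\<bar> \<in> E} \<subseteq> E \<union> uminus -` E" by (auto simp: abs_if)
  then have "emeasure lborel {t. \<bar>t\<bar> \<in> E} \<le> emeasure lborel (E \<union> uminus -` E)"
    using assms neg by (intro emeasure_mono) auto
  also have "\<dots> \<le> emeasure lborel E + emeasure lborel (uminus -` E)"
    using assms neg by (intro emeasure_subadditive) auto
  also have "emeasure lborel (uminus -` E) = emeasure lborel E"
  proof -
    have "emeasure lborel E = emeasure (distr lborel borel uminus) E"
      by (simp add: lborel_distr_uminus)
    also have "\<dots> = emeasure lborel (uminus -` E)"
      using assms by (subst emeasure_distr) auto
    finally show ?thesis by simp
  qed
  also have "emeasure lborel E + emeasure lborel E = (1 + 1) * emeasure lborel E"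
    by (simp only: distrib_right mult_1_left)
  finally show ?thesis by simp
qed

text \<open>
At a slope \<open>t\<close>, use the bound of the index preceding the first exceptional set that contains \<open>t\<close>; for
the first index the trivial bound \<open>2\<close> suffices.
\<close>

lemma dyadic_superposition:
  assumes M: "1 \<le> M"
    and E: "\<And>i t. 1 \<le> i \<Longrightarrow> i \<le> M \<Longrightarrow> t \<in> {0..1} - E i \<Longrightarrow> cover_length t n \<le> 8 / 2 ^ i"
    and t: "0 \<le> t" "t \<le> 1"
  shows "cover_length t n \<le> 8 / 2 ^ M + (\<Sum>i = 1..M. 16 / 2 ^ i * indicator (E i) t)"
proof -
  have nonneg: "0 \<le> 16 / 2 ^ i * indicat_real (E i) t" for i by simp
  show ?thesis
  proof (cases "\<exists>i\<in>{1..M}. t \<in> E i")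
    case False
    then have "cover_length t n \<le> 8 / 2 ^ M" using M t by (intro E) auto
    then show ?thesis using nonneg by (simp add: add_increasing2 sum_nonneg)
  next
    case True
    define j where "j = (LEAST i. i \<in> {1..M} \<and> t \<in> E i)"
    have j: "j \<in> {1..M}" "t \<in> E j"
      using LeastI_ex[of "\<lambda>i. i \<in> {1..M} \<and> t \<in> E i"] True unfolding j_def by blast+
    have "cover_length t n \<le> 16 / 2 ^ j"
    proof (cases "j = 1")
      case True
      then show ?thesis using cover_length_le_2[of t n] t by simp
    next
      case False
      have "j - 1 < j" using j(1) by simp
      then have "\<not> (j - 1 \<in> {1..M} \<and> t \<in> E (j - 1))" unfolding j_def by (rule not_less_Least)
      then have "t \<notin> E (j - 1)" using j(1) False by auto
      then have "cover_length t n \<le> 8 / 2 ^ (j - 1)" using j(1) False t by (intro E) auto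
      also have "\<dots> = 16 / 2 ^ j" using j(1) by (simp add: power_diff)
      finally show ?thesis .
    qed
    also have "\<dots> = 16 / 2 ^ j * indicator (E j) t" using j(2) by simp
    also have "\<dots> \<le> (\<Sum>i = 1..M. 16 / 2 ^ i * indicator (E i) t)"
      by (rule member_le_sum) (use j(1) nonneg in auto)
    finally show ?thesis by (simp add: add_increasing)
  qed
qed

lemma nn_integral_sum_indicators:
  fixes c :: ennreal and d :: "'i \<Rightarrow> ennreal"
  assumes "A \<in> sets M" "\<And>i. i \<in> I \<Longrightarrow> S i \<in> sets M"
  shows "(\<integral>\<^sup>+x. c * indicator A x + (\<Sum>i\<in>I. d i * indicator (S i) x) \<partial>M)
    = c * emeasure M A + (\<Sum>i\<in>I. d i * emeasure M (S i))"
proof -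
  have meas: "(\<lambda>x. d i * indicator (S i) x) \<in> borel_measurable M" if "i \<in> I" for i
    using assms(2)[OF that] by measurable
  have "(\<integral>\<^sup>+x. c * indicator A x + (\<Sum>i\<in>I. d i * indicator (S i) x) \<partial>M)
      = (\<integral>\<^sup>+x. c * indicator A x \<partial>M) + (\<integral>\<^sup>+x. (\<Sum>i\<in>I. d i * indicator (S i) x) \<partial>M)"
    using assms(1) meas by (intro nn_integral_add borel_measurable_sum) auto
  also have "(\<integral>\<^sup>+x. (\<Sum>i\<in>I. d i * indicator (S i) x) \<partial>M) = (\<Sum>i\<in>I. \<integral>\<^sup>+x. d i * indicator (S i) x \<partial>M)"
    by (rule nn_integral_sum) (rule meas)
  finally show ?thesis using assms by (simp add: nn_integral_cmult_indicator)
qed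

text \<open>
The set number \<open>i\<close> has measure of order \<open>2 ^ i * n powr (- 1 / 6)\<close> and enters with the factor
\<open>16 / 2 ^ i\<close>, so every dyadic level contributes equally.
\<close>

lemma favard_four_corner_le:
  assumes n: "1 \<le> n" and M: "1 \<le> M"
  shows "favard_length (four_corner_gen n)
    \<le> ennreal (72 / 2 ^ M + 9216000000 * real M / real n powr (1 / 6))"
proof -
  have "\<forall>i. \<exists>E. 1 \<le> i \<longrightarrow> compact E \<and>
      measure lebesgue E \<le> 64000000 * 2 ^ i / real n powr (1 / 6) \<and>
      (\<forall>t\<in>{0..1} - E. cover_length t n \<le> 8 / 2 ^ i)"
    using few_bad_directions[OF _ n] by metis
  then obtain E where E: "\<And>i. 1 \<le> i \<Longrightarrow> compact (E i)"
      "\<And>i. 1 \<le> i \<Longrightarrow> measure lebesgue (E i) \<le> 64000000 * 2 ^ i / real n powr (1 / 6)"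
      "\<And>i t. 1 \<le> i \<Longrightarrow> t \<in> {0..1} - E i \<Longrightarrow> cover_length t n \<le> 8 / 2 ^ i"
    by metis
  define h where "h = (\<lambda>t. ennreal (12 / 2 ^ M) + (\<Sum>i = 1..M. ennreal (24 / 2 ^ i) * indicator (E i) t))"
  have E_meas: "E i \<in> sets borel" if "i \<in> {1..M}" for i
    using E(1)[of i] that by (auto intro: borel_compact)
  have h_meas: "h \<in> borel_measurable borel"
    unfolding h_def using E_meas by (intro borel_measurable_add borel_measurable_sum borel_measurable_times) auto
  have h_ge: "ennreal (3 / 2 * cover_length t n) \<le> h t" if t: "0 \<le> t" "t \<le> 1" for t
  proof -
    have "3 / 2 * cover_length t n \<le> 3 / 2 * (8 / 2 ^ M + (\<Sum>i = 1..M. 16 / 2 ^ i * indicator (E i) t))"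
      using E(3) t by (intro mult_left_mono dyadic_superposition M) auto
    also have "\<dots> = 12 / 2 ^ M + (\<Sum>i = 1..M. 24 / 2 ^ i * indicator (E i) t)"
      by (simp add: distrib_left sum_distrib_left mult.assoc[symmetric])
    finally have "ennreal (3 / 2 * cover_length t n)
        \<le> ennreal (12 / 2 ^ M + (\<Sum>i = 1..M. 24 / 2 ^ i * indicator (E i) t))"
      by (rule ennreal_leI)
    also have "\<dots> = ennreal (12 / 2 ^ M) + (\<Sum>i = 1..M. ennreal (24 / 2 ^ i * indicator (E i) t))"
      by (subst ennreal_plus) (auto intro!: sum_nonneg simp: sum_ennreal)
    also have "\<dots> = h t"
      unfolding h_def by (intro arg_cong2[where f = "(+)"] sum.cong refl) (auto simp: indicator_def)
    finally show ?thesis .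
  qed
  have piece: "emeasure lborel ({t. \<bar>t\<bar> \<in> E i} \<inter> {-1..1}) \<le> ennreal (128000000 * 2 ^ i / real n powr (1 / 6))"
    if "i \<in> {1..M}" for i
  proof -
    have "emeasure lborel ({t. \<bar>t\<bar> \<in> E i} \<inter> {-1..1}) \<le> emeasure lborel {t. \<bar>t\<bar> \<in> E i}"
      using measurable_sets_borel[OF borel_measurable_abs[OF measurable_ident] E_meas[OF that]]
      by (intro emeasure_mono) (auto simp: vimage_def)
    also have "\<dots> \<le> 2 * emeasure lborel (E i)"
      by (rule emeasure_abs_preimage_le[OF E_meas[OF that]])
    also have "emeasure lborel (E i) = ennreal (measure lebesgue (E i))"
      using emeasure_eq_measure2[OF lmeasurable_compact[OF E(1)[of i]]] that E_meas[OF that]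
      by (simp add: emeasure_completion)
    also have "\<dots> \<le> ennreal (64000000 * 2 ^ i / real n powr (1 / 6))"
      using E(2)[of i] that by (intro ennreal_leI) auto
    also have "2 * ennreal (64000000 * 2 ^ i / real n powr (1 / 6)) = ennreal (128000000 * 2 ^ i / real n powr (1 / 6))"
      by (subst ennreal_numeral[symmetric], subst ennreal_mult[symmetric]) auto
    finally show ?thesis by (simp add: mult_left_mono)
  qed
  have "(\<integral>\<^sup>+t. h \<bar>t\<bar> * indicator {-1..1} t \<partial>lborel)
      = (\<integral>\<^sup>+t. ennreal (12 / 2 ^ M) * indicator {-1..1} t
          + (\<Sum>i = 1..M. ennreal (24 / 2 ^ i) * indicator ({t. \<bar>t\<bar> \<in> E i} \<inter> {-1..1}) t) \<partial>lborel)"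
  proof (rule nn_integral_cong)
    fix t :: real
    show "h \<bar>t\<bar> * indicator {-1..1} t = ennreal (12 / 2 ^ M) * indicator {-1..1} t
          + (\<Sum>i = 1..M. ennreal (24 / 2 ^ i) * indicator ({t. \<bar>t\<bar> \<in> E i} \<inter> {-1..1}) t)"
    proof (cases "t \<in> {-1..1}")
      case True
      then have "indicator ({t. \<bar>t\<bar> \<in> E i} \<inter> {-1..1}) t = (indicator (E i) \<bar>t\<bar> :: ennreal)" for i
        by (simp add: indicator_def)
      then show ?thesis using True by (simp add: h_def)
    qed simp
  qed
  also have "\<dots> = ennreal (12 / 2 ^ M) * emeasure lborel {-1..1::real}
      + (\<Sum>i = 1..M. ennreal (24 / 2 ^ i) * emeasure lborel ({t. \<bar>t\<bar> \<in> E i} \<inter> {-1..1}))"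
  proof -
    have "{t. \<bar>t\<bar> \<in> E i} \<inter> {-1..1} \<in> sets borel" if "i \<in> {1..M}" for i
      using measurable_sets_borel[OF borel_measurable_abs[OF measurable_ident] E_meas[OF that]]
      by (intro sets.Int) (auto simp: vimage_def)
    then show ?thesis by (intro nn_integral_sum_indicators) auto
  qed
  also have "\<dots> \<le> ennreal (12 / 2 ^ M) * ennreal 2
      + (\<Sum>i = 1..M. ennreal (24 / 2 ^ i) * ennreal (128000000 * 2 ^ i / real n powr (1 / 6)))"
    using piece by (intro add_mono mult_left_mono sum_mono) auto
  also have "\<dots> = ennreal (24 / 2 ^ M) + (\<Sum>i = 1..M. ennreal (3072000000 / real n powr (1 / 6)))"
    by (intro arg_cong2[where f = "(+)"] sum.cong refl) (subst ennreal_mult[symmetric]; simp)+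
  also have "\<dots> = ennreal (24 / 2 ^ M + 3072000000 * real M / real n powr (1 / 6))"
    by (subst sum_ennreal; simp add: ennreal_plus[symmetric] mult.commute del: ennreal_plus)
  finally have slope: "(\<integral>\<^sup>+t. h \<bar>t\<bar> * indicator {-1..1} t \<partial>lborel)
      \<le> ennreal (24 / 2 ^ M + 3072000000 * real M / real n powr (1 / 6))" (is "_ \<le> ennreal ?B") .
  have "favard_length (four_corner_gen n)
      \<le> 3 * (\<integral>\<^sup>+t. h \<bar>t\<bar> * indicator {-1..1} t \<partial>lborel) / ennreal pi"
    by (rule favard_le_slope_integral[OF h_meas h_ge])
  also have "\<dots> \<le> 3 * ennreal ?B / ennreal pi"
    by (intro divide_right_mono_ennreal mult_left_mono slope) simp
  also have "3 * ennreal ?B = ennreal (3 * ?B)"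
    by (subst ennreal_numeral[symmetric], rule ennreal_mult[symmetric]) auto
  also have "ennreal (3 * ?B) / ennreal pi = ennreal (3 * ?B / pi)"
    by (rule divide_ennreal) auto
  also have "\<dots> \<le> ennreal (3 * ?B)"
  proof (rule ennreal_leI)
    have "3 * ?B * 1 \<le> 3 * ?B * pi" using pi_ge_two by (intro mult_left_mono) auto
    then show "3 * ?B / pi \<le> 3 * ?B" by (simp add: divide_le_eq)
  qed
  finally show ?thesis by (simp add: algebra_simps)
qed

theorem theorem1:
  fixes \<delta> :: real
  assumes "\<delta> > 0"
  shows "\<exists>C::real. C > 0 \<and>
    (\<forall>n::nat. n \<ge> 1 \<longrightarrow> favard_length (four_corner_gen n) \<le> ennreal (C * real n powr (\<delta> - 1 / 6)))"
proof -
  define C where "C = 72 + 9216000000 * (1 / (\<delta> * ln 2) + 2)"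
  have "C > 0" using assms by (simp add: C_def add_pos_nonneg)
  moreover have "favard_length (four_corner_gen n) \<le> ennreal (C * real n powr (\<delta> - 1 / 6))"
    if n: "n \<ge> 1" for n :: nat
  proof -
    \<comment> \<open>Enough levels for \<open>2 ^ M \<ge> n\<close>; there are only logarithmically many, which \<open>n powr \<delta>\<close> absorbs.\<close>
    define M where "M = nat \<lceil>log 2 (real n)\<rceil> + 1"
    have log0: "0 \<le> log 2 (real n)" using n by simp
    have M_bounds: "log 2 (real n) \<le> real M" "real M \<le> log 2 (real n) + 2"
      unfolding M_def using log0 by linarith+
    have n\<delta>: "1 \<le> real n powr \<delta>" using n assms by (simp add: ge_one_powr_ge_zero)
    have "real n = 2 powr log 2 (real n)" using n by simp
    also have "\<dots> \<le> 2 powr real M" using M_bounds(1) by (intro powr_mono) auto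
    finally have "real n \<le> 2 ^ M" by (simp add: powr_realpow)
    moreover have "real n powr (1 / 6) \<le> real n" using powr_mono[of "1 / 6" 1 "real n"] n by simp
    ultimately have "real n powr (1 / 6) \<le> 2 ^ M" by linarith
    then have "72 / 2 ^ M \<le> 72 / real n powr (1 / 6)" using n by (intro divide_left_mono) auto
    also have "\<dots> \<le> 72 * real n powr \<delta> / real n powr (1 / 6)"
      using n\<delta> by (intro divide_right_mono) auto
    finally have "72 / 2 ^ M \<le> 72 * real n powr \<delta> / real n powr (1 / 6)" .
    moreover have "real M \<le> (1 / (\<delta> * ln 2) + 2) * real n powr \<delta>"
    proof -
      have "ln (real n) \<le> real n powr \<delta> / \<delta>" using n assms by (intro ln_powr_bound) auto
      then have "log 2 (real n) \<le> real n powr \<delta> / \<delta> / ln 2"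
        unfolding log_def by (intro divide_right_mono) auto
      then show ?thesis using M_bounds(2) n\<delta> by (simp add: distrib_right)
    qed
    then have "9216000000 * real M / real n powr (1 / 6)
        \<le> 9216000000 * ((1 / (\<delta> * ln 2) + 2) * real n powr \<delta>) / real n powr (1 / 6)"
      by (intro divide_right_mono mult_left_mono) auto
    ultimately have "72 / 2 ^ M + 9216000000 * real M / real n powr (1 / 6)
        \<le> C * real n powr \<delta> / real n powr (1 / 6)"
      by (simp add: C_def distrib_right add_divide_distrib)
    also have "\<dots> = C * real n powr (\<delta> - 1 / 6)"
      by (simp add: powr_diff)
    finally show ?thesis
      using order_trans[OF favard_four_corner_le[OF n, of M] ennreal_leI] by (simp add: M_def)
  qed
  ultimately show ?thesis by blast
qed

end
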